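(* In the setting described in the context, let $P_\varepsilon^t\colon U_\varepsilon^t\to V_\varepsilon^t$, $P_\varepsilon^t(x)=\Phi_\varepsilon(T;x,t)$, be the time-$T$-map of $\mathcal{Z}_\varepsilon$. For sufficiently small $\varepsilon>0$ the following hold: (a) $P_\varepsilon^t$ is a homeomorphism for every $t\in\mathbb{S}^1$; (b) for every $t\in\mathbb{S}^1$, $P_\varepsilon^t$ is a diffeomorphism in $U_\varepsilon^t\setminus\bigl(\Omega^t\cup (P_\varepsilon^t)^{-1}(\Omega^t)\bigr)$ (onto its image).
   Context: Smooth means $\mathcal{C}^\infty$. Piecewise smooth vector fields. Let $n\geq 2$, $N\ge 1$, $h_1,\dots,h_N\colon\mathbb{R}^n\to\mathbb{R}$ smooth ($0$ need not be a regular value), $\Sigma_i=h_i^{-1}(\{0\})$, $\Sigma=\bigcup_i\Sigma_i$ (switching set), and let $A_1,\dots,A_k$ ($k\ge2$) be the connected components of $\mathbb{R}^n\setminus\Sigma$. An autonomous piecewise smooth vector field $Z_0=(X_0^1,\dots,X_0^k)$ consists of smooth vector fields $X_0^j$, each defined in a neighborhood of $\overline{A_j}$. A point $x_0\in\Sigma$ is a crossing point if: (i) $x_0\in\Sigma_i$ for a unique $i$; (ii) $\nabla h_i(x_0)\ne0$; (iii) $\langle X_0^a(x_0),\nabla h_i(x_0)\rangle\,\langle X_0^b(x_0),\nabla h_i(x_0)\rangle>0$, where $X_0^a,X_0^b$ are the two components with $x_0\in\overline{A_a}\cap\overline{A_b}$. Trajectories follow $X_0^j$ in $A_j$, and at a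 crossing point they are continued by concatenating the trajectories of the two components there. Only arcs of orbit meeting the switching set solely at crossing points are considered. Homoclinic connection. $p_0\in\mathbb{R}^n\setminus\Sigma$ is a hyperbolic singularity of saddle type of $Z_0$, $q_0\in (W^s(p_0)\cap W^u(p_0))\setminus\{p_0\}$ is a homoclinic point whose orbit $\gamma_{q_0}$ meets $\Sigma$ only at crossing points, and $\Gamma=\{p_0\}\cup\gamma_{q_0}$. Perturbation. Let $T>0$, $\mathbb{S}^1=\mathbb{R}/T\mathbb{Z}$, and let $X_1^j(x,t)$ be smooth and $T$-periodic in $t$. For $\varepsilon\geq0$, $\mathcal{Z}_\varepsilon$ is the autonomous piecewise smooth vector field on $\mathbb{R}^n\times\mathbb{S}^1$ with components $\dot x=X_0^j(x)+\varepsilon X_1^j(x,t)$, $\dot t=1$ on (a neighborhood of) $\overline{A_j}\times\mathbb{S}^1$ and switching set $\Omega=\Sigma\times\mathbb{S}^1$ (given by the functions $(x,t)\mapsto h_i(x)$; crossing points are defined as before). Its solution with $\Phi_\varepsilon(0;x,t)=(x,t)$, along arcs meeting $\Omega$ only at crossing points, is denoted $\Phi_\varepsilon(\tau;x,t)=\Phi_\varepsilon^\tau(x,t)$. $\Omega^t=\Sigma\times\{t\}$; points $(x,t)$ of a fixed slice $\mathbb{R}^n\times\{t\}$ are identified with $x$. Domains. For $\varepsilon>0$ small there is an open neighborhood $U_\varepsilon^0$ of $\Gamma\times\{0\}$ in $\mathbb{R}^n\times\{0\}$ such that, with $U_\varepsilon^t:=\Phi_\varepsilon^t(U_\varepsilon^0)$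 for $t\in[0,T)$ and $\mathcal{U}_\varepsilon:=\bigcup_{t\in[0,T)}U^t_\varepsilon$, each $U_\varepsilon^t$ is a neighborhood of $\Gamma\times\{t\}$ in its slice and for every $(x,t)\in\mathcal{U}_\varepsilon$ the solution $\Phi_\varepsilon(\tau;x,t)$ is well defined for $\tau\in[-T,T]$ and meets $\Omega$ only at crossing points. $V_\varepsilon^t:=P_\varepsilon^t(U_\varepsilon^t)\subset\mathbb{R}^n\times\{t\}$. *)

theory Defs
  imports "HOL-Analysis.Analysis"
begin

section \<open>Smooth maps and diffeomorphisms\<close>

fun Ck_on :: "nat \<Rightarrow> ('a::real_normed_vector) set \<Rightarrow> ('a \<Rightarrow> 'b::real_normed_vector) \<Rightarrow> bool" where
  "Ck_on 0 S f \<longleftrightarrow> continuous_on S f"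
| "Ck_on (Suc m) S f \<longleftrightarrow>
     (\<forall>x\<in>S. f differentiable (at x)) \<and> (\<forall>v. Ck_on m S (\<lambda>x. frechet_derivative f (at x) v))"

text \<open>Derivatives are taken in the ambient space (\<open>at x\<close>, not \<open>at x within S\<close>), so this is
  meaningful for open \<open>S\<close> only; it is used for open sets throughout.\<close>

definition smooth_on :: "('a::real_normed_vector) set \<Rightarrow> ('a \<Rightarrow> 'b::real_normed_vector) \<Rightarrow> bool" where
  "smooth_on S f \<longleftrightarrow> (\<forall>m. Ck_on m S f)"

definition diffeomorphism ::
    "('a::real_normed_vector) set \<Rightarrow> ('b::real_normed_vector) set \<Rightarrow> ('a \<Rightarrow> 'b) \<Rightarrow> ('b \<Rightarrow> 'a) \<Rightarrow> bool" where
  "diffeomorphism S S' f g \<longleftrightarrow>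
     open S \<and> open S' \<and> homeomorphism S S' f g \<and> smooth_on S f \<and> smooth_on S' g"

definition gradient :: "('a::real_inner \<Rightarrow> real) \<Rightarrow> 'a \<Rightarrow> 'a" where
  "gradient f x = (THE D. GDERIV f x :> D)"

section \<open>Piecewise smooth vector fields\<close>

text \<open>The switching functions are indexed by \<open>{1..sw_num Z}\<close>, the regions (connected components of
  the complement of the switching set) and the vector fields on them by \<open>{1..reg_num Z}\<close>.\<close>

record 'a pws =
  sw_num :: nat
  sw_fun :: "nat \<Rightarrow> 'a \<Rightarrow> real"
  reg_num :: nat
  region :: "nat \<Rightarrow> 'a set"
  vfield :: "nat \<Rightarrow> 'a \<Rightarrow> 'a"

definition switching_set :: "'a pws \<Rightarrow> 'a set" where
  "switching_set Z = (\<Union>i\<in>{1..sw_num Z}. {x. sw_fun Z i x = 0})"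

definition piecewise_smooth :: "('a::euclidean_space) pws \<Rightarrow> bool" where
  "piecewise_smooth Z \<longleftrightarrow>
     1 \<le> sw_num Z \<and> (\<forall>i\<in>{1..sw_num Z}. smooth_on UNIV (sw_fun Z i)) \<and>
     2 \<le> reg_num Z \<and> bij_betw (region Z) {1..reg_num Z} (components (- switching_set Z)) \<and>
     (\<forall>j\<in>{1..reg_num Z}. \<exists>W. open W \<and> closure (region Z j) \<subseteq> W \<and> smooth_on W (vfield Z j))"

definition crossing_point :: "('a::euclidean_space) pws \<Rightarrow> 'a \<Rightarrow> bool" where
  "crossing_point Z x \<longleftrightarrow>
     (\<exists>i. {l\<in>{1..sw_num Z}. sw_fun Z l x = 0} = {i} \<and>
        gradient (sw_fun Z i) x \<noteq> 0 \<and>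
        (\<exists>a b. a \<noteq> b \<and> {j\<in>{1..reg_num Z}. x \<in> closure (region Z j)} = {a, b} \<and>
           (vfield Z a x \<bullet> gradient (sw_fun Z i) x) * (vfield Z b x \<bullet> gradient (sw_fun Z i) x) > 0))"

text \<open>\<open>pws_solution Z \<phi> I\<close>: on the interval \<open>I\<close>, \<open>\<phi>\<close> is an arc of trajectory that meets the
  switching set at crossing points only. At a crossing point a trajectory of the field of one
  region and a trajectory of the field of another one are concatenated. If \<open>t\<close> is an endpoint of \<open>I\<close>
  then the conditions on the missing side are void.\<close>

definition pws_solution :: "('a::euclidean_space) pws \<Rightarrow> (real \<Rightarrow> 'a) \<Rightarrow> real set \<Rightarrow> bool" where
  "pws_solution Z \<phi> I \<longleftrightarrow> is_interval I \<and>
     (\<forall>t\<in>I.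
        (\<exists>j\<in>{1..reg_num Z}. \<phi> t \<in> region Z j \<and>
           (\<phi> has_vector_derivative vfield Z j (\<phi> t)) (at t within I)) \<or>
        (crossing_point Z (\<phi> t) \<and>
           (\<exists>a\<in>{1..reg_num Z}. \<exists>b\<in>{1..reg_num Z}. \<exists>d>0. a \<noteq> b \<and>
              \<phi> ` (I \<inter> {t-d<..<t}) \<subseteq> region Z a \<and>
              \<phi> ` (I \<inter> {t<..<t+d}) \<subseteq> region Z b \<and>
              (\<phi> has_vector_derivative vfield Z a (\<phi> t)) (at t within (I \<inter> {..t})) \<and>
              (\<phi> has_vector_derivative vfield Z b (\<phi> t)) (at t within (I \<inter> {t..})))))"

definition solution_exists :: "('a::euclidean_space) pws \<Rightarrow> real set \<Rightarrow> 'a \<Rightarrow> bool" where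
  "solution_exists Z I z \<longleftrightarrow> (\<exists>\<phi>. pws_solution Z \<phi> I \<and> \<phi> 0 = z)"

text \<open>Only meaningful if \<open>solution_exists Z (closed_segment 0 \<tau>) z\<close>.\<close>

definition pws_flow :: "('a::euclidean_space) pws \<Rightarrow> real \<Rightarrow> 'a \<Rightarrow> 'a" where
  "pws_flow Z \<tau> z = (THE y. \<exists>\<phi>. pws_solution Z \<phi> (closed_segment 0 \<tau>) \<and> \<phi> 0 = z \<and> \<phi> \<tau> = y)"

definition orbit :: "('a::euclidean_space) pws \<Rightarrow> 'a \<Rightarrow> 'a set" where
  "orbit Z z = {pws_flow Z \<tau> z | \<tau>. solution_exists Z (closed_segment 0 \<tau>) z}"

definition stable_manifold :: "('a::euclidean_space) pws \<Rightarrow> 'a \<Rightarrow> 'a set" where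
  "stable_manifold Z p = {q. \<exists>\<phi>. pws_solution Z \<phi> {0..} \<and> \<phi> 0 = q \<and> (\<phi> \<longlongrightarrow> p) at_top}"

definition unstable_manifold :: "('a::euclidean_space) pws \<Rightarrow> 'a \<Rightarrow> 'a set" where
  "unstable_manifold Z p = {q. \<exists>\<phi>. pws_solution Z \<phi> {..0} \<and> \<phi> 0 = q \<and> (\<phi> \<longlongrightarrow> p) at_bot}"

definition complex_eigenvalue :: "real^'n^'n \<Rightarrow> complex \<Rightarrow> bool" where
  "complex_eigenvalue M \<mu> \<longleftrightarrow> (\<exists>v. v \<noteq> 0 \<and> map_matrix complex_of_real M *v v = \<mu> *s v)"

definition hyperbolic_saddle :: "(real^'n) pws \<Rightarrow> real^'n \<Rightarrow> bool" where
  "hyperbolic_saddle Z p \<longleftrightarrow>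
     (\<exists>j\<in>{1..reg_num Z}. p \<in> region Z j \<and> vfield Z j p = 0 \<and>
        (let M = jacobian (vfield Z j) (at p) in
           (\<forall>\<mu>. complex_eigenvalue M \<mu> \<longrightarrow> Re \<mu> \<noteq> 0) \<and>
           (\<exists>\<mu>. complex_eigenvalue M \<mu> \<and> Re \<mu> < 0) \<and>
           (\<exists>\<mu>. complex_eigenvalue M \<mu> \<and> Re \<mu> > 0)))"

section \<open>Periodic perturbations\<close>

definition periodic_perturbation ::
    "('a::euclidean_space) pws \<Rightarrow> real \<Rightarrow> (nat \<Rightarrow> 'a \<Rightarrow> real \<Rightarrow> 'a) \<Rightarrow> bool" where
  "periodic_perturbation Z T X1 \<longleftrightarrow>
     (\<forall>j\<in>{1..reg_num Z}. \<exists>W. open W \<and> closure (region Z j) \<subseteq> W \<and>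
        smooth_on (W \<times> UNIV) (\<lambda>(x, t). X1 j x t) \<and>
        (\<forall>x\<in>W. \<forall>t. X1 j x (t + T) = X1 j x t))"

text \<open>The circle of circumference \<open>T\<close> is replaced by its universal cover: the perturbed system lives
  on \<open>'a \<times> real\<close> and is \<open>T\<close>-periodic in the last variable. A point of the circle is
  represented by its unique representative in \<open>{0..<T}\<close>.\<close>

definition perturbed ::
    "('a::euclidean_space) pws \<Rightarrow> (nat \<Rightarrow> 'a \<Rightarrow> real \<Rightarrow> 'a) \<Rightarrow> real \<Rightarrow> ('a \<times> real) pws" where
  "perturbed Z X1 \<epsilon> =
     \<lparr>sw_num = sw_num Z,
      sw_fun = (\<lambda>i (x, t). sw_fun Z i x),
      reg_num = reg_num Z,
      region = (\<lambda>j. region Z j \<times> UNIV),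
      vfield = (\<lambda>j (x, t). (vfield Z j x + \<epsilon> *\<^sub>R X1 j x t, 1))\<rparr>"

definition time_slice ::
    "('a::euclidean_space) pws \<Rightarrow> (nat \<Rightarrow> 'a \<Rightarrow> real \<Rightarrow> 'a) \<Rightarrow> real \<Rightarrow> 'a set \<Rightarrow> real \<Rightarrow> 'a set" where
  "time_slice Z X1 \<epsilon> U0 t = (\<lambda>x. fst (pws_flow (perturbed Z X1 \<epsilon>) t (x, 0))) ` U0"

text \<open>The first component is all that is needed: the flow for time \<open>T\<close> takes the slice over \<open>t\<close> to
  the one over \<open>t + T\<close>, and these are the same slice over the circle.\<close>

definition time_T_map ::
    "('a::euclidean_space) pws \<Rightarrow> (nat \<Rightarrow> 'a \<Rightarrow> real \<Rightarrow> 'a) \<Rightarrow> real \<Rightarrow> real \<Rightarrow> real \<Rightarrow> 'a \<Rightarrow> 'a" where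
  "time_T_map Z X1 T \<epsilon> t x = fst (pws_flow (perturbed Z X1 \<epsilon>) T (x, t))"

text \<open>The condition on the points \<open>(x, 0)\<close> with \<open>x \<in> U0\<close> makes \<open>pws_flow\<close> meaningful in \<open>time_slice\<close>;
  it entails that the slice at time \<open>0\<close> is \<open>U0\<close>.\<close>

definition admissible_domain ::
    "('a::euclidean_space) pws \<Rightarrow> (nat \<Rightarrow> 'a \<Rightarrow> real \<Rightarrow> 'a) \<Rightarrow> real \<Rightarrow> 'a set \<Rightarrow> real \<Rightarrow> 'a set \<Rightarrow> bool" where
  "admissible_domain Z X1 T \<Gamma> \<epsilon> U0 \<longleftrightarrow>
     open U0 \<and> \<Gamma> \<subseteq> U0 \<and>
     (\<forall>x\<in>U0. solution_exists (perturbed Z X1 \<epsilon>) {-T..T} (x, 0)) \<and>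
     (\<forall>t\<in>{0..<T}. \<Gamma> \<subseteq> interior (time_slice Z X1 \<epsilon> U0 t) \<and>
        (\<forall>x\<in>time_slice Z X1 \<epsilon> U0 t. solution_exists (perturbed Z X1 \<epsilon>) {-T..T} (x, t)))"

end

theory Submission
  imports Defs
begin

text \<open>
  A solution meets the switching set at crossing points only, and near such a point both fields point
  to the same side of a smooth hypersurface. Hence the direction in which a solution leaves is
  determined by the point, and solutions are unique. Near a crossing point the trajectories are
  obtained by following the flow of the incoming field up to the time of crossing, which is a smooth
  function of the starting point by the implicit function theorem, and then the flow of the outgoing
  field. Composing finitely many such local flows along a compact arc shows that the set of starting
  points is open, that the flow for a fixed time is continuous, and that it is smooth when both
  end points are off the switching set, because the intermediate points can be chosen there too. The
  reversed field gives the inverse map with the same properties.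

  Smoothness of the flow of a smooth field is proved for equations \<open>y' = G (t, p, y)\<close> with a parameter:
  a directional derivative of the solution in \<open>p\<close> solves an equation of the same kind (on the same
  types), which allows an induction on the order of differentiability.
\<close>

section \<open>Calculus of maps of class C^k\<close>

text \<open>The obstacle is the loss of smoothness on the switching set. Near a crossing point the
  local flow contains the crossing time truncated to the elapsed interval, and the truncation has
  kinks where the crossing happens at time 0 or at the final time, that is, where the starting point
  or the end point lies on the switching set. This is the set removed in (b). Statements about arcs
  therefore carry two claims: continuity always, and class C^m if both ends are off the switching
  set. The order m is fixed through the local theory because the neighbourhoods obtained there
  depend on it. Uniqueness shows that the flow itself does not, so the orders are combined only at
  the end. The definition of a solution names the regions before and after a crossing by existential
  quantifiers; charts that orient the crossing are needed to identify them. The perturbed system is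
  treated as an autonomous field whose last component has constant speed c in all regions. The flow
  then maps slices to slices, and the same lemmas with c = 1 and c = -1 serve the system and its
  reversal. Images are open because the reversed flow exists near each image point.\<close>

lemma Ck_on_subset: "Ck_on m S f \<Longrightarrow> T \<subseteq> S \<Longrightarrow> Ck_on m T f"
proof (induction m arbitrary: f)
  case 0
  then show ?case by (auto intro: continuous_on_subset)
next
  case (Suc m)
  then show ?case by (auto simp: subset_iff)
qed

lemma Ck_on_cong:
  "open S \<Longrightarrow> (\<And>x. x \<in> S \<Longrightarrow> f x = g x) \<Longrightarrow> Ck_on m S f \<Longrightarrow> Ck_on m S g"
proof (induction m arbitrary: f g)
  case 0
  then show ?case using continuous_on_cong by force
next
  case (Suc m)
  have *: "(f has_derivative D) (at x) \<longleftrightarrow> (g has_derivative D) (at x)" if "x \<in> S" for x D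
    using has_derivative_transform_within_open[of f D x UNIV S g]
      has_derivative_transform_within_open[of g D x UNIV S f] Suc.prems(1,2) that by auto
  have eq: "frechet_derivative f (at x) = frechet_derivative g (at x)" if "x \<in> S" for x
    unfolding frechet_derivative_def using *[OF that] by simp
  moreover have "g differentiable (at x)" if "x \<in> S" for x
  proof -
    have "f differentiable at x"
      using Suc.prems(3) that by simp
    then obtain D where "(f has_derivative D) (at x)"
      unfolding differentiable_def ..
    then have "(g has_derivative D) (at x)"
      using *[OF that] by blast
    then show ?thesis
      by (rule differentiableI)
  qed
  moreover have "Ck_on m S (\<lambda>x. frechet_derivative g (at x) v)" for v
  proof (rule Suc.IH[OF Suc.prems(1)])
    show "Ck_on m S (\<lambda>x. frechet_derivative f (at x) v)"
      using Suc.prems(3) by simp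
  qed (simp only: eq)
  ultimately show ?case
    by simp
qed

lemma Ck_on_SucD:
  assumes "Ck_on (Suc m) S f"
  shows "x \<in> S \<Longrightarrow> (f has_derivative frechet_derivative f (at x)) (at x)"
    and "Ck_on m S (\<lambda>x. frechet_derivative f (at x) v)"
  using assms by (auto simp: frechet_derivative_works)

text \<open>Derivatives in the ambient space are unique, so any explicit formula for the derivative
  may take the place of \<open>frechet_derivative\<close>. The closure properties below are proved
  in this way.\<close>

lemma Ck_on_SucI:
  assumes "open S" and D: "\<And>x. x \<in> S \<Longrightarrow> (f has_derivative f' x) (at x)"
    and "\<And>v. Ck_on m S (\<lambda>x. f' x v)"
  shows "Ck_on (Suc m) S f"
proof -
  have "frechet_derivative f (at x) = f' x" if "x \<in> S" for x
    using D[OF that] by (metis frechet_derivative_at)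
  then have "Ck_on m S (\<lambda>x. frechet_derivative f (at x) v)" for v
    by (intro Ck_on_cong[OF \<open>open S\<close> _ assms(3)]) simp
  moreover have "f differentiable at x" if "x \<in> S" for x
    using D[OF that] by (auto simp: differentiable_def)
  ultimately show ?thesis by simp
qed

lemma Ck_on_Suc_continuous: "Ck_on (Suc m) S f \<Longrightarrow> continuous_on S f"
  by (intro continuous_at_imp_continuous_on ballI) (rule has_derivative_continuous[OF Ck_on_SucD(1)])

declare Ck_on.simps(2) [simp del]

lemma Ck_on_SucI':
  assumes "\<And>x. x \<in> S \<Longrightarrow> f differentiable at x"
    and "\<And>v. Ck_on m S (\<lambda>x. frechet_derivative f (at x) v)"
  shows "Ck_on (Suc m) S f"
  using assms by (simp add: Ck_on.simps(2))

lemma Ck_on_Suc_imp: "Ck_on (Suc m) S f \<Longrightarrow> Ck_on m S f"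
proof (induction m arbitrary: f)
  case 0
  then show ?case using Ck_on_Suc_continuous[OF 0] by simp
next
  case (Suc m)
  show ?case
    by (rule Ck_on_SucI') (use Ck_on_SucD[OF Suc.prems] Suc.IH in \<open>auto simp: differentiable_def\<close>)
qed

lemma Ck_on_mono: "Ck_on m S f \<Longrightarrow> k \<le> m \<Longrightarrow> Ck_on k S f"
  by (induction m) (auto simp: le_Suc_eq dest: Ck_on_Suc_imp)

text \<open>Derivatives are taken in the ambient space, so membership in the class is a local
  matter. This later glues neighbourhoods that depend on the point and on the order.\<close>

lemma Ck_on_local:
  "(\<And>x. x \<in> S \<Longrightarrow> \<exists>T. open T \<and> x \<in> T \<and> Ck_on m T f) \<Longrightarrow> Ck_on m S f"
proof (induction m arbitrary: f)
  case 0
  then show ?case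
    by (metis Ck_on.simps(1) continuous_at_imp_continuous_on continuous_on_eq_continuous_at)
next
  case (Suc m)
  have "f differentiable at x" if "x \<in> S" for x
    using Suc.prems[OF that] by (auto simp: Ck_on.simps(2))
  moreover have "Ck_on m S (\<lambda>x. frechet_derivative f (at x) v)" for v
    using Suc.prems by (intro Suc.IH) (metis Ck_on_SucD(2))
  ultimately show ?case by (simp add: Ck_on.simps(2))
qed

lemma Ck_on_const [simp]: "Ck_on m S (\<lambda>x. c)"
  by (induction m arbitrary: c) (auto simp: Ck_on.simps(2))

lemma Ck_on_bounded_linear_compose:
  assumes "open S" and L: "bounded_linear L"
  shows "Ck_on m S f \<Longrightarrow> Ck_on m S (\<lambda>x. L (f x))"
proof (induction m arbitrary: f)
  case 0
  then show ?case
    using L by (auto intro: bounded_linear.continuous_on)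
next
  case (Suc m)
  show ?case
  proof (rule Ck_on_SucI[OF \<open>open S\<close>])
    fix x assume "x \<in> S"
    then show "((\<lambda>x. L (f x)) has_derivative (\<lambda>v. L (frechet_derivative f (at x) v))) (at x)"
      using Ck_on_SucD(1)[OF Suc.prems] L by (auto intro: bounded_linear.has_derivative)
  qed (rule Suc.IH[OF Ck_on_SucD(2)[OF Suc.prems]])
qed

lemma Ck_on_id: "open S \<Longrightarrow> Ck_on m S (\<lambda>x. x)"
proof (cases m)
  case (Suc k)
  assume "open S"
  then show ?thesis unfolding Suc by (intro Ck_on_SucI[where f' = "\<lambda>x v. v"]) auto
qed auto

lemma Ck_on_bounded_linear: "open S \<Longrightarrow> bounded_linear L \<Longrightarrow> Ck_on m S L"
  using Ck_on_bounded_linear_compose Ck_on_id by blast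

lemma Ck_on_add:
  assumes "open S"
  shows "Ck_on m S f \<Longrightarrow> Ck_on m S g \<Longrightarrow> Ck_on m S (\<lambda>x. f x + g x)"
proof (induction m arbitrary: f g)
  case 0
  then show ?case by (auto intro: continuous_intros)
next
  case (Suc m)
  show ?case
  proof (rule Ck_on_SucI[OF assms])
    fix x assume "x \<in> S"
    then show "((\<lambda>x. f x + g x) has_derivative
        (\<lambda>v. frechet_derivative f (at x) v + frechet_derivative g (at x) v)) (at x)"
      using Ck_on_SucD(1)[OF Suc.prems(1)] Ck_on_SucD(1)[OF Suc.prems(2)]
      by (auto intro: has_derivative_add)
  qed (rule Suc.IH[OF Ck_on_SucD(2)[OF Suc.prems(1)] Ck_on_SucD(2)[OF Suc.prems(2)]])
qed

lemma Ck_on_sum: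
  assumes "open S"
  shows "(\<And>i. i \<in> I \<Longrightarrow> Ck_on m S (f i)) \<Longrightarrow> Ck_on m S (\<lambda>x. \<Sum>i\<in>I. f i x)"
  by (induction I rule: infinite_finite_induct) (auto intro: Ck_on_add assms)

lemma Ck_on_scaleR:
  fixes a :: "'a::real_normed_vector \<Rightarrow> real"
  assumes "open S"
  shows "Ck_on m S a \<Longrightarrow> Ck_on m S f \<Longrightarrow> Ck_on m S (\<lambda>x. a x *\<^sub>R f x)"
proof (induction m arbitrary: a f)
  case 0
  then show ?case by (auto intro: continuous_intros)
next
  case (Suc m)
  show ?case
  proof (rule Ck_on_SucI[OF assms])
    fix x assume "x \<in> S"
    then show "((\<lambda>x. a x *\<^sub>R f x) has_derivative
        (\<lambda>v. a x *\<^sub>R frechet_derivative f (at x) v + frechet_derivative a (at x) v *\<^sub>R f x)) (at x)"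
      using Ck_on_SucD(1)[OF Suc.prems(1)] Ck_on_SucD(1)[OF Suc.prems(2)]
      by (auto intro: has_derivative_scaleR)
  next
    show "Ck_on m S (\<lambda>x. a x *\<^sub>R frechet_derivative f (at x) v + frechet_derivative a (at x) v *\<^sub>R f x)" for v
      by (intro Ck_on_add assms Suc.IH Ck_on_SucD(2)[OF Suc.prems(1)] Ck_on_SucD(2)[OF Suc.prems(2)]
          Ck_on_Suc_imp[OF Suc.prems(1)] Ck_on_Suc_imp[OF Suc.prems(2)])
  qed
qed

lemma Ck_on_inverse:
  fixes a :: "'a::real_normed_vector \<Rightarrow> real"
  assumes "open S"
  shows "Ck_on m S a \<Longrightarrow> (\<And>x. x \<in> S \<Longrightarrow> a x \<noteq> 0) \<Longrightarrow> Ck_on m S (\<lambda>x. inverse (a x))"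
proof (induction m arbitrary: a)
  case 0
  then show ?case by (auto intro: continuous_intros)
next
  case (Suc m)
  show ?case
  proof (rule Ck_on_SucI[OF assms])
    fix x assume "x \<in> S"
    then show "((\<lambda>x. inverse (a x)) has_derivative
        (\<lambda>v. (- (inverse (a x) *\<^sub>R inverse (a x))) *\<^sub>R frechet_derivative a (at x) v)) (at x)"
      using Ck_on_SucD(1)[OF Suc.prems(1)] Suc.prems(2)
      by (auto intro!: derivative_eq_intros simp: fun_eq_iff)
  next
    have "Ck_on m S (\<lambda>x. inverse (a x))"
      by (intro Suc.IH Ck_on_Suc_imp[OF Suc.prems(1)] Suc.prems(2))
    then show "Ck_on m S (\<lambda>x. (- (inverse (a x) *\<^sub>R inverse (a x))) *\<^sub>R frechet_derivative a (at x) v)" for v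
      using Ck_on_SucD(2)[OF Suc.prems(1)]
      by (intro Ck_on_scaleR Ck_on_bounded_linear_compose[where L = uminus] assms
          bounded_linear_minus bounded_linear_ident) 
  qed
qed

lemma has_derivative_linear_sum:
  fixes f' :: "'a::euclidean_space \<Rightarrow> 'b::real_normed_vector"
  assumes "(f has_derivative f') F"
  shows "f' v = (\<Sum>i\<in>Basis. (v \<bullet> i) *\<^sub>R f' i)"
proof -
  have "linear f'" using assms has_derivative_linear by blast
  then have "f' (\<Sum>i\<in>Basis. (v \<bullet> i) *\<^sub>R i) = (\<Sum>i\<in>Basis. (v \<bullet> i) *\<^sub>R f' i)"
    by (simp add: linear_sum linear_scale)
  then show ?thesis by (simp add: euclidean_representation)
qed

text \<open>The class tests derivatives along fixed vectors, whereas the chain rule evaluates the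
  derivative of \<open>g\<close> along the moving vector
  \<open>frechet_derivative f (at x) v\<close>. Expanding that vector in \<open>Basis\<close>
  restores fixed directions, with coefficients of class C^m; hence the Euclidean middle
  space.\<close>

lemma Ck_on_compose:
  fixes f :: "'a::real_normed_vector \<Rightarrow> 'b::euclidean_space"
  assumes "open S" "f ` S \<subseteq> T"
  shows "Ck_on m T g \<Longrightarrow> Ck_on m S f \<Longrightarrow> Ck_on m S (\<lambda>x. g (f x))"
proof (induction m arbitrary: g)
  case 0
  then show ?case using assms by (auto intro: continuous_on_compose2)
next
  case (Suc m)
  show ?case
  proof (rule Ck_on_SucI[OF \<open>open S\<close>])
    fix x assume "x \<in> S"
    then have g: "(g has_derivative frechet_derivative g (at (f x))) (at (f x))"
      using Suc.prems(1) Ck_on_SucD(1) assms by blast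
    have "((\<lambda>x. g (f x)) has_derivative
        (\<lambda>v. frechet_derivative g (at (f x)) (frechet_derivative f (at x) v))) (at x)"
      using has_derivative_compose[OF Ck_on_SucD(1)[OF Suc.prems(2) \<open>x \<in> S\<close>] g] .
    moreover have "(\<lambda>v. frechet_derivative g (at (f x)) (frechet_derivative f (at x) v)) =
      (\<lambda>v. \<Sum>i\<in>Basis. (frechet_derivative f (at x) v \<bullet> i) *\<^sub>R frechet_derivative g (at (f x)) i)"
      using has_derivative_linear_sum[OF g] by fast
    ultimately show "((\<lambda>x. g (f x)) has_derivative
      (\<lambda>v. \<Sum>i\<in>Basis. (frechet_derivative f (at x) v \<bullet> i) *\<^sub>R frechet_derivative g (at (f x)) i)) (at x)"
      by simp
  next
    show "Ck_on m S (\<lambda>x. \<Sum>i\<in>Basis. (frechet_derivative f (at x) v \<bullet> i) *\<^sub>R frechet_derivative g (at (f x)) i)" for v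
    proof (intro Ck_on_sum Ck_on_scaleR \<open>open S\<close>)
      fix i :: 'b
      show "Ck_on m S (\<lambda>x. frechet_derivative f (at x) v \<bullet> i)"
        by (rule Ck_on_bounded_linear_compose[OF \<open>open S\<close> bounded_linear_inner_left Ck_on_SucD(2)])
          (rule Suc.prems)
      show "Ck_on m S (\<lambda>x. frechet_derivative g (at (f x)) i)"
        using Suc.prems by (intro Suc.IH[OF Ck_on_SucD(2)] Ck_on_Suc_imp[of m S f])
    qed
  qed
qed

lemma Ck_on_Pair:
  assumes "open S" "Ck_on m S f" "Ck_on m S g"
  shows "Ck_on m S (\<lambda>x. (f x, g x))"
proof -
  have "Ck_on m S (\<lambda>x. (f x, 0) + (0, g x))"
    using assms by (intro Ck_on_add Ck_on_bounded_linear_compose[where L = "\<lambda>x. (x, 0)"]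
        Ck_on_bounded_linear_compose[where L = "\<lambda>x. (0, x)"])
      (auto intro!: bounded_linear_Pair bounded_linear_zero bounded_linear_ident)
  then show ?thesis by simp
qed

lemma Ck_on_fst: "open S \<Longrightarrow> Ck_on m S f \<Longrightarrow> Ck_on m S (\<lambda>x. fst (f x))"
  by (rule Ck_on_bounded_linear_compose[OF _ bounded_linear_fst])

lemma Ck_on_minus: "open S \<Longrightarrow> Ck_on m S f \<Longrightarrow> Ck_on m S (\<lambda>x. - f x)"
  by (rule Ck_on_bounded_linear_compose[OF _ bounded_linear_minus[OF bounded_linear_ident]])

lemma Ck_on_diff:
  assumes "open S" "Ck_on m S f" "Ck_on m S g"
  shows "Ck_on m S (\<lambda>x. f x - g x)"
  unfolding diff_conv_add_uminus by (intro Ck_on_add Ck_on_minus assms)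

text \<open>The same expansion in \<open>Basis\<close>, for a derivative taken at a moving point in
  a moving direction. This is the shape of the variational equations and of the derivative of an
  implicit function.\<close>

lemma Ck_on_frechet_derivative_apply:
  fixes f :: "'a::euclidean_space \<Rightarrow> 'b::real_normed_vector"
    and u w :: "'c::real_normed_vector \<Rightarrow> 'a"
  assumes "open S" "w ` S \<subseteq> T" "Ck_on (Suc m) T f" "Ck_on m S w" "Ck_on m S u"
  shows "Ck_on m S (\<lambda>x. frechet_derivative f (at (w x)) (u x))"
proof -
  have "Ck_on m S (\<lambda>x. \<Sum>i\<in>Basis. (u x \<bullet> i) *\<^sub>R frechet_derivative f (at (w x)) i)"
    by (intro Ck_on_sum Ck_on_scaleR Ck_on_bounded_linear_compose[OF _ bounded_linear_inner_left]
        Ck_on_compose[OF assms(1,2) Ck_on_SucD(2)[OF assms(3)]] assms(1,4,5))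
  moreover have "(\<Sum>i\<in>Basis. (u x \<bullet> i) *\<^sub>R frechet_derivative f (at (w x)) i)
      = frechet_derivative f (at (w x)) (u x)" if "x \<in> S" for x
    using has_derivative_linear_sum[OF Ck_on_SucD(1)[OF assms(3), of "w x"], of "u x"] assms(2) that
    by auto
  ultimately show ?thesis
    by (rule Ck_on_cong[OF \<open>open S\<close>, rotated])
qed

text \<open>In finite dimension, continuity of the directional derivatives is continuity in operator
  norm. The Lipschitz bounds and the uniform linearization below need the latter.\<close>

lemma continuous_on_blinfun_frechet_derivative:
  fixes f :: "'a::euclidean_space \<Rightarrow> 'b::real_normed_vector"
  assumes "Ck_on (Suc 0) S f"
  shows "continuous_on S (\<lambda>x. Blinfun (frechet_derivative f (at x)))"
proof (rule continuous_on_blinfun_componentwise)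
  fix i :: 'a
  have "x \<in> S \<Longrightarrow> Blinfun (frechet_derivative f (at x)) i = frechet_derivative f (at x) i" for x
    using has_derivative_bounded_linear[OF Ck_on_SucD(1)[OF assms]] by (simp add: bounded_linear_Blinfun_apply)
  then show "continuous_on S (\<lambda>x. Blinfun (frechet_derivative f (at x)) i)"
    using Ck_on_SucD(2)[OF assms, of i] by (simp add: cong: continuous_on_cong)
qed

section \<open>Local solutions of differential equations and their smooth dependence on data\<close>

lemma short_gronwall:
  fixes u :: "real \<Rightarrow> 'a::real_normed_vector"
  assumes "compact I" "convex I" "t0 \<in> I"
    and der: "\<And>t. t \<in> I \<Longrightarrow> (u has_vector_derivative u' t) (at t within I)"
    and bound: "\<And>t. t \<in> I \<Longrightarrow> norm (u' t) \<le> L * norm (u t) + e"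
    and len: "\<And>t. t \<in> I \<Longrightarrow> \<bar>t - t0\<bar> \<le> \<delta>"
    and "0 \<le> L" "0 \<le> e" "L * \<delta> \<le> 1/2" "t \<in> I"
  shows "norm (u t) \<le> 2 * (norm (u t0) + \<delta> * e)"
proof -
  have "continuous_on I u"
    using der has_vector_derivative_continuous continuous_on_eq_continuous_within by blast
  then obtain s where s: "s \<in> I" "\<And>t. t \<in> I \<Longrightarrow> norm (u t) \<le> norm (u s)"
    using continuous_attains_sup[of I "\<lambda>t. norm (u t)"] \<open>compact I\<close> \<open>t0 \<in> I\<close>
    by (auto intro: continuous_on_norm)
  define M where "M = norm (u s)"
  have "norm (u s - u t0) \<le> (L * M + e) * norm (s - t0)"
  proof (rule differentiable_bound[OF \<open>convex I\<close>])
    fix x assume x: "x \<in> I"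
    show "(u has_derivative (\<lambda>h. h *\<^sub>R u' x)) (at x within I)"
      using der[OF x] by (simp add: has_vector_derivative_def)
    have "norm (u' x) \<le> L * M + e"
      using bound[OF x] s(2)[OF x] mult_left_mono[OF s(2)[OF x] \<open>0 \<le> L\<close>] by (simp add: M_def)
    then show "onorm (\<lambda>h. h *\<^sub>R u' x) \<le> L * M + e"
      by (intro onorm_le) (metis mult.commute mult_left_mono norm_ge_zero norm_scaleR real_norm_def)
  qed (use s(1) \<open>t0 \<in> I\<close> in auto)
  also have "\<dots> \<le> (L * M + e) * \<delta>"
    using len[OF s(1)] \<open>0 \<le> L\<close> \<open>0 \<le> e\<close> by (intro mult_left_mono) (auto simp: M_def)
  also have "\<dots> \<le> M / 2 + \<delta> * e"
    using mult_right_mono[OF \<open>L * \<delta> \<le> 1/2\<close>, of M] by (simp add: M_def algebra_simps)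
  finally have "norm (u s) \<le> norm (u t0) + M / 2 + \<delta> * e"
    using norm_triangle_ineq2[of "u s" "u t0"] by linarith
  then have "norm (u s) \<le> 2 * (norm (u t0) + \<delta> * e)"
    by (simp add: M_def)
  then show ?thesis
    using s(2)[OF \<open>t \<in> I\<close>] by linarith
qed

lemma dist_triple_less:
  fixes t t' :: "'t::metric_space" and p p' :: "'p::metric_space" and y y' :: "'a::metric_space"
  assumes "dist t t' + dist p p' + dist y y' < e"
  shows "dist ((t, p), y) ((t', p'), y') < e"
proof -
  have "dist ((t, p), y) ((t', p'), y') \<le> dist (t, p) (t', p') + dist y y'"
    unfolding dist_Pair_Pair[of "(t, p)"] by (rule sqrt_sum_squares_le_sum) auto
  moreover have "dist (t, p) (t', p') \<le> dist t t' + dist p p'"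
    unfolding dist_Pair_Pair[of t] by (rule sqrt_sum_squares_le_sum) auto
  ultimately show ?thesis using assms by linarith
qed

text \<open>The substitution s = \<theta> t turns the Picard integral from 0 to t into t times an
  integral over the fixed interval [0, 1]. Negative t needs no separate convention, and continuity
  in (t, p) follows from the theorem on integrals with a parameter.\<close>

lemma integral_reparametrized:
  fixes g :: "real \<Rightarrow> 'a::banach"
  assumes F: "\<And>s. s \<in> {-\<delta>..\<delta>} \<Longrightarrow> (F has_vector_derivative g s) (at s within {-\<delta>..\<delta>})"
    and t: "t \<in> {-\<delta>..\<delta>}"
  shows "t *\<^sub>R integral {0..1} (\<lambda>\<theta>. g (\<theta> * t)) = F t - F 0"
proof -
  have sub: "(\<lambda>\<theta>. \<theta> * t) ` {0..1} \<subseteq> {-\<delta>..\<delta>}"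
  proof safe
    fix \<theta> :: real assume "\<theta> \<in> {0..1}"
    then have "\<bar>\<theta> * t\<bar> \<le> \<bar>t\<bar>" by (simp add: abs_mult mult_left_le_one_le)
    then show "\<theta> * t \<in> {-\<delta>..\<delta>}" using t by auto
  qed
  have "((\<lambda>\<theta>. F (\<theta> * t)) has_vector_derivative t *\<^sub>R g (\<theta> * t)) (at \<theta> within {0..1})"
    if "\<theta> \<in> {0..1}" for \<theta>
  proof -
    have "(F \<circ> (\<lambda>\<theta>. \<theta> * t) has_vector_derivative t *\<^sub>R g (\<theta> * t)) (at \<theta> within {0..1})"
    proof (rule vector_diff_chain_within)
      show "((\<lambda>\<theta>. \<theta> * t) has_vector_derivative t) (at \<theta> within {0..1})"
        by (auto intro!: derivative_eq_intros simp flip: has_real_derivative_iff_has_vector_derivative)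
      show "(F has_vector_derivative g (\<theta> * t)) (at (\<theta> * t) within (\<lambda>\<theta>. \<theta> * t) ` {0..1})"
        by (rule has_vector_derivative_within_subset[OF F sub]) (use sub that in blast)
    qed
    then show ?thesis by (simp add: o_def)
  qed
  then have "((\<lambda>\<theta>. t *\<^sub>R g (\<theta> * t)) has_integral F (1 * t) - F (0 * t)) {0..1}"
    by (intro fundamental_theorem_of_calculus) auto
  from integral_unique[OF this] show ?thesis by simp
qed

text \<open>Time and parameter form one pair, so that graph points read \<open>(q, y q)\<close>. The
  initial value is a function \<open>g0\<close> of the parameter: with the starting point as
  parameter and \<open>g0\<close> the identity one obtains flows, and differentiating in p leads to
  a problem of the same shape.\<close>

definition param_solution ::
    "((real \<times> 'p::metric_space) \<times> 'a::real_normed_vector) set \<Rightarrow> ((real \<times> 'p) \<times> 'a \<Rightarrow> 'a) \<Rightarrow>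
      real \<Rightarrow> 'p set \<Rightarrow> ('p \<Rightarrow> 'a) \<Rightarrow> (real \<times> 'p \<Rightarrow> 'a) \<Rightarrow> bool" where
  "param_solution Q G \<delta> N g0 y \<longleftrightarrow> 0 < \<delta> \<and> open N \<and> continuous_on ({-\<delta><..<\<delta>} \<times> N) y \<and>
     (\<forall>t\<in>{-\<delta><..<\<delta>}. \<forall>p\<in>N. ((t, p), y (t, p)) \<in> Q \<and>
        ((\<lambda>s. y (s, p)) has_vector_derivative G ((t, p), y (t, p))) (at t)) \<and>
     (\<forall>p\<in>N. y (0, p) = g0 p)"

lemma param_solutionD:
  assumes "param_solution Q G \<delta> N g0 y"
  shows "0 < \<delta>" "open N" "continuous_on ({-\<delta><..<\<delta>} \<times> N) y"
    "t \<in> {-\<delta><..<\<delta>} \<Longrightarrow> p \<in> N \<Longrightarrow> ((t, p), y (t, p)) \<in> Q"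
    "t \<in> {-\<delta><..<\<delta>} \<Longrightarrow> p \<in> N \<Longrightarrow>
        ((\<lambda>s. y (s, p)) has_vector_derivative G ((t, p), y (t, p))) (at t)"
    "p \<in> N \<Longrightarrow> y (0, p) = g0 p"
  using assms by (auto simp: param_solution_def)

lemma param_solution_subset:
  assumes "param_solution Q G \<delta> N g0 y" "0 < \<delta>'" "\<delta>' \<le> \<delta>" "open N'" "N' \<subseteq> N"
  shows "param_solution Q G \<delta>' N' g0 y"
proof -
  have "continuous_on ({-\<delta>'<..<\<delta>'} \<times> N') y"
    by (rule continuous_on_subset[OF param_solutionD(3)[OF assms(1)]]) (use assms in auto)
  then show ?thesis
    using assms by (auto simp: param_solution_def)
qed

text \<open>Picard iteration is carried out for all parameters at once, on functions of (t, p), so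
  that uniform convergence yields joint continuity. Values in a Banach space are allowed because the
  variational equation is solved for operators.\<close>

theorem local_solution_exists:
  fixes G :: "(real \<times> 'p::metric_space) \<times> 'a::banach \<Rightarrow> 'a" and g0 :: "'p \<Rightarrow> 'a"
  assumes "open Q" and w0: "((0, p0), g0 p0) \<in> Q" and contG: "continuous_on Q G"
    and lip: "\<And>q y y'. (q, y) \<in> Q \<Longrightarrow> (q, y') \<in> Q \<Longrightarrow> norm (G (q, y) - G (q, y')) \<le> L * norm (y - y')"
    and "0 \<le> L"
    and "open N0" "p0 \<in> N0" and contg0: "continuous_on N0 g0"
  obtains \<delta> N y where "p0 \<in> N" "N \<subseteq> N0" "param_solution Q G \<delta> N g0 y"
proof -
  define y0 where "y0 = g0 p0"
  define M where "M = norm (G ((0, p0), y0)) + 1"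
  have "0 < M" by (auto simp: M_def intro: add_nonneg_pos)
  have "open {w \<in> Q. norm (G w) < M}"
    using continuous_open_preimage[OF continuous_on_norm[OF contG] \<open>open Q\<close>, of "{..<M}"]
    by (simp add: vimage_def Int_def)
  moreover have "((0, p0), y0) \<in> {w \<in> Q. norm (G w) < M}"
    using w0 by (auto simp: y0_def M_def)
  ultimately obtain e where "0 < e" and e: "ball ((0, p0), y0) e \<subseteq> {w \<in> Q. norm (G w) < M}"
    using open_contains_ball by blast
  define r where "r = e / 4"
  have "0 < r" using \<open>0 < e\<close> by (simp add: r_def)
  have box: "((t, p), y) \<in> Q" "norm (G ((t, p), y)) \<le> M"
    if "\<bar>t\<bar> \<le> r" "dist p p0 < r" "norm (y - y0) \<le> 2 * r" for t p y
  proof -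
    have "dist 0 t + dist p0 p + dist y0 y < e"
      using that dist_norm[of y y0] by (simp add: r_def dist_commute)
    then have "((t, p), y) \<in> ball ((0, p0), y0) e"
      by (auto intro: dist_triple_less)
    then show "((t, p), y) \<in> Q" "norm (G ((t, p), y)) \<le> M"
      using e by force+
  qed
  define N where "N = {p \<in> N0. g0 p \<in> ball y0 r} \<inter> ball p0 r"
  have "open {p \<in> N0. g0 p \<in> ball y0 r}"
    using continuous_open_preimage[OF contg0 \<open>open N0\<close> open_ball, of y0 r]
    by (simp add: vimage_def Int_def)
  then have "open N" by (auto simp: N_def)
  have "p0 \<in> N" "N \<subseteq> N0" using \<open>p0 \<in> N0\<close> \<open>0 < r\<close> by (auto simp: N_def y0_def)
  have N: "dist p p0 < r" "norm (g0 p - y0) < r" if "p \<in> N" for p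
    using that by (auto simp: N_def dist_commute dist_norm norm_minus_commute)
  \<comment> \<open>The bound \<open>r\<close> keeps the time in the box, \<open>r / M\<close> keeps
    the integral term below \<open>r\<close>, and the last one makes the Picard map contract by 1/2.
    The summand 1 guards against \<open>L = 0\<close>.\<close>
  define \<delta> where "\<delta> = min r (min (r / M) (1 / (2 * (L + 1))))"
  have "0 < \<delta>" using \<open>0 < r\<close> \<open>0 < M\<close> \<open>0 \<le> L\<close> by (simp add: \<delta>_def)
  have "\<delta> \<le> r" by (simp add: \<delta>_def)
  have "\<delta> \<le> r / M" by (simp add: \<delta>_def)
  then have "\<delta> * M \<le> r" using \<open>0 < M\<close> by (simp add: field_simps)
  have "\<delta> * L \<le> 1 / 2"
  proof -
    have "\<delta> * L \<le> 1 / (2 * (L + 1)) * L"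
      using \<open>0 \<le> L\<close> by (intro mult_right_mono) (auto simp: \<delta>_def)
    also have "\<dots> \<le> 1 / 2" using \<open>0 \<le> L\<close> by (simp add: field_simps)
    finally show ?thesis .
  qed
  define R where "R = {-\<delta>..\<delta>} \<times> N"
  \<comment> \<open>Graphs of such iterates stay in the box, where the right-hand side is defined,
    bounded by \<open>M\<close> and Lipschitz.\<close>
  define good where "good Y \<longleftrightarrow> continuous_on R Y \<and> (\<forall>x\<in>R. norm (Y x - y0) \<le> 2 * r)" for Y
  define rhs where "rhs Y x \<theta> = G ((\<theta> * fst x, snd x), Y (\<theta> * fst x, snd x))" for Y x and \<theta> :: real
  define Tm where "Tm Y x = g0 (snd x) + fst x *\<^sub>R integral {0..1} (rhs Y x)" for Y x
  have inR: "(\<theta> * fst x, snd x) \<in> R" if "x \<in> R" "\<theta> \<in> {0..1}" for x \<theta>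
  proof -
    have "\<bar>\<theta> * fst x\<bar> \<le> \<bar>fst x\<bar>" using that by (simp add: abs_mult mult_left_le_one_le)
    then show ?thesis using that by (auto simp: R_def)
  qed
  have inQ: "(x, Y x) \<in> Q" "norm (G (x, Y x)) \<le> M" if "x \<in> R" "good Y" for x Y
    using box[of "fst x" "snd x" "Y x"] N[of "snd x"] that \<open>\<delta> \<le> r\<close>
    by (auto simp: R_def good_def abs_le_iff)
  have cont_rhs: "continuous_on (R \<times> cbox 0 1) (\<lambda>(x, \<theta>). rhs Y x \<theta>)" if "good Y" for Y
    unfolding rhs_def split_beta
  proof (rule continuous_on_compose2[OF contG])
    have "continuous_on (R \<times> cbox 0 1) (\<lambda>x. Y (snd x * fst (fst x), snd (fst x)))"
      by (rule continuous_on_compose2[of R Y])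
        (use that inR in \<open>auto simp: good_def intro!: continuous_intros\<close>)
    then show "continuous_on (R \<times> cbox 0 1)
      (\<lambda>x. ((snd x * fst (fst x), snd (fst x)), Y (snd x * fst (fst x), snd (fst x))))"
      by (intro continuous_intros)
  qed (use that inR inQ in auto)
  have cont_rhs1: "continuous_on {0..1} (rhs Y x)" if "good Y" "x \<in> R" for Y x
  proof -
    have "continuous_on {0..1} (\<lambda>\<theta>. (x, \<theta>))" by (intro continuous_intros)
    then show ?thesis
      using continuous_on_compose2[OF cont_rhs[OF that(1)], of "{0..1}" "\<lambda>\<theta>. (x, \<theta>)"] that(2) by auto
  qed
  have bnd: "norm (Tm Y x - g0 (snd x)) \<le> r" if "good Y" "x \<in> R" for Y x
  proof -
    have "norm (integral {0..1} (rhs Y x)) \<le> M * (1 - 0)"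
      using inQ[OF inR[OF that(2)] that(1)]
      by (intro integral_bound cont_rhs1 that) (auto simp: rhs_def)
    moreover have "\<bar>fst x\<bar> \<le> \<delta>" using that(2) by (auto simp: R_def)
    ultimately have "\<bar>fst x\<bar> * norm (integral {0..1} (rhs Y x)) \<le> \<delta> * M"
      using \<open>0 < \<delta>\<close> by (intro mult_mono) auto
    then have "norm (Tm Y x - g0 (snd x)) \<le> \<delta> * M"
      by (simp add: Tm_def)
    then show ?thesis using \<open>\<delta> * M \<le> r\<close> by simp
  qed
  have good_Tm: "good (Tm Y)" if "good Y" for Y
    unfolding good_def
  proof
    have "continuous_on R (\<lambda>x. integral (cbox 0 1) (rhs Y x))"
      by (rule integral_continuous_on_param[OF cont_rhs[OF that]])
    then show "continuous_on R (Tm Y)"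
      unfolding Tm_def
      by (auto simp: R_def intro!: continuous_intros continuous_on_compose2[OF contg0] dest: subsetD[OF \<open>N \<subseteq> N0\<close>])
    show "\<forall>x\<in>R. norm (Tm Y x - y0) \<le> 2 * r"
    proof
      fix x assume "x \<in> R"
      then have "norm (g0 (snd x) - y0) \<le> r" using N[of "snd x"] by (auto simp: R_def)
      then show "norm (Tm Y x - y0) \<le> 2 * r"
        using bnd[OF that \<open>x \<in> R\<close>] norm_triangle_ineq[of "Tm Y x - g0 (snd x)" "g0 (snd x) - y0"] by simp
    qed
  qed
  have contr: "norm (Tm Y x - Tm Y' x) \<le> c / 2"
    if "good Y" "good Y'" "\<And>x. x \<in> R \<Longrightarrow> norm (Y x - Y' x) \<le> c" "x \<in> R" for Y Y' x c
  proof -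
    have int: "rhs Y x integrable_on {0..1}" "rhs Y' x integrable_on {0..1}"
      using cont_rhs1 that integrable_continuous_real by blast+
    have "0 \<le> c" using that(3)[OF that(4)] norm_ge_zero order_trans by blast
    have "norm (integral {0..1} (\<lambda>\<theta>. rhs Y x \<theta> - rhs Y' x \<theta>)) \<le> L * c * (1 - 0)"
    proof (intro integral_bound continuous_on_diff cont_rhs1 that ballI)
      fix \<theta> :: real assume \<theta>: "\<theta> \<in> {0..1}"
      let ?x = "(\<theta> * fst x, snd x)"
      have "norm (rhs Y x \<theta> - rhs Y' x \<theta>) \<le> L * norm (Y ?x - Y' ?x)"
        unfolding rhs_def by (intro lip inQ inR that \<theta>)
      also have "\<dots> \<le> L * c"
        by (intro mult_left_mono that(3) inR that(4) \<theta> \<open>0 \<le> L\<close>)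
      finally show "norm (rhs Y x \<theta> - rhs Y' x \<theta>) \<le> L * c" .
    qed simp
    then have "norm (integral {0..1} (rhs Y x) - integral {0..1} (rhs Y' x)) \<le> L * c"
      using int by (simp add: integral_diff)
    moreover have "\<bar>fst x\<bar> \<le> \<delta>" using that(4) by (auto simp: R_def)
    ultimately have "\<bar>fst x\<bar> * norm (integral {0..1} (rhs Y x) - integral {0..1} (rhs Y' x)) \<le> \<delta> * (L * c)"
      using \<open>0 < \<delta>\<close> by (intro mult_mono) auto
    then have "norm (Tm Y x - Tm Y' x) \<le> \<delta> * (L * c)"
      by (simp add: Tm_def flip: scaleR_diff_right)
    also have "\<dots> \<le> c / 2"
      using mult_right_mono[OF \<open>\<delta> * L \<le> 1 / 2\<close> \<open>0 \<le> c\<close>] by simp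
    finally show ?thesis .
  qed
  define Y where "Y n = (Tm ^^ n) (\<lambda>x. g0 (snd x))" for n
  have Y_Suc: "Y (Suc n) = Tm (Y n)" for n by (simp add: Y_def)
  have good0: "good (Y 0)"
  proof -
    have "continuous_on R (\<lambda>x. g0 (snd x))"
      by (rule continuous_on_compose2[OF contg0]) (use \<open>N \<subseteq> N0\<close> in \<open>auto simp: R_def intro!: continuous_intros\<close>)
    moreover have "norm (g0 (snd x) - y0) \<le> 2 * r" if "x \<in> R" for x
      using N(2)[of "snd x"] that \<open>0 < r\<close> by (auto simp: R_def)
    ultimately show ?thesis by (auto simp: good_def Y_def)
  qed
  have goodY: "good (Y n)" for n
    by (induction n) (use good0 good_Tm in \<open>auto simp: Y_Suc\<close>)
  have step: "norm (Y (Suc n) x - Y n x) \<le> r * (1/2) ^ n" if "x \<in> R" for n x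
    using that
  proof (induction n arbitrary: x)
    case 0
    then show ?case using bnd[OF good0] by (simp add: Y_Suc) (simp add: Y_def)
  next
    case (Suc n)
    show ?case
      using contr[OF goodY goodY Suc.IH Suc.prems] by (simp add: Y_Suc[symmetric])
  qed
  \<comment> \<open>The increments decay geometrically, so the telescoping series converges
    uniformly; its partial sums are the iterates minus \<open>Y 0\<close>.\<close>
  have "uniform_limit R (\<lambda>n x. \<Sum>i<n. (Y (Suc i) x - Y i x)) (\<lambda>x. suminf (\<lambda>i. Y (Suc i) x - Y i x)) sequentially"
    by (rule Weierstrass_m_test[OF step]) (auto intro!: summable_mult summable_geometric)
  moreover have "(\<Sum>i<n. (Y (Suc i) x - Y i x)) = Y n x - Y 0 x" for n x
    by (induction n) auto
  ultimately have lim0: "uniform_limit R (\<lambda>n x. Y n x - Y 0 x) (\<lambda>x. suminf (\<lambda>i. Y (Suc i) x - Y i x)) sequentially"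
    by simp
  define y where "y x = suminf (\<lambda>i. Y (Suc i) x - Y i x) + Y 0 x" for x
  have lim: "uniform_limit R Y y sequentially"
    using uniform_limit_add[OF lim0 uniform_limit_const[where c = "Y 0"]] by (simp add: y_def[abs_def])
  have lim_pt: "(\<lambda>n. Y n x) \<longlonglongrightarrow> y x" if "x \<in> R" for x
    using tendsto_uniform_limitI[OF lim that] .
  have "good y"
    unfolding good_def
  proof
    show "continuous_on R y"
      by (rule uniform_limit_theorem[OF _ lim]) (use goodY in \<open>auto simp: good_def\<close>)
    show "\<forall>x\<in>R. norm (y x - y0) \<le> 2 * r"
    proof
      fix x assume "x \<in> R"
      then have "(\<lambda>n. norm (Y n x - y0)) \<longlonglongrightarrow> norm (y x - y0)"
        by (intro tendsto_intros lim_pt)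
      then show "norm (y x - y0) \<le> 2 * r"
        by (rule LIMSEQ_le_const2) (use goodY \<open>x \<in> R\<close> in \<open>auto simp: good_def\<close>)
    qed
  qed
  have fixp: "y x = Tm y x" if "x \<in> R" for x
  proof (rule LIMSEQ_unique)
    show "(\<lambda>n. Y (Suc n) x) \<longlonglongrightarrow> y x"
      using lim_pt[OF that] by (rule LIMSEQ_Suc)
    show "(\<lambda>n. Y (Suc n) x) \<longlonglongrightarrow> Tm y x"
    proof (rule LIMSEQ_I)
      fix \<epsilon> :: real assume "0 < \<epsilon>"
      then obtain m where m: "\<And>n x. n \<ge> m \<Longrightarrow> x \<in> R \<Longrightarrow> dist (Y n x) (y x) < \<epsilon>"
        using uniform_limitD[OF lim] unfolding eventually_sequentially by metis
      have "norm (Y (Suc n) x - Tm y x) < \<epsilon>" if "n \<ge> m" for n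
      proof -
        have "norm (Tm (Y n) x - Tm y x) \<le> \<epsilon> / 2"
          by (rule contr[OF goodY \<open>good y\<close> _ \<open>x \<in> R\<close>]) (use m[OF that] in \<open>auto simp: dist_norm less_imp_le\<close>)
        then show ?thesis using \<open>0 < \<epsilon>\<close> by (simp add: Y_Suc)
      qed
      then show "\<exists>no. \<forall>n\<ge>no. norm (Y (Suc n) x - Tm y x) < \<epsilon>" by blast
    qed
  qed
  show thesis
  proof (rule that[OF \<open>p0 \<in> N\<close> \<open>N \<subseteq> N0\<close>], unfold param_solution_def, intro conjI ballI)
    show "0 < \<delta>" "open N" by fact+
    show "continuous_on ({-\<delta><..<\<delta>} \<times> N) y"
      by (rule continuous_on_subset[of R]) (use \<open>good y\<close> in \<open>auto simp: good_def R_def\<close>)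
    show "((t, p), y (t, p)) \<in> Q" if "t \<in> {-\<delta><..<\<delta>}" "p \<in> N" for t p
      using inQ(1)[of "(t, p)" y] \<open>good y\<close> that by (auto simp: R_def)
    show "y (0, p) = g0 p" if "p \<in> N" for p
      using fixp[of "(0, p)"] that \<open>0 < \<delta>\<close> by (simp add: R_def Tm_def)
    show "((\<lambda>s. y (s, p)) has_vector_derivative G ((t, p), y (t, p))) (at t)"
      if t: "t \<in> {-\<delta><..<\<delta>}" and "p \<in> N" for t p
    proof -
      have "continuous_on {-\<delta>..\<delta>} (\<lambda>s. y (s, p))"
        by (rule continuous_on_compose2[of R y])
          (use \<open>good y\<close> \<open>p \<in> N\<close> in \<open>auto simp: good_def R_def intro!: continuous_intros\<close>)
      then have "continuous_on {-\<delta>..\<delta>} (\<lambda>s. ((s, p), y (s, p)))"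
        by (intro continuous_intros)
      then have "continuous_on {-\<delta>..\<delta>} (\<lambda>s. G ((s, p), y (s, p)))"
        by (rule continuous_on_compose2[OF contG]) (use inQ(1) \<open>good y\<close> \<open>p \<in> N\<close> in \<open>auto simp: R_def\<close>)
      \<comment> \<open>The fixed point satisfies an integral equation only. An antiderivative
        \<open>F\<close> of the continuous right-hand side along \<open>y\<close> turns it into y
        (s, p) = g0 p + (F s - F 0), which can be differentiated.\<close>
      then obtain F where F: "\<And>s. s \<in> {-\<delta>..\<delta>} \<Longrightarrow>
          (F has_vector_derivative G ((s, p), y (s, p))) (at s within {-\<delta>..\<delta>})"
        using antiderivative_continuous by blast
      have eq: "y (s, p) = g0 p + (F s - F 0)" if "s \<in> {-\<delta>..\<delta>}" for s
        using fixp[of "(s, p)"] that \<open>p \<in> N\<close> integral_reparametrized[OF F that]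
        by (simp add: R_def Tm_def rhs_def[abs_def])
      have "(F has_vector_derivative G ((t, p), y (t, p))) (at t within {-\<delta><..<\<delta>})"
        by (rule has_vector_derivative_within_subset[OF F]) (use t in auto)
      then have "(F has_vector_derivative G ((t, p), y (t, p))) (at t)"
        using t by (simp add: at_within_open[OF t])
      then have "((\<lambda>s. g0 p + (F s - F 0)) has_vector_derivative G ((t, p), y (t, p))) (at t)"
        by (auto intro!: derivative_eq_intros)
      then show ?thesis
        by (rule has_vector_derivative_transform_within_open[OF _ open_greaterThanLessThan t])
          (use eq in auto)
    qed
  qed
qed

section \<open>Differentiability of solutions in the parameter\<close>

lemma Ck_on_has_derivative_Blinfun:
  assumes "Ck_on (Suc 0) S f" "x \<in> S"
  shows "(f has_derivative blinfun_apply (Blinfun (frechet_derivative f (at x)))) (at x)"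
    and "blinfun_apply (Blinfun (frechet_derivative f (at x))) = frechet_derivative f (at x)"
  using Ck_on_SucD(1)[OF assms] has_derivative_bounded_linear[OF Ck_on_SucD(1)[OF assms]]
  by (simp_all add: bounded_linear_Blinfun_apply)

lemma C1_locally_lipschitz:
  fixes f :: "'a::euclidean_space \<Rightarrow> 'b::real_normed_vector"
  assumes "open S" "Ck_on (Suc 0) S f" "x0 \<in> S"
  obtains e B where "0 < e" "0 < B" "ball x0 e \<subseteq> S"
    "\<And>x. x \<in> ball x0 e \<Longrightarrow> norm (Blinfun (frechet_derivative f (at x))) \<le> B"
    "\<And>x y. x \<in> ball x0 e \<Longrightarrow> y \<in> ball x0 e \<Longrightarrow> norm (f x - f y) \<le> B * norm (x - y)"
proof -
  let ?D = "\<lambda>x. Blinfun (frechet_derivative f (at x))"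
  define B where "B = norm (?D x0) + 1"
  have "open {x \<in> S. norm (?D x) < B}"
    using continuous_open_preimage[OF continuous_on_norm[OF continuous_on_blinfun_frechet_derivative[OF assms(2)]]
        \<open>open S\<close>, of "{..<B}"]
    by (simp add: vimage_def Int_def)
  moreover have "x0 \<in> {x \<in> S. norm (?D x) < B}"
    using \<open>x0 \<in> S\<close> by (simp add: B_def)
  ultimately obtain e where "0 < e" and e: "ball x0 e \<subseteq> {x \<in> S. norm (?D x) < B}"
    using open_contains_ball by blast
  show thesis
  proof (rule that[OF \<open>0 < e\<close>])
    show "0 < B" by (simp add: B_def add_nonneg_pos)
    show "ball x0 e \<subseteq> S" using e by auto
    show le: "norm (?D x) \<le> B" if "x \<in> ball x0 e" for x using e that by force
    show "norm (f x - f y) \<le> B * norm (x - y)" if "x \<in> ball x0 e" "y \<in> ball x0 e" for x y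
    proof (rule differentiable_bound[OF convex_ball _ _ that])
      fix z assume z: "z \<in> ball x0 e"
      then have "z \<in> S" using e by auto
      show "(f has_derivative blinfun_apply (?D z)) (at z within ball x0 e)"
        by (rule has_derivative_at_withinI[OF Ck_on_has_derivative_Blinfun(1)[OF assms(2) \<open>z \<in> S\<close>]])
      show "onorm (blinfun_apply (?D z)) \<le> B"
        using le[OF z] by (simp add: norm_blinfun.rep_eq)
    qed
  qed
qed

text \<open>The remainder in the definition of the derivative is made uniform over a compact set,
  later the graph of a trajectory. A fattening of \<open>K\<close> by r / 2 is still compact and
  inside \<open>S\<close>; uniform continuity of \<open>f'\<close> on it and the mean value estimate
  on small balls give one \<open>\<eta>\<close> for all base points.\<close>

lemma uniformly_linearizable:
  fixes f :: "'a::euclidean_space \<Rightarrow> 'b::real_normed_vector" and f' :: "'a \<Rightarrow> 'a \<Rightarrow>\<^sub>L 'b"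
  assumes "open S" and D: "\<And>x. x \<in> S \<Longrightarrow> (f has_derivative blinfun_apply (f' x)) (at x)"
    and cont: "continuous_on S f'" and "compact K" "K \<subseteq> S" "0 < \<epsilon>"
  obtains \<eta> where "0 < \<eta>"
    "\<And>x y. x \<in> K \<Longrightarrow> norm (y - x) < \<eta> \<Longrightarrow> norm (f y - f x - f' x (y - x)) \<le> \<epsilon> * norm (y - x)"
proof -
  obtain r where "0 < r" and r: "(\<Union>x\<in>K. ball x r) \<subseteq> S"
    using compact_subset_open_imp_ball_epsilon_subset[OF \<open>compact K\<close> \<open>open S\<close> \<open>K \<subseteq> S\<close>] .
  define C where "C = {x + b | x b. x \<in> K \<and> b \<in> cball 0 (r / 2)}"
  have "compact C" unfolding C_def by (intro compact_sums \<open>compact K\<close> compact_cball)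
  have inC: "y \<in> C" if "x \<in> K" "norm (y - x) \<le> r / 2" for x y
  proof -
    have "y = x + (y - x)" by simp
    then show ?thesis unfolding C_def using that by (metis (mono_tags, lifting) mem_Collect_eq mem_cball_0)
  qed
  have "C \<subseteq> S"
  proof
    fix y assume "y \<in> C"
    then obtain x b where "x \<in> K" "norm b \<le> r / 2" "y = x + b" by (auto simp: C_def)
    then have "y \<in> ball x r" using \<open>0 < r\<close> by (simp add: dist_norm)
    then show "y \<in> S" using r \<open>x \<in> K\<close> by blast
  qed
  have "uniformly_continuous_on C f'"
    by (rule compact_uniformly_continuous[OF continuous_on_subset[OF cont \<open>C \<subseteq> S\<close>] \<open>compact C\<close>])
  then have "\<exists>d>0. \<forall>x\<in>C. \<forall>x'\<in>C. dist x' x < d \<longrightarrow> dist (f' x') (f' x) < \<epsilon>"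
    using \<open>0 < \<epsilon>\<close> unfolding uniformly_continuous_on_def by simp
  then obtain d where "0 < d" and d: "\<And>x y. x \<in> C \<Longrightarrow> y \<in> C \<Longrightarrow> dist y x < d \<Longrightarrow> dist (f' y) (f' x) < \<epsilon>"
    by auto
  define \<eta> where "\<eta> = min d (r / 2)"
  show thesis
  proof (rule that[of \<eta>])
    show "0 < \<eta>" using \<open>0 < d\<close> \<open>0 < r\<close> by (simp add: \<eta>_def)
    fix x y assume "x \<in> K" and y: "norm (y - x) < \<eta>"
    have ball: "z \<in> C" "dist z x < d" if "z \<in> ball x \<eta>" for z
      using that inC[OF \<open>x \<in> K\<close>, of z] by (auto simp: \<eta>_def dist_norm norm_minus_commute)
    have "norm (f y - f x - f' x (y - x)) \<le> norm (y - x) * \<epsilon>"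
    proof (rule differentiable_bound_linearization[where S = "ball x \<eta>"])
      fix t :: real assume "t \<in> {0..1}"
      then have "norm (t *\<^sub>R (y - x)) \<le> norm (y - x)" by (simp add: mult_left_le_one_le)
      then show "x + t *\<^sub>R (y - x) \<in> ball x \<eta>" using y by (simp add: dist_norm)
    next
      fix z assume z: "z \<in> ball x \<eta>"
      then have "z \<in> S" using ball(1)[OF z] \<open>C \<subseteq> S\<close> by blast
      show "(f has_derivative blinfun_apply (f' z)) (at z within ball x \<eta>)"
        by (rule has_derivative_at_withinI[OF D[OF \<open>z \<in> S\<close>]])
      have "dist (f' z) (f' x) < \<epsilon>"
        using d[of x z] ball[OF z] inC[OF \<open>x \<in> K\<close>, of x] \<open>0 < r\<close> by auto
      then show "onorm (blinfun_apply (f' z) - blinfun_apply (f' x)) \<le> \<epsilon>"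
        by (simp add: dist_norm norm_blinfun.rep_eq minus_blinfun.rep_eq fun_diff_def)
    qed (use \<open>0 < \<eta>\<close> in auto)
    then show "norm (f y - f x - f' x (y - x)) \<le> \<epsilon> * norm (y - x)"
      by (simp add: mult.commute)
  qed
qed

text \<open>The candidate \<open>Y\<close> for the derivative in p is constructed first, from the
  linear variational equation. Two applications of \<open>short_gronwall\<close> identify it: the
  difference of two solutions is O(norm (p' - p)), and after subtracting
  \<open>Y (s, p) (p' - p)\<close> it is o(norm (p' - p)). The equation for \<open>Y\<close> is part
  of the conclusion because the induction on the order starts from it.\<close>

theorem solution_C1:
  fixes G :: "(real \<times> 'p::euclidean_space) \<times> 'a::euclidean_space \<Rightarrow> 'a"
  assumes sol: "param_solution Q G \<delta> N g0 y" and "open Q" and G: "Ck_on (Suc 0) Q G"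
    and g0: "Ck_on (Suc 0) N g0" and "p0 \<in> N"
  obtains \<delta>' N' Y where "0 < \<delta>'" "\<delta>' \<le> \<delta>" "open N'" "p0 \<in> N'" "N' \<subseteq> N"
    "continuous_on ({-\<delta>'<..<\<delta>'} \<times> N') (Y :: real \<times> 'p \<Rightarrow> 'p \<Rightarrow>\<^sub>L 'a)"
    "\<And>t p. t \<in> {-\<delta>'<..<\<delta>'} \<Longrightarrow> p \<in> N' \<Longrightarrow>
        (y has_derivative (\<lambda>(\<tau>, v). \<tau> *\<^sub>R G ((t, p), y (t, p)) + Y (t, p) v)) (at (t, p))"
    "\<And>t p v. t \<in> {-\<delta>'<..<\<delta>'} \<Longrightarrow> p \<in> N' \<Longrightarrow> ((\<lambda>s. Y (s, p) v) has_vector_derivative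
        frechet_derivative G (at ((t, p), y (t, p))) ((0, v), Y (t, p) v)) (at t)"
    "\<And>p v. p \<in> N' \<Longrightarrow> Y (0, p) v = frechet_derivative g0 (at p) v"
proof -
  let ?DG = "\<lambda>w. Blinfun (frechet_derivative G (at w))"
  let ?Dg0 = "\<lambda>p. Blinfun (frechet_derivative g0 (at p))"
  note solD = param_solutionD[OF sol]
  define graph where "graph q = (q, y q)" for q
  define w0 where "w0 = graph (0, p0)"
  have "w0 \<in> Q"
    using solD(4)[of 0 p0] solD(1) \<open>p0 \<in> N\<close> by (simp add: w0_def graph_def)
  obtain e B where "0 < e" "0 < B" and eQ: "ball w0 e \<subseteq> Q"
    and DG_le: "\<And>x. x \<in> ball w0 e \<Longrightarrow> norm (?DG x) \<le> B"
    and G_lip: "\<And>x y. x \<in> ball w0 e \<Longrightarrow> y \<in> ball w0 e \<Longrightarrow> norm (G x - G y) \<le> B * norm (x - y)"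
    using C1_locally_lipschitz[OF \<open>open Q\<close> G \<open>w0 \<in> Q\<close>] by metis
  obtain e0 B0 where "0 < e0" "0 < B0" "ball p0 e0 \<subseteq> N"
    and g0_lip: "\<And>x y. x \<in> ball p0 e0 \<Longrightarrow> y \<in> ball p0 e0 \<Longrightarrow> norm (g0 x - g0 y) \<le> B0 * norm (x - y)"
    using C1_locally_lipschitz[OF solD(2) g0 \<open>p0 \<in> N\<close>] by metis
  have cont_graph: "continuous_on ({-\<delta><..<\<delta>} \<times> N) graph"
    unfolding graph_def using solD(3) by (intro continuous_intros)
  have "open (({-\<delta><..<\<delta>} \<times> N) \<inter> graph -` ball w0 e)"
    by (intro continuous_open_preimage[OF cont_graph] open_Times solD(2)) auto
  moreover have "(0, p0) \<in> ({-\<delta><..<\<delta>} \<times> N) \<inter> graph -` ball w0 e"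
    using solD(1) \<open>p0 \<in> N\<close> \<open>0 < e\<close> by (simp add: w0_def)
  ultimately obtain A0 A1 where A: "open A0" "open A1" "(0, p0) \<in> A0 \<times> A1"
      "A0 \<times> A1 \<subseteq> ({-\<delta><..<\<delta>} \<times> N) \<inter> graph -` ball w0 e"
    by (rule open_prod_elim)
  obtain d where "0 < d" "ball 0 d \<subseteq> A0" using openE[OF A(1), of 0] A(3) by blast
  obtain r where "0 < r" "ball p0 r \<subseteq> A1" using openE[OF A(2), of p0] A(3) by blast
  define \<delta>1 where "\<delta>1 = min d \<delta>"
  define N1 where "N1 = ball p0 (min r e0)"
  have N1: "open N1" "p0 \<in> N1" "N1 \<subseteq> ball p0 e0" "N1 \<subseteq> N"
    using \<open>0 < r\<close> \<open>0 < e0\<close> \<open>ball p0 e0 \<subseteq> N\<close> by (auto simp: N1_def)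
  have "0 < \<delta>1" "\<delta>1 \<le> \<delta>" using solD(1) \<open>0 < d\<close> by (auto simp: \<delta>1_def)
  have box: "graph (t, p) \<in> ball w0 e" if "t \<in> {-\<delta>1<..<\<delta>1}" "p \<in> N1" for t p
  proof -
    have "t \<in> ball 0 d" "p \<in> ball p0 r" using that by (auto simp: \<delta>1_def N1_def dist_norm)
    then show ?thesis using A(4) \<open>ball 0 d \<subseteq> A0\<close> \<open>ball p0 r \<subseteq> A1\<close> by blast
  qed

  define iy :: "'a \<Rightarrow>\<^sub>L ((real \<times> 'p) \<times> 'a)" where "iy = Blinfun (\<lambda>z. (0, z))"
  define ip :: "'p \<Rightarrow>\<^sub>L ((real \<times> 'p) \<times> 'a)" where "ip = Blinfun (\<lambda>v. ((0, v), 0))"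
  have iy [simp]: "iy z = (0, z)" for z
    unfolding iy_def
    by (simp add: bounded_linear_Blinfun_apply bounded_linear_Pair bounded_linear_zero bounded_linear_ident)
  have ip [simp]: "ip v = ((0, v), 0)" for v
    unfolding ip_def
    by (simp add: bounded_linear_Blinfun_apply bounded_linear_Pair bounded_linear_zero bounded_linear_ident)
  \<comment> \<open>The variational equation in operator form: the derivative of \<open>G\<close>
    along the graph, applied to ((0, v), Y v). It is affine in the unknown, hence Lipschitz in it
    with a constant that comes from the bound on \<open>?DG\<close>.\<close>
  define H where "H qY = ?DG (graph (fst qY)) o\<^sub>L (ip + (iy o\<^sub>L snd qY))" for qY :: "(real \<times> 'p) \<times> ('p \<Rightarrow>\<^sub>L 'a)"
  define Q2 where "Q2 = ({-\<delta>1<..<\<delta>1} \<times> N1) \<times> (UNIV :: ('p \<Rightarrow>\<^sub>L 'a) set)"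
  have fst_Q2: "fst ` Q2 \<subseteq> {-\<delta><..<\<delta>} \<times> N" "graph ` fst ` Q2 \<subseteq> Q"
    using \<open>\<delta>1 \<le> \<delta>\<close> N1(4) box eQ by (force simp: Q2_def)+
  have "continuous_on Q2 (\<lambda>x. graph (fst x))"
    by (rule continuous_on_compose2[OF cont_graph _ fst_Q2(1)]) (intro continuous_intros)
  then have "continuous_on Q2 (\<lambda>x. ?DG (graph (fst x)))"
    by (rule continuous_on_compose2[OF continuous_on_blinfun_frechet_derivative[OF G]])
      (use fst_Q2(2) in auto)
  then have contH: "continuous_on Q2 H"
    unfolding H_def by (intro continuous_intros bounded_bilinear.continuous_on[OF bounded_bilinear_blinfun_compose])
  have "open Q2" unfolding Q2_def by (intro open_Times N1(1)) auto
  have lipH: "norm (H (q, Y) - H (q, Y')) \<le> (B * norm iy) * norm (Y - Y')" if "(q, Y) \<in> Q2" for q Y Y'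
  proof -
    have "H (q, Y) - H (q, Y') = ?DG (graph q) o\<^sub>L (iy o\<^sub>L (Y - Y'))"
      unfolding H_def
      by (rule blinfun_eqI) (simp add: blinfun.diff_left blinfun.add_left blinfun.diff_right blinfun.add_right flip: blinfun.diff_right)
    then have "norm (H (q, Y) - H (q, Y')) \<le> norm (?DG (graph q)) * norm (iy o\<^sub>L (Y - Y'))"
      by (simp add: norm_blinfun_compose)
    also have "\<dots> \<le> B * (norm iy * norm (Y - Y'))"
      using that DG_le[OF box[of "fst q" "snd q"]] \<open>0 < B\<close>
      by (intro mult_mono norm_blinfun_compose) (auto simp: Q2_def)
    finally show ?thesis by simp
  qed
  have contDg0: "continuous_on N1 ?Dg0"
    using continuous_on_blinfun_frechet_derivative[OF Ck_on_subset[OF g0 N1(4)]] .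
  obtain \<delta>2 N2 Y where "p0 \<in> N2" "N2 \<subseteq> N1" and solY: "param_solution Q2 H \<delta>2 N2 ?Dg0 Y"
  proof (rule local_solution_exists[OF \<open>open Q2\<close> _ contH lipH _ N1(1,2) contDg0])
    show "((0, p0), ?Dg0 p0) \<in> Q2" using \<open>0 < \<delta>1\<close> N1 by (simp add: Q2_def)
    show "0 \<le> B * norm iy" using \<open>0 < B\<close> by simp
  qed
  note solYD = param_solutionD[OF solY]
  obtain r2 where "0 < r2" and r2: "ball p0 r2 \<subseteq> N2" using solYD(2) \<open>p0 \<in> N2\<close> openE by blast
  define N' where "N' = ball p0 r2"
  \<comment> \<open>The bound 1 / (2 * B) is what \<open>short_gronwall\<close> requires for the
    Lipschitz constant \<open>B\<close>.\<close>
  define \<delta>' where "\<delta>' = min (min \<delta>1 \<delta>2) (1 / (2 * B))"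
  have "0 < \<delta>'" using \<open>0 < \<delta>1\<close> solYD(1) \<open>0 < B\<close> by (simp add: \<delta>'_def)
  have \<delta>': "t \<in> {-\<delta>1<..<\<delta>1}" "t \<in> {-\<delta>2<..<\<delta>2}" "t \<in> {-\<delta><..<\<delta>}" if "\<bar>t\<bar> < \<delta>'" for t
    using that \<open>\<delta>1 \<le> \<delta>\<close> by (auto simp: \<delta>'_def)
  have "\<delta>' \<le> 1 / (2 * B)" by (simp add: \<delta>'_def)
  then have B\<delta>: "B * \<delta>' \<le> 1 / 2" using \<open>0 < B\<close> by (simp add: field_simps)
  have "N' \<subseteq> N2" "N' \<subseteq> N1" "N' \<subseteq> N" using r2 \<open>N2 \<subseteq> N1\<close> N1(4) by (auto simp: N'_def)
  have DGgraph: "?DG (graph (t, p)) u = frechet_derivative G (at ((t, p), y (t, p))) u"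
    if "\<bar>t\<bar> < \<delta>'" "p \<in> N'" for t p u
  proof -
    have "graph (t, p) \<in> Q" using box[of t p] \<delta>'(1)[OF that(1)] that(2) \<open>N' \<subseteq> N1\<close> eQ by blast
    then show ?thesis using Ck_on_has_derivative_Blinfun(2)[OF G] by (simp add: graph_def)
  qed
  have derY: "((\<lambda>s. Y (s, p) v) has_vector_derivative ?DG (graph (t, p)) ((0, v), Y (t, p) v)) (at t)"
    if "\<bar>t\<bar> < \<delta>'" "p \<in> N'" for t p v
  proof -
    have "((\<lambda>s. Y (s, p)) has_vector_derivative H ((t, p), Y (t, p))) (at t)"
      using solYD(5) \<delta>'(2)[OF that(1)] that(2) \<open>N' \<subseteq> N2\<close> by blast
    from bounded_linear.has_vector_derivative[OF blinfun.bounded_linear_left this, of v]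
    show ?thesis by (simp add: H_def blinfun.add_left)
  qed
  have initY: "Y (0, p) v = frechet_derivative g0 (at p) v" if "p \<in> N'" for p v
  proof -
    have "Y (0, p) = ?Dg0 p" using solYD(6) that \<open>N' \<subseteq> N2\<close> by blast
    then show ?thesis using Ck_on_has_derivative_Blinfun(2)[OF g0] that \<open>N' \<subseteq> N\<close> by auto
  qed

  have der_p: "((\<lambda>p. y (t, p)) has_derivative Y (t, p)) (at p)" if t: "\<bar>t\<bar> < \<delta>'" and "p \<in> N'" for t p
  proof -
    define I where "I = {-\<bar>t\<bar>..\<bar>t\<bar>}"
    have I: "compact I" "convex I" "0 \<in> I" "t \<in> I" by (auto simp: I_def)
    have It: "\<bar>s\<bar> < \<delta>'" if "s \<in> I" for s using that t by (auto simp: I_def)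
    define K where "K = (\<lambda>s. graph (s, p)) ` I"
    have "continuous_on I (\<lambda>s. graph (s, p))"
      by (rule continuous_on_compose2[OF cont_graph])
        (use It \<delta>'(3) \<open>p \<in> N'\<close> \<open>N' \<subseteq> N\<close> in \<open>auto intro!: continuous_intros\<close>)
    then have "compact K" unfolding K_def by (rule compact_continuous_image) (rule I(1))
    have "K \<subseteq> Q"
      unfolding K_def
      using box[OF \<delta>'(1)[OF It] subsetD[OF \<open>N' \<subseteq> N1\<close> \<open>p \<in> N'\<close>]] eQ by (intro image_subsetI) blast
    obtain \<rho> where "0 < \<rho>" and \<rho>: "ball p \<rho> \<subseteq> N'"
      using \<open>p \<in> N'\<close> unfolding N'_def by (meson openE open_ball)
    \<comment> \<open>The factor 2 * (B0 + \<delta>' * B) from \<open>short_gronwall\<close>, with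
      \<delta>' * B \<le> 1/2.\<close>
    define C where "C = 2 * B0 + 1"
    have "0 < C" using \<open>0 < B0\<close> by (simp add: C_def)
    \<comment> \<open>Total factor of \<epsilon> in the second estimate: 1 from the error of
      \<open>g0\<close>, \<delta>' * (1 + C) from the linearization of \<open>G\<close>, doubled by
      \<open>short_gronwall\<close>.\<close>
    define D where "D = 2 * (1 + \<delta>' * (1 + C))"
    have "0 < D" using \<open>0 < C\<close> \<open>0 < \<delta>'\<close> by (simp add: D_def add_pos_pos)
    have u_le: "norm (y (s, p') - y (s, p)) \<le> C * norm (p' - p)" if "p' \<in> ball p \<rho>" "s \<in> I" for s p'
    proof -
      have "p' \<in> N'" using that \<rho> by blast
      have "norm (y (s, p') - y (s, p)) \<le> 2 * (norm (y (0, p') - y (0, p)) + \<delta>' * (B * norm (p' - p)))"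
      proof (rule short_gronwall[OF I(1-3), where u = "\<lambda>s. y (s, p') - y (s, p)" and L = B])
        fix s assume s: "s \<in> I"
        show "((\<lambda>s. y (s, p') - y (s, p)) has_vector_derivative G (graph (s, p')) - G (graph (s, p))) (at s within I)"
          using s \<open>p' \<in> N'\<close> \<open>p \<in> N'\<close> \<open>N' \<subseteq> N\<close> \<delta>'(3)[OF It[OF s]] unfolding graph_def
          by (intro has_vector_derivative_diff has_vector_derivative_at_within[OF solD(5)]) auto
        have "norm (G (graph (s, p')) - G (graph (s, p))) \<le> B * norm (graph (s, p') - graph (s, p))"
          using \<open>p' \<in> N'\<close> \<open>p \<in> N'\<close> \<open>N' \<subseteq> N1\<close> \<delta>'(1)[OF It[OF s]] by (intro G_lip box) auto
        also have "norm (graph (s, p') - graph (s, p)) \<le> norm (p' - p) + norm (y (s, p') - y (s, p))"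
          using norm_Pair_le[of "(s, p') - (s, p)" "y (s, p') - y (s, p)"] by (simp add: graph_def norm_Pair)
        finally show "norm (G (graph (s, p')) - G (graph (s, p))) \<le> B * norm (y (s, p') - y (s, p)) + B * norm (p' - p)"
          using \<open>0 < B\<close> by (simp add: algebra_simps)
        show "\<bar>s - 0\<bar> \<le> \<delta>'" using It[OF s] by simp
      qed (use \<open>0 < B\<close> B\<delta> that in auto)
      also have "norm (y (0, p') - y (0, p)) \<le> B0 * norm (p' - p)"
        using g0_lip[of p' p] solD(6) \<open>p' \<in> N'\<close> \<open>p \<in> N'\<close> \<open>N' \<subseteq> N\<close> \<open>N' \<subseteq> N1\<close> N1(3) by (auto simp: subset_iff)
      also have "\<delta>' * (B * norm (p' - p)) \<le> 1 / 2 * norm (p' - p)"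
        using mult_right_mono[OF B\<delta> norm_ge_zero[of "p' - p"]] by (simp add: mult_ac)
      finally show ?thesis by (simp add: C_def algebra_simps)
    qed
    show ?thesis
      unfolding has_derivative_at_alt
    proof (intro conjI allI impI)
      show "bounded_linear (Y (t, p))" by (rule blinfun.bounded_linear_right)
      fix \<epsilon>' :: real assume "0 < \<epsilon>'"
      define \<epsilon> where "\<epsilon> = \<epsilon>' / D"
      have "0 < \<epsilon>" using \<open>0 < \<epsilon>'\<close> \<open>0 < D\<close> by (simp add: \<epsilon>_def)
      obtain \<eta> where "0 < \<eta>" and \<eta>: "\<And>w w'. w \<in> K \<Longrightarrow> norm (w' - w) < \<eta> \<Longrightarrow>
          norm (G w' - G w - ?DG w (w' - w)) \<le> \<epsilon> * norm (w' - w)"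
        using uniformly_linearizable[OF \<open>open Q\<close> Ck_on_has_derivative_Blinfun(1)[OF G]
            continuous_on_blinfun_frechet_derivative[OF G] \<open>compact K\<close> \<open>K \<subseteq> Q\<close> \<open>0 < \<epsilon>\<close>] by metis
      have "(g0 has_derivative frechet_derivative g0 (at p)) (at p)"
        using Ck_on_SucD(1)[OF g0] \<open>p \<in> N'\<close> \<open>N' \<subseteq> N\<close> by blast
      then obtain \<eta>0 where "0 < \<eta>0" and \<eta>0: "\<And>p'. norm (p' - p) < \<eta>0 \<Longrightarrow>
          norm (g0 p' - g0 p - frechet_derivative g0 (at p) (p' - p)) \<le> \<epsilon> * norm (p' - p)"
        using \<open>0 < \<epsilon>\<close> unfolding has_derivative_at_alt by blast
      \<comment> \<open>Graph points over p and p' differ by at most (1 + C) * norm (p' - p); the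
        last bound keeps this below \<open>\<eta>\<close>.\<close>
      define d where "d = min \<rho> (min \<eta>0 (\<eta> / (1 + C)))"
      have "0 < d" using \<open>0 < \<rho>\<close> \<open>0 < \<eta>0\<close> \<open>0 < \<eta>\<close> \<open>0 < C\<close> by (simp add: d_def)
      moreover have "norm (y (t, p') - y (t, p) - Y (t, p) (p' - p)) \<le> \<epsilon>' * norm (p' - p)"
        if "norm (p' - p) < d" for p'
      proof -
        have p': "p' \<in> ball p \<rho>" "norm (p' - p) < \<eta>0" "norm (p' - p) < \<eta> / (1 + C)"
          using that by (auto simp: d_def dist_norm norm_minus_commute)
        then have "p' \<in> N'" using \<rho> by blast
        have small: "(1 + C) * norm (p' - p) < \<eta>" using p'(3) \<open>0 < C\<close> by (simp add: field_simps)
        define v where "v = p' - p"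
        define u where "u s = y (s, p') - y (s, p)" for s
        have diff_graph: "graph (s, p') - graph (s, p) = ((0, v), u s)" for s
          by (simp add: graph_def v_def u_def)
        have norm_graph: "norm (graph (s, p') - graph (s, p)) \<le> (1 + C) * norm v" if "s \<in> I" for s
          using norm_Pair_le[of "(0::real, v)" "u s"] u_le[OF p'(1) that] unfolding diff_graph
          by (simp add: norm_Pair u_def v_def algebra_simps)
        have "norm (u t - Y (t, p) v) \<le> 2 * (norm (u 0 - Y (0, p) v) + \<delta>' * (\<epsilon> * ((1 + C) * norm v)))"
        proof (rule short_gronwall[OF I(1-3), where u = "\<lambda>s. u s - Y (s, p) v" and L = B])
          fix s assume s: "s \<in> I"
          have sN: "s \<in> {-\<delta><..<\<delta>}" "s \<in> {-\<delta>1<..<\<delta>1}" "p \<in> N" "p' \<in> N" "p \<in> N1"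
            using \<delta>'[OF It[OF s]] \<open>p' \<in> N'\<close> \<open>p \<in> N'\<close> \<open>N' \<subseteq> N\<close> \<open>N' \<subseteq> N1\<close> by auto
          let ?u' = "G (graph (s, p')) - G (graph (s, p)) - ?DG (graph (s, p)) ((0, v), Y (s, p) v)"
          show "((\<lambda>s. u s - Y (s, p) v) has_vector_derivative ?u') (at s within I)"
            using sN unfolding graph_def u_def
            by (intro has_vector_derivative_diff has_vector_derivative_at_within[OF solD(5)]
                has_vector_derivative_at_within[OF derY[OF It[OF s] \<open>p \<in> N'\<close>, unfolded graph_def]]) auto
          \<comment> \<open>Inserting the actual difference \<open>u s\<close> isolates the
            linearization error of \<open>G\<close>. What remains is linear in
            \<open>u s - Y (s, p) v\<close>, the quantity to be estimated.\<close>
          have "?DG (graph (s, p)) ((0, v), Y (s, p) v) =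
              ?DG (graph (s, p)) ((0, v), u s) - ?DG (graph (s, p)) ((0, 0), u s - Y (s, p) v)"
            by (simp flip: blinfun.diff_right)
          then have "?u' = (G (graph (s, p')) - G (graph (s, p)) - ?DG (graph (s, p)) ((0, v), u s))
              + ?DG (graph (s, p)) ((0, 0), u s - Y (s, p) v)"
            by simp
          also have "norm \<dots> \<le> \<epsilon> * norm ((0::real, v), u s) + B * norm (u s - Y (s, p) v)"
          proof (rule norm_triangle_mono)
            show "norm (G (graph (s, p')) - G (graph (s, p)) - ?DG (graph (s, p)) ((0, v), u s)) \<le> \<epsilon> * norm ((0::real, v), u s)"
              using \<eta>[of "graph (s, p)" "graph (s, p')"] s norm_graph[OF s] small
              by (simp add: K_def diff_graph v_def)
            have "norm (?DG (graph (s, p)) ((0, 0), u s - Y (s, p) v)) \<le> norm (?DG (graph (s, p))) * norm ((0::real, 0::'p), u s - Y (s, p) v)"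
              by (rule norm_blinfun)
            also have "\<dots> \<le> B * norm (u s - Y (s, p) v)"
              using DG_le[OF box[OF sN(2,5)]] by (simp add: norm_Pair mult_right_mono)
            finally show "norm (?DG (graph (s, p)) ((0, 0), u s - Y (s, p) v)) \<le> B * norm (u s - Y (s, p) v)" .
          qed
          also have "norm ((0::real, v), u s) \<le> (1 + C) * norm v"
            using norm_graph[OF s] by (simp add: diff_graph)
          finally show "norm ?u' \<le> B * norm (u s - Y (s, p) v) + \<epsilon> * ((1 + C) * norm v)"
            using \<open>0 < \<epsilon>\<close> by (simp add: mult_left_mono)
          show "\<bar>s - 0\<bar> \<le> \<delta>'" using It[OF s] by simp
        qed (use \<open>0 < B\<close> \<open>0 < \<epsilon>\<close> \<open>0 < C\<close> B\<delta> I in auto)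
        also have "norm (u 0 - Y (0, p) v) \<le> \<epsilon> * norm v"
          using \<eta>0[OF p'(2)] solD(6)[of p] solD(6)[of p'] \<open>p' \<in> N'\<close> \<open>p \<in> N'\<close> \<open>N' \<subseteq> N\<close>
          by (simp add: initY u_def v_def subset_iff)
        also have "2 * (\<epsilon> * norm v + \<delta>' * (\<epsilon> * ((1 + C) * norm v))) = \<epsilon> * D * norm v"
          by (simp add: D_def algebra_simps)
        also have "\<epsilon> * D = \<epsilon>'" using \<open>0 < D\<close> by (simp add: \<epsilon>_def)
        finally show ?thesis by (simp add: u_def v_def)
      qed
      ultimately show "\<exists>d>0. \<forall>p'. norm (p' - p) < d \<longrightarrow>
          norm (y (t, p') - y (t, p) - Y (t, p) (p' - p)) \<le> \<epsilon>' * norm (p' - p)" by blast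
    qed
  qed

  have contY: "continuous_on ({-\<delta>'<..<\<delta>'} \<times> N') Y"
    by (rule continuous_on_subset[OF solYD(3)]) (use \<open>N' \<subseteq> N2\<close> in \<open>auto simp: \<delta>'_def\<close>)
  have "open N'" by (simp add: N'_def)
  show thesis
  proof (rule that[OF \<open>0 < \<delta>'\<close> _ \<open>open N'\<close> _ \<open>N' \<subseteq> N\<close> contY])
    show "\<delta>' \<le> \<delta>" "p0 \<in> N'" using \<open>\<delta>1 \<le> \<delta>\<close> \<open>0 < r2\<close> by (auto simp: \<delta>'_def N'_def)
    fix t p assume tp: "t \<in> {-\<delta>'<..<\<delta>'}" "p \<in> N'"
    then have t: "\<bar>t\<bar> < \<delta>'" by auto
    have "((\<lambda>(t, p). y (t, p)) has_derivative (\<lambda>(\<tau>, v). \<tau> *\<^sub>R G ((t, p), y (t, p)) + Y (t, p) v))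
        (at (t, p) within {-\<delta>'<..<\<delta>'} \<times> N')"
    \<comment> \<open>Joint differentiability follows from the time derivative at the point and a
      partial derivative in p that exists nearby and is jointly continuous.\<close>
    proof (rule has_derivative_partialsI[where fy = "\<lambda>t p. Y (t, p)"])
      show "((\<lambda>t. y (t, p)) has_derivative (\<lambda>\<tau>. \<tau> *\<^sub>R G ((t, p), y (t, p)))) (at t within {-\<delta>'<..<\<delta>'})"
        using has_vector_derivative_at_within[OF solD(5)[OF \<delta>'(3)[OF t]]] tp(2) \<open>N' \<subseteq> N\<close>
        unfolding has_vector_derivative_def by blast
      show "((\<lambda>p. y (s, p)) has_derivative Y (s, p')) (at p' within N')"
        if "s \<in> {-\<delta>'<..<\<delta>'}" "p' \<in> N'" for s p'
      proof -
        have "\<bar>s\<bar> < \<delta>'" using that by auto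
        show ?thesis by (rule has_derivative_at_withinI[OF der_p[OF \<open>\<bar>s\<bar> < \<delta>'\<close> that(2)]])
      qed
      show "continuous (at (t, p) within {-\<delta>'<..<\<delta>'} \<times> N') (\<lambda>(t, p). Y (t, p))"
        using contY tp by (simp add: continuous_on_eq_continuous_within)
    qed (use tp in \<open>auto simp: N'_def\<close>)
    then show "(y has_derivative (\<lambda>(\<tau>, v). \<tau> *\<^sub>R G ((t, p), y (t, p)) + Y (t, p) v)) (at (t, p))"
      using tp \<open>open N'\<close> by (simp add: at_within_open[of "(t, p)" "{-\<delta>'<..<\<delta>'} \<times> N'"] open_Times)
    show "((\<lambda>s. Y (s, p) v) has_vector_derivative
        frechet_derivative G (at ((t, p), y (t, p))) ((0, v), Y (t, p) v)) (at t)" for v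
      using derY[OF t tp(2), of v] DGgraph[OF t tp(2)] by simp
  qed (use initY in blast)
qed

text \<open>For fixed v, the function \<open>Y q v\<close> solves an equation in which
  \<open>y\<close> itself occurs as a coefficient. The induction hypothesis is therefore used twice:
  for \<open>y\<close>, so that the new right-hand side \<open>H v\<close> has the required order,
  and then for \<open>Y q v\<close>. The order lost by differentiating \<open>G\<close> is regained
  when the derivative of \<open>y\<close> is integrated back into a statement on
  \<open>y\<close>.\<close>

theorem solution_Ck:
  fixes G :: "(real \<times> 'p::euclidean_space) \<times> 'a::euclidean_space \<Rightarrow> 'a"
  assumes "param_solution Q G \<delta> N g0 y" "open Q" "Ck_on (Suc m) Q G" "Ck_on (Suc m) N g0" "p0 \<in> N"
  shows "\<exists>S. open S \<and> (0, p0) \<in> S \<and> S \<subseteq> {-\<delta><..<\<delta>} \<times> N \<and> Ck_on (Suc m) S y"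
  using assms
proof (induction m arbitrary: Q G \<delta> N g0 y)
  case (0 Q G \<delta> N g0 y)
  obtain \<delta>' N' Y where *: "0 < \<delta>'" "\<delta>' \<le> \<delta>" "open N'" "p0 \<in> N'" "N' \<subseteq> N"
    and contY: "continuous_on ({-\<delta>'<..<\<delta>'} \<times> N') (Y :: real \<times> 'p \<Rightarrow> 'p \<Rightarrow>\<^sub>L 'a)"
    and D: "\<And>t p. t \<in> {-\<delta>'<..<\<delta>'} \<Longrightarrow> p \<in> N' \<Longrightarrow>
        (y has_derivative (\<lambda>(\<tau>, v). \<tau> *\<^sub>R G ((t, p), y (t, p)) + Y (t, p) v)) (at (t, p))"
    using solution_C1[OF "0.prems"] by metis
  let ?S = "{-\<delta>'<..<\<delta>'} \<times> N'"
  have "open ?S" by (intro open_Times *) auto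
  have sol': "param_solution Q G \<delta>' N' g0 y"
    by (rule param_solution_subset[OF "0.prems"(1) *(1-3,5)])
  have "Ck_on (Suc 0) ?S y"
  proof (rule Ck_on_SucI[OF \<open>open ?S\<close>])
    show "(y has_derivative (\<lambda>v. fst v *\<^sub>R G (q, y q) + Y q (snd v))) (at q)" if "q \<in> ?S" for q
      using D[of "fst q" "snd q"] that by (auto simp: case_prod_unfold)
    have "continuous_on ?S (\<lambda>q. G (q, y q))"
      by (rule continuous_on_compose2[OF Ck_on_Suc_continuous[OF "0.prems"(3)]])
        (use param_solutionD[OF sol'] in \<open>auto intro!: continuous_intros\<close>)
    then show "Ck_on 0 ?S (\<lambda>q. fst v *\<^sub>R G (q, y q) + Y q (snd v))" for v
      using contY by (auto intro!: continuous_intros)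
  qed
  then show ?case using * \<open>open ?S\<close> by (intro exI[of _ ?S]) auto
next
  case (Suc m Q G \<delta> N g0 y)
  note solD = param_solutionD[OF Suc.prems(1)]
  obtain \<delta>1 N1 Y where *: "0 < \<delta>1" "\<delta>1 \<le> \<delta>" "open N1" "p0 \<in> N1" "N1 \<subseteq> N"
    and contY: "continuous_on ({-\<delta>1<..<\<delta>1} \<times> N1) (Y :: real \<times> 'p \<Rightarrow> 'p \<Rightarrow>\<^sub>L 'a)"
    and D: "\<And>t p. t \<in> {-\<delta>1<..<\<delta>1} \<Longrightarrow> p \<in> N1 \<Longrightarrow>
        (y has_derivative (\<lambda>(\<tau>, v). \<tau> *\<^sub>R G ((t, p), y (t, p)) + Y (t, p) v)) (at (t, p))"
    and DY: "\<And>t p v. t \<in> {-\<delta>1<..<\<delta>1} \<Longrightarrow> p \<in> N1 \<Longrightarrow> ((\<lambda>s. Y (s, p) v) has_vector_derivative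
        frechet_derivative G (at ((t, p), y (t, p))) ((0, v), Y (t, p) v)) (at t)"
    and initY: "\<And>p v. p \<in> N1 \<Longrightarrow> Y (0, p) v = frechet_derivative g0 (at p) v"
    using solution_C1[OF Suc.prems(1,2) Ck_on_mono[OF Suc.prems(3)] Ck_on_mono[OF Suc.prems(4)] Suc.prems(5)]
    by auto
  obtain S1 where S1: "open S1" "(0, p0) \<in> S1" "S1 \<subseteq> {-\<delta><..<\<delta>} \<times> N" "Ck_on (Suc m) S1 y"
    using Suc.IH[OF Suc.prems(1,2) Ck_on_Suc_imp[OF Suc.prems(3)] Ck_on_Suc_imp[OF Suc.prems(4)] Suc.prems(5)] by blast
  have "open (S1 \<inter> {-\<delta>1<..<\<delta>1} \<times> N1)" "(0, p0) \<in> S1 \<inter> {-\<delta>1<..<\<delta>1} \<times> N1"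
    using S1 * by (auto intro!: open_Int open_Times)
  then obtain A0 A1 where A: "open A0" "open A1" "(0, p0) \<in> A0 \<times> A1" "A0 \<times> A1 \<subseteq> S1 \<inter> {-\<delta>1<..<\<delta>1} \<times> N1"
    by (rule open_prod_elim)
  obtain d where d: "0 < d" "ball 0 d \<subseteq> A0" using openE[OF A(1), of 0] A(3) by blast
  define \<delta>2 where "\<delta>2 = min d \<delta>1"
  define B where "B = {-\<delta>2<..<\<delta>2} \<times> A1"
  have "t \<in> ball 0 d" if "t \<in> {-\<delta>2<..<\<delta>2}" for t using that by (auto simp: \<delta>2_def dist_norm)
  then have "B \<subseteq> A0 \<times> A1" using d by (auto simp: B_def)
  then have B: "B \<subseteq> S1" "B \<subseteq> {-\<delta>1<..<\<delta>1} \<times> N1" using A(4) by blast+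
  have "0 < \<delta>2" "\<delta>2 \<le> \<delta>1" using d(1) *(1) by (auto simp: \<delta>2_def)
  have "open B" using A(2) by (auto simp: B_def intro: open_Times)
  have "A1 \<subseteq> N1" using B(2) \<open>0 < \<delta>2\<close> by (force simp: B_def)
  have yB: "Ck_on (Suc m) B y" by (rule Ck_on_subset[OF S1(4) B(1)])
  have graphQ: "(q, y q) \<in> Q" if "q \<in> B" for q
  proof -
    have "q \<in> {-\<delta>1<..<\<delta>1} \<times> N1" using that B(2) by blast
    then show ?thesis using solD(4)[of "fst q" "snd q"] *(2,5) by auto
  qed
  define w where "w x = (fst x, y (fst x))" for x :: "(real \<times> 'p) \<times> 'a"
  define H where "H v x = frechet_derivative G (at (w x)) ((0, v), snd x)" for v x
  let ?Q = "B \<times> (UNIV :: 'a set)"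
  have "open ?Q" by (intro open_Times \<open>open B\<close>) auto
  have H: "Ck_on (Suc m) ?Q (H v)" for v
    unfolding H_def
  proof (rule Ck_on_frechet_derivative_apply[OF \<open>open ?Q\<close> _ Suc.prems(3)])
    show "w ` ?Q \<subseteq> Q" using graphQ by (auto simp: w_def)
    have "Ck_on (Suc m) ?Q fst" "Ck_on (Suc m) ?Q snd"
      by (intro Ck_on_bounded_linear[OF \<open>open ?Q\<close>] bounded_linear_fst bounded_linear_snd)+
    moreover have "Ck_on (Suc m) ?Q (\<lambda>x. y (fst x))"
      by (rule Ck_on_compose[OF \<open>open ?Q\<close> _ yB \<open>Ck_on (Suc m) ?Q fst\<close>]) auto
    ultimately show "Ck_on (Suc m) ?Q w" "Ck_on (Suc m) ?Q (\<lambda>x. ((0, v), snd x))"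
      unfolding w_def[abs_def] by (auto intro!: Ck_on_Pair[OF \<open>open ?Q\<close>])
  qed
  have solY: "param_solution ?Q (H v) \<delta>2 A1 (\<lambda>p. frechet_derivative g0 (at p) v) (\<lambda>q. Y q v)" for v
    unfolding param_solution_def
  proof (intro conjI ballI)
    have "continuous_on B Y" by (rule continuous_on_subset[OF contY B(2)])
    then show "continuous_on ({-\<delta>2<..<\<delta>2} \<times> A1) (\<lambda>q. Y q v)"
      unfolding B_def by (intro continuous_intros)
    fix t p assume tp: "t \<in> {-\<delta>2<..<\<delta>2}" "p \<in> A1"
    then show "((t, p), Y (t, p) v) \<in> ?Q" by (simp add: B_def)
    show "((\<lambda>s. Y (s, p) v) has_vector_derivative H v ((t, p), Y (t, p) v)) (at t)"
      using DY[of t p v] tp \<open>\<delta>2 \<le> \<delta>1\<close> \<open>A1 \<subseteq> N1\<close> by (auto simp: H_def w_def)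
  qed (use \<open>0 < \<delta>2\<close> A(2) \<open>A1 \<subseteq> N1\<close> initY in auto)
  have "\<exists>S. open S \<and> (0, p0) \<in> S \<and> S \<subseteq> B \<and> Ck_on (Suc m) S (\<lambda>q. Y q v)" for v
    unfolding B_def
  proof (rule Suc.IH[OF solY \<open>open ?Q\<close> H])
    show "Ck_on (Suc m) A1 (\<lambda>p. frechet_derivative g0 (at p) v)"
      by (rule Ck_on_subset[OF Ck_on_SucD(2)[OF Suc.prems(4)]]) (use \<open>A1 \<subseteq> N1\<close> *(5) in auto)
    show "p0 \<in> A1" using A(3) by auto
  qed
  then obtain S where S: "\<And>v. open (S v)" "\<And>v. (0, p0) \<in> S v" "\<And>v. S v \<subseteq> B"
      "\<And>v. Ck_on (Suc m) (S v) (\<lambda>q. Y q v)"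
    by metis
  \<comment> \<open>The domains depend on the direction; basis vectors suffice, and finitely many of
    them leave an open intersection.\<close>
  define S2 where "S2 = (\<Inter>v\<in>Basis. S v)"
  have "open S2" unfolding S2_def using S(1) by (intro open_INT) auto
  have "(0, p0) \<in> S2" using S(2) by (auto simp: S2_def)
  have "S2 \<subseteq> B" using S(3) nonempty_Basis by (fastforce simp: S2_def)
  have YS: "Ck_on (Suc m) S2 (\<lambda>q. Y q v)" if "v \<in> Basis" for v
    by (rule Ck_on_subset[OF S(4)]) (use that in \<open>auto simp: S2_def\<close>)
  have "Ck_on (Suc (Suc m)) S2 y"
  proof (rule Ck_on_SucI[OF \<open>open S2\<close>])
    show "(y has_derivative (\<lambda>v. fst v *\<^sub>R G (q, y q) + (\<Sum>i\<in>Basis. (snd v \<bullet> i) *\<^sub>R Y q i))) (at q)"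
      if "q \<in> S2" for q
    proof -
      have "(\<Sum>i\<in>Basis. (v \<bullet> i) *\<^sub>R Y q i) = Y q v" for v
      proof -
        have "Y q (\<Sum>i\<in>Basis. (v \<bullet> i) *\<^sub>R i) = (\<Sum>i\<in>Basis. (v \<bullet> i) *\<^sub>R Y q i)"
          by (simp add: blinfun.sum_right blinfun.scaleR_right)
        then show ?thesis by (simp add: euclidean_representation)
      qed
      moreover have "q \<in> {-\<delta>1<..<\<delta>1} \<times> N1" using that \<open>S2 \<subseteq> B\<close> B(2) by blast
      ultimately show ?thesis
        using D[of "fst q" "snd q"] by (auto simp: case_prod_unfold)
    qed
    have "Ck_on (Suc m) S2 (\<lambda>q. (q, y q))"
      by (intro Ck_on_Pair \<open>open S2\<close> Ck_on_id Ck_on_subset[OF yB \<open>S2 \<subseteq> B\<close>])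
    then have "Ck_on (Suc m) S2 (\<lambda>q. G (q, y q))"
      by (rule Ck_on_compose[OF \<open>open S2\<close> _ Ck_on_Suc_imp[OF Suc.prems(3)], rotated])
        (use graphQ \<open>S2 \<subseteq> B\<close> in auto)
    then show "Ck_on (Suc m) S2 (\<lambda>q. fst v *\<^sub>R G (q, y q) + (\<Sum>i\<in>Basis. (snd v \<bullet> i) *\<^sub>R Y q i))" for v
      by (intro Ck_on_add Ck_on_sum Ck_on_scaleR \<open>open S2\<close> Ck_on_const YS)
  qed
  moreover have "S2 \<subseteq> {-\<delta><..<\<delta>} \<times> N" using \<open>S2 \<subseteq> B\<close> B(1) S1(3) by blast
  ultimately show ?case using \<open>open S2\<close> \<open>(0, p0) \<in> S2\<close> by blast
qed

text \<open>The starting point is the parameter and \<open>g0\<close> the identity. The Lipschitz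
  bound needed for existence is available near \<open>x0\<close> only, hence the restriction of the
  values to a ball.\<close>

theorem local_flow_exists:
  fixes f :: "'a::euclidean_space \<Rightarrow> 'a"
  assumes "open W" "Ck_on (Suc m) W f" "x0 \<in> W"
  obtains \<delta> N \<phi> where "0 < \<delta>" "open N" "x0 \<in> N" "Ck_on (Suc m) ({-\<delta><..<\<delta>} \<times> N) \<phi>"
    "\<And>x. x \<in> N \<Longrightarrow> \<phi> (0, x) = x"
    "\<And>t x. t \<in> {-\<delta><..<\<delta>} \<Longrightarrow> x \<in> N \<Longrightarrow> \<phi> (t, x) \<in> W"
    "\<And>t x. t \<in> {-\<delta><..<\<delta>} \<Longrightarrow> x \<in> N \<Longrightarrow>
        ((\<lambda>s. \<phi> (s, x)) has_vector_derivative f (\<phi> (t, x))) (at t)"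
proof -
  obtain e B where "0 < e" "0 < B" and eW: "ball x0 e \<subseteq> W"
    and lip: "\<And>x y. x \<in> ball x0 e \<Longrightarrow> y \<in> ball x0 e \<Longrightarrow> norm (f x - f y) \<le> B * norm (x - y)"
    using C1_locally_lipschitz[OF assms(1) Ck_on_mono[OF assms(2)] assms(3)] by auto metis
  define Q where "Q = (UNIV :: (real \<times> 'a) set) \<times> ball x0 e"
  have "open Q" unfolding Q_def by (intro open_Times) auto
  have "Ck_on (Suc m) Q snd" by (rule Ck_on_bounded_linear[OF \<open>open Q\<close> bounded_linear_snd])
  then have G: "Ck_on (Suc m) Q (\<lambda>w. f (snd w))"
    by (rule Ck_on_compose[OF \<open>open Q\<close> _ assms(2), rotated]) (use eW in \<open>auto simp: Q_def\<close>)
  obtain \<delta> N \<phi> where "x0 \<in> N" and sol: "param_solution Q (\<lambda>w. f (snd w)) \<delta> N (\<lambda>x. x) \<phi>"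
  proof (rule local_solution_exists[OF \<open>open Q\<close> _ Ck_on_Suc_continuous[OF G], where L = B and ?g0.0 = "\<lambda>x. x"])
    show "((0, x0), x0) \<in> Q" using \<open>0 < e\<close> by (simp add: Q_def)
    show "norm (f (snd (q, y)) - f (snd (q, y'))) \<le> B * norm (y - y')"
      if "(q, y) \<in> Q" "(q, y') \<in> Q" for q y y'
      using that lip by (auto simp: Q_def)
    show "open (ball x0 e)" "x0 \<in> ball x0 e" using \<open>0 < e\<close> by auto
  qed (use \<open>0 < B\<close> in auto)
  note solD = param_solutionD[OF sol]
  obtain S where S: "open S" "(0, x0) \<in> S" "S \<subseteq> {-\<delta><..<\<delta>} \<times> N" "Ck_on (Suc m) S \<phi>"
    using solution_Ck[OF sol \<open>open Q\<close> G Ck_on_id[OF solD(2)] \<open>x0 \<in> N\<close>] by blast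
  obtain A0 A1 where A: "open A0" "open A1" "(0, x0) \<in> A0 \<times> A1" "A0 \<times> A1 \<subseteq> S"
    using open_prod_elim[OF S(1,2)] by blast
  obtain d where d: "0 < d" "ball 0 d \<subseteq> A0" using openE[OF A(1), of 0] A(3) by blast
  have sub: "{-d<..<d} \<times> A1 \<subseteq> S"
    using d(2) A(4) by (auto simp: ball_def dist_norm subset_iff)
  have sub': "t \<in> {-\<delta><..<\<delta>}" "x \<in> N" if "t \<in> {-d<..<d}" "x \<in> A1" for t x
    using that sub S(3) by blast+
  show thesis
  proof (rule that[OF d(1) A(2)])
    show "x0 \<in> A1" using A(3) by auto
    show "Ck_on (Suc m) ({-d<..<d} \<times> A1) \<phi>" by (rule Ck_on_subset[OF S(4) sub])
    show "\<phi> (0, x) = x" if "x \<in> A1" for x using solD(6) sub'(2)[OF _ that, of 0] d(1) by simp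
    show "\<phi> (t, x) \<in> W" if "t \<in> {-d<..<d}" "x \<in> A1" for t x
      using solD(4)[OF sub'[OF that]] eW by (auto simp: Q_def)
    show "((\<lambda>s. \<phi> (s, x)) has_vector_derivative f (\<phi> (t, x))) (at t)"
      if "t \<in> {-d<..<d}" "x \<in> A1" for t x
      using solD(5)[OF sub'[OF that]] by simp
  qed
qed

section \<open>Piecewise smooth vector fields near a crossing point\<close>

lemma has_real_derivative_along_curve:
  fixes h :: "'a::real_normed_vector \<Rightarrow> real"
  assumes h: "Ck_on (Suc 0) S h" "c t \<in> S" and c: "(c has_vector_derivative c') (at t within I)"
  shows "((\<lambda>t. h (c t)) has_real_derivative frechet_derivative h (at (c t)) c') (at t within I)"
proof -
  let ?D = "frechet_derivative h (at (c t))"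
  have D: "(h has_derivative ?D) (at (c t))" using Ck_on_SucD(1)[OF h] .
  have "((\<lambda>t. h (c t)) has_derivative (\<lambda>s. ?D (s *\<^sub>R c'))) (at t within I)"
    using has_derivative_compose[OF c[unfolded has_vector_derivative_def] D] .
  moreover have "?D (s *\<^sub>R c') = ?D c' * s" for s
    using linear_scale[OF has_derivative_linear[OF D]] by simp
  ultimately show ?thesis by (simp add: has_field_derivative_def)
qed

text \<open>Makes the description by \<open>THE\<close> usable: the vector with coordinates
  \<open>?D i\<close> is a gradient, and nondegeneracy of the inner product excludes any
  other.\<close>

lemma gradient_inner:
  fixes f :: "'a::euclidean_space \<Rightarrow> real"
  assumes "Ck_on (Suc 0) S f" "x \<in> S"
  shows "v \<bullet> gradient f x = frechet_derivative f (at x) v"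
proof -
  let ?D = "frechet_derivative f (at x)"
  have D: "(f has_derivative ?D) (at x)" using Ck_on_SucD(1)[OF assms] .
  let ?g = "\<Sum>i\<in>Basis. ?D i *\<^sub>R i"
  have eq: "v \<bullet> ?g = ?D v" for v
    using has_derivative_linear_sum[OF D, of v] by (simp add: inner_sum_right mult.commute)
  have "GDERIV f x :> ?g"
    unfolding gderiv_def using D by (simp add: eq)
  moreover have "g = ?g" if "GDERIV f x :> g" for g
  proof -
    have "(\<lambda>h. h \<bullet> g) = ?D"
      using that D unfolding gderiv_def by (rule has_derivative_unique)
    then have "\<forall>v. v \<bullet> g = v \<bullet> ?g" unfolding eq by metis
    then show ?thesis by (rule iffD1[OF vector_eq_ldot])
  qed
  ultimately have "gradient f x = ?g"
    unfolding gradient_def by (rule the_equality)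
  then show ?thesis by (simp add: eq)
qed

lemma smooth_onD: "smooth_on S f \<Longrightarrow> Ck_on m S f"
  by (simp add: smooth_on_def)

lemma mem_switching_set: "x \<in> switching_set Z \<longleftrightarrow> (\<exists>i\<in>{1..sw_num Z}. sw_fun Z i x = 0)"
  by (auto simp: switching_set_def)

lemma crossing_point_in_switching_set: "crossing_point Z x \<Longrightarrow> x \<in> switching_set Z"
  unfolding crossing_point_def mem_switching_set by blast

context
  fixes Z :: "'a::euclidean_space pws"
  assumes Z: "piecewise_smooth Z"
begin

lemma closed_switching_set: "closed (switching_set Z)"
proof -
  have "closed {x. sw_fun Z i x = 0}" if "i \<in> {1..sw_num Z}" for i
  proof -
    have "continuous_on UNIV (sw_fun Z i)"
      using Z that smooth_onD[of UNIV "sw_fun Z i" 0] by (auto simp: piecewise_smooth_def)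
    then show ?thesis
      by (intro closed_Collect_eq continuous_on_const)
  qed
  then show ?thesis unfolding switching_set_def by (intro closed_UN) auto
qed

lemma region_component: "j \<in> {1..reg_num Z} \<Longrightarrow> region Z j \<in> components (- switching_set Z)"
  using Z unfolding piecewise_smooth_def bij_betw_def by blast

lemma open_region: "j \<in> {1..reg_num Z} \<Longrightarrow> open (region Z j)"
  using open_components[OF _ region_component] closed_switching_set by blast

lemma region_subset: "j \<in> {1..reg_num Z} \<Longrightarrow> region Z j \<subseteq> - switching_set Z"
  using region_component in_components_subset by blast

lemma region_unique:
  "j \<in> {1..reg_num Z} \<Longrightarrow> k \<in> {1..reg_num Z} \<Longrightarrow> x \<in> region Z j \<Longrightarrow> x \<in> region Z k \<Longrightarrow> j = k"
  using components_nonoverlap[OF region_component region_component, of j k] Z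
  unfolding piecewise_smooth_def bij_betw_def inj_on_def by blast

lemma region_cover: "x \<notin> switching_set Z \<Longrightarrow> \<exists>j\<in>{1..reg_num Z}. x \<in> region Z j"
proof -
  assume "x \<notin> switching_set Z"
  then obtain C where "C \<in> components (- switching_set Z)" "x \<in> C"
    using Union_components[of "- switching_set Z"] by blast
  moreover have "components (- switching_set Z) = region Z ` {1..reg_num Z}"
    using Z by (simp add: piecewise_smooth_def bij_betw_def)
  ultimately show ?thesis by auto
qed

lemma connected_subset_region:
  "j \<in> {1..reg_num Z} \<Longrightarrow> connected C \<Longrightarrow> C \<inter> switching_set Z = {} \<Longrightarrow> x \<in> C \<Longrightarrow> x \<in> region Z j \<Longrightarrow>
    C \<subseteq> region Z j"
  using components_maximal[OF region_component, of j C] by blast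

text \<open>Shifting a small ball along a transversal direction moves it to the positive side, so
  every nearby point of that side is joined to one and the same ball off the switching set.\<close>

lemma positive_side_in_region:
  fixes h :: "'a \<Rightarrow> real"
  assumes "open B" "y0 \<in> B" and B: "\<And>z. z \<in> B \<Longrightarrow> z \<in> switching_set Z \<longleftrightarrow> h z = 0"
    and h: "Ck_on (Suc 0) UNIV h" "h y0 = 0" and v: "0 < frechet_derivative h (at y0) v"
  obtains j r where "j \<in> {1..reg_num Z}" "0 < r" "{z \<in> ball y0 r. 0 < h z} \<subseteq> region Z j"
proof -
  have "continuous_on UNIV (\<lambda>z. frechet_derivative h (at z) v)"
    using Ck_on_SucD(2)[OF h(1)] by simp
  then have "open {z. 0 < frechet_derivative h (at z) v}"
    by (intro open_Collect_less continuous_on_const)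
  then obtain r where "0 < r" and r: "ball y0 r \<subseteq> B \<inter> {z. 0 < frechet_derivative h (at z) v}"
    using openE[OF open_Int[OF \<open>open B\<close>], of _ y0] \<open>y0 \<in> B\<close> v by blast
  \<comment> \<open>Shifts by s v with s at most \<delta> have length at most r / 4, so points
    within r / 2 of \<open>y0\<close> remain within r.\<close>
  define \<delta> where "\<delta> = r / (4 * (norm v + 1))"
  have "0 < \<delta>" using \<open>0 < r\<close> by (simp add: \<delta>_def add_nonneg_pos)
  have small: "norm (s *\<^sub>R v) \<le> r / 4" if "s \<in> {0..\<delta>}" for s
  proof -
    have "s * norm v \<le> \<delta> * (norm v + 1)" using that by (intro mult_mono) auto
    also have "\<dots> = r / 4" by (simp add: \<delta>_def field_simps add_nonneg_eq_0_iff)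
    finally show ?thesis using that by simp
  qed
  have incr: "h z < h (z + s *\<^sub>R v)" if "z \<in> ball y0 (r / 2)" "s \<in> {0<..\<delta>}" for z s
  proof -
    have "h (z + 0 *\<^sub>R v) < h (z + s *\<^sub>R v)"
    proof (rule DERIV_pos_imp_increasing[where f = "\<lambda>x. h (z + x *\<^sub>R v)"])
      fix x assume x: "0 \<le> x" "x \<le> s"
      have "dist y0 (z + x *\<^sub>R v) \<le> dist y0 z + norm (x *\<^sub>R v)"
        using dist_triangle[of y0 "z + x *\<^sub>R v" z] by (simp add: dist_norm)
      then have "z + x *\<^sub>R v \<in> ball y0 r"
        using small[of x] x that \<open>0 < r\<close> by auto
      then have "0 < frechet_derivative h (at (z + x *\<^sub>R v)) v" using r by blast
      moreover have "((\<lambda>x. z + x *\<^sub>R v) has_vector_derivative v) (at x)"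
        by (auto intro!: derivative_eq_intros)
      then have "((\<lambda>x. h (z + x *\<^sub>R v)) has_real_derivative frechet_derivative h (at (z + x *\<^sub>R v)) v) (at x)"
        by (rule has_real_derivative_along_curve[OF h(1) UNIV_I])
      ultimately show "\<exists>y. ((\<lambda>x. h (z + x *\<^sub>R v)) has_real_derivative y) (at x) \<and> 0 < y" by blast
    qed (use that in auto)
    then show ?thesis by simp
  qed
  define y1 where "y1 = y0 + \<delta> *\<^sub>R v"
  have "0 < h y1" using incr[of y0 \<delta>] \<open>0 < r\<close> \<open>0 < \<delta>\<close> h(2) by (simp add: y1_def)
  have "open {z. 0 < h z}"
    using Ck_on_Suc_continuous[OF h(1)] by (intro open_Collect_less continuous_on_const)
  then obtain r1 where "0 < r1" and r1: "ball y1 r1 \<subseteq> {z. 0 < h z}"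
    using openE[of _ y1] \<open>0 < h y1\<close> by blast
  define r2 where "r2 = min r1 (r / 2)"
  have "0 < r2" using \<open>0 < r\<close> \<open>0 < r1\<close> by (simp add: r2_def)
  have y1_near: "dist y0 y1 \<le> r / 4"
    using small[of \<delta>] \<open>0 < \<delta>\<close> by (simp add: y1_def dist_norm)
  have ball_y1: "w \<in> B" "0 < h w" if "w \<in> ball y1 r2" for w
  proof -
    have "dist y0 w < r" using dist_triangle[of y0 w y1] y1_near that \<open>0 < r\<close> by (auto simp: r2_def)
    then show "w \<in> B" "0 < h w" using r r1 that by (auto simp: r2_def subset_iff)
  qed
  have "y1 \<in> ball y1 r2" using \<open>0 < r2\<close> by simp
  then have "y1 \<notin> switching_set Z"
    using ball_y1[of y1] B[of y1] by auto
  then obtain j where j: "j \<in> {1..reg_num Z}" "y1 \<in> region Z j" using region_cover by blast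
  have "z \<in> region Z j" if z: "z \<in> ball y0 r2" "0 < h z" for z
  proof -
    \<comment> \<open>The segment joins \<open>z\<close> to its translate, which lies in the ball
      around \<open>y1\<close> because translation by \<delta> v takes \<open>y0\<close> to
      \<open>y1\<close>. On both pieces \<open>h\<close> is positive.\<close>
    let ?T = "closed_segment z (z + \<delta> *\<^sub>R v) \<union> ball y1 r2"
    have "z + \<delta> *\<^sub>R v \<in> ball y1 r2" using z by (simp add: y1_def dist_norm)
    then have "connected ?T"
      using ends_in_segment(2)[of "z + \<delta> *\<^sub>R v" z] by (intro connected_Un) auto
    moreover have "w \<notin> switching_set Z" if "w \<in> ?T" for w
    proof (cases "w \<in> ball y1 r2")
      case True
      then show ?thesis using ball_y1[of w] B[of w] by auto
    next
      case False
      then obtain u where u: "0 \<le> u" "u \<le> 1" "w = (1 - u) *\<^sub>R z + u *\<^sub>R (z + \<delta> *\<^sub>R v)"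
        using \<open>w \<in> ?T\<close> by (auto simp: closed_segment_def)
      then have w: "w = z + (u * \<delta>) *\<^sub>R v" by (simp add: algebra_simps)
      have "u * \<delta> \<in> {0..\<delta>}" using u \<open>0 < \<delta>\<close> by (auto simp: mult_left_le_one_le)
      have "dist y0 w \<le> dist y0 z + norm ((u * \<delta>) *\<^sub>R v)"
        using dist_triangle[of y0 w z] by (simp add: dist_norm w)
      then have "w \<in> B"
        using small[OF \<open>u * \<delta> \<in> {0..\<delta>}\<close>] z r \<open>0 < r\<close> by (auto simp: r2_def subset_iff)
      moreover have "0 < h w"
      proof (cases "u * \<delta> = 0")
        case False
        then have "u * \<delta> \<in> {0<..\<delta>}" using \<open>u * \<delta> \<in> {0..\<delta>}\<close> by (auto simp: less_le)
        then have "h z < h (z + (u * \<delta>) *\<^sub>R v)" using z by (intro incr) (auto simp: r2_def)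
        then show ?thesis using z by (simp add: w)
      qed (use z w \<open>0 < \<delta>\<close> in auto)
      ultimately show ?thesis using B by auto
    qed
    ultimately have "?T \<subseteq> region Z j"
      using connected_subset_region[OF j(1), of ?T y1] j(2) \<open>y1 \<in> ball y1 r2\<close> by blast
    then show ?thesis by auto
  qed
  then show thesis using that[OF j(1) \<open>0 < r2\<close>] by blast
qed

end

text \<open>A local normal form. The sign of \<open>h\<close> is such that both fields increase it,
  which orients the crossing: trajectories come from region \<open>a\<close> and leave into region
  \<open>b\<close>. Both fields are smooth on all of \<open>B\<close>, so each of them can be
  followed across the surface.\<close>

definition crossing_chart :: "'a::euclidean_space pws \<Rightarrow> ('a \<Rightarrow> real) \<Rightarrow> 'a set \<Rightarrow> nat \<Rightarrow> nat \<Rightarrow> bool" where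
  "crossing_chart Z h B a b \<longleftrightarrow>
     open B \<and> a \<in> {1..reg_num Z} \<and> b \<in> {1..reg_num Z} \<and> a \<noteq> b \<and> (\<forall>m. Ck_on m UNIV h) \<and>
     (\<forall>m. Ck_on m B (vfield Z a)) \<and> (\<forall>m. Ck_on m B (vfield Z b)) \<and>
     (\<forall>z\<in>B. 0 < frechet_derivative h (at z) (vfield Z a z) \<and>
             0 < frechet_derivative h (at z) (vfield Z b z)) \<and>
     (\<forall>z\<in>B. (h z < 0 \<longrightarrow> z \<in> region Z a) \<and> (h z = 0 \<longrightarrow> crossing_point Z z) \<and>
             (0 < h z \<longrightarrow> z \<in> region Z b))"

lemma frechet_derivative_uminus:
  assumes "Ck_on (Suc 0) S h" "z \<in> S"
  shows "frechet_derivative (\<lambda>z. - h z) (at z) v = - frechet_derivative h (at z) v"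
  using frechet_derivative_at[OF has_derivative_minus[OF Ck_on_SucD(1)[OF assms]]] by metis

text \<open>Used for \<open>h\<close> and for \<open>- h\<close>, to show that points of the surface
  adhere to the regions on both sides.\<close>

lemma increasing_nearby:
  fixes h :: "'a::real_normed_vector \<Rightarrow> real"
  assumes h: "Ck_on (Suc 0) UNIV h" and v: "0 < frechet_derivative h (at z) v" and "open B" "z \<in> B"
  shows "\<exists>w\<in>B. h z < h w"
proof -
  have "((\<lambda>t. z + t *\<^sub>R v) has_vector_derivative v) (at 0)"
    by (auto intro!: derivative_eq_intros)
  from has_real_derivative_along_curve[OF h UNIV_I this]
  have "((\<lambda>t. h (z + t *\<^sub>R v)) has_real_derivative frechet_derivative h (at z) v) (at 0)"
    by simp
  from has_real_derivative_pos_inc_right[OF this v]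
  obtain d where "0 < d" and d: "\<And>t. 0 < t \<Longrightarrow> t < d \<Longrightarrow> h z < h (z + t *\<^sub>R v)"
    by auto
  have "((\<lambda>t. z + t *\<^sub>R v) \<longlongrightarrow> z + 0 *\<^sub>R v) (at_right 0)"
    by (intro tendsto_intros)
  then have "eventually (\<lambda>t. z + t *\<^sub>R v \<in> B) (at_right 0)"
    using \<open>open B\<close> \<open>z \<in> B\<close> by (intro topological_tendstoD) auto
  moreover have "eventually (\<lambda>t. t \<in> {0<..<d}) (at_right 0)"
    using \<open>0 < d\<close> by (rule eventually_at_right_real)
  ultimately have "eventually (\<lambda>t. z + t *\<^sub>R v \<in> B \<and> t \<in> {0<..<d}) (at_right 0)"
    by (rule eventually_conj)
  then obtain t where "z + t *\<^sub>R v \<in> B" "t \<in> {0<..<d}"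
    using eventually_happens'[of "at_right (0::real)"] by auto
  then show ?thesis using d by auto
qed

text \<open>All zeros of \<open>h\<close> near \<open>y0\<close> have to be crossing points again,
  so no third region may adhere to them. A small neighbourhood without the surface is covered by the
  two sides of \<open>h\<close>, hence only \<open>a\<close> and \<open>b\<close> can occur. The
  definition provides an unordered pair \<open>a'\<close>, \<open>b'\<close>; the sides put it in
  order.\<close>

theorem crossing_chart_exists:
  fixes Z :: "'a::euclidean_space pws"
  assumes Z: "piecewise_smooth Z" and "crossing_point Z y0"
  shows "\<exists>h B a b. crossing_chart Z h B a b \<and> y0 \<in> B \<and> h y0 = 0"
proof -
  obtain i a' b' where i: "{l\<in>{1..sw_num Z}. sw_fun Z l y0 = 0} = {i}"
    and "a' \<noteq> b'" and ab': "{j\<in>{1..reg_num Z}. y0 \<in> closure (region Z j)} = {a', b'}"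
    and prod: "(vfield Z a' y0 \<bullet> gradient (sw_fun Z i) y0) * (vfield Z b' y0 \<bullet> gradient (sw_fun Z i) y0) > 0"
    using assms(2) unfolding crossing_point_def by blast
  have i_mem: "i \<in> {1..sw_num Z}" and "sw_fun Z i y0 = 0" using i by blast+
  have sm: "Ck_on m UNIV (sw_fun Z i)" for m
    using Z i_mem smooth_onD unfolding piecewise_smooth_def by blast
  \<comment> \<open>The sign for which the first field increases \<open>h\<close>; by the product
    condition the second field then increases it too.\<close>
  define s :: real where "s = (if 0 < vfield Z a' y0 \<bullet> gradient (sw_fun Z i) y0 then 1 else - 1)"
  have s: "s * s = 1" by (simp add: s_def)
  define h where "h z = s * sw_fun Z i z" for z
  have hCk: "Ck_on m UNIV h" for m
    unfolding h_def[abs_def]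
    by (rule Ck_on_bounded_linear_compose[OF open_UNIV bounded_linear_mult_right sm])
  have Dh: "frechet_derivative h (at z) v = s * (v \<bullet> gradient (sw_fun Z i) z)" for z v
  proof -
    have "(h has_derivative (\<lambda>v. s * frechet_derivative (sw_fun Z i) (at z) v)) (at z)"
      unfolding h_def[abs_def]
      by (rule has_derivative_mult_right[OF Ck_on_SucD(1)[OF sm UNIV_I]])
    from frechet_derivative_at[OF this] show ?thesis
      using gradient_inner[OF sm UNIV_I, of v z] by metis
  qed
  have pos0: "0 < frechet_derivative h (at y0) (vfield Z a' y0)" "0 < frechet_derivative h (at y0) (vfield Z b' y0)"
    using prod unfolding Dh by (auto simp: s_def zero_less_mult_iff)
  have "h y0 = 0" using \<open>sw_fun Z i y0 = 0\<close> by (simp add: h_def)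
  \<comment> \<open>On this open set the other switching functions do not vanish, so the switching
    set is the zero set of \<open>h\<close>.\<close>
  define B0 where "B0 = - (\<Union>l\<in>{1..sw_num Z} - {i}. {x. sw_fun Z l x = 0})"
  have "closed {x. sw_fun Z l x = 0}" if "l \<in> {1..sw_num Z}" for l
  proof -
    have "continuous_on UNIV (sw_fun Z l)"
      using Z that smooth_onD[of UNIV "sw_fun Z l" 0] by (auto simp: piecewise_smooth_def)
    then show ?thesis by (intro closed_Collect_eq continuous_on_const)
  qed
  then have "open B0" unfolding B0_def by (intro open_Compl closed_UN) auto
  have "y0 \<in> B0" using i unfolding B0_def by blast
  have B0: "{l\<in>{1..sw_num Z}. sw_fun Z l z = 0} = (if h z = 0 then {i} else {})" if "z \<in> B0" for z
    using that i_mem s unfolding B0_def h_def by auto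
  then have B0_sw: "z \<in> switching_set Z \<longleftrightarrow> h z = 0" if "z \<in> B0" for z
  proof -
    have "z \<in> switching_set Z \<longleftrightarrow> {l\<in>{1..sw_num Z}. sw_fun Z l z = 0} \<noteq> {}"
      unfolding mem_switching_set by blast
    then show ?thesis unfolding B0[OF that] by simp
  qed

  have "\<exists>P. open P \<and> y0 \<in> P \<and> (\<forall>m. Ck_on m P (vfield Z k)) \<and>
      (\<forall>z\<in>P. 0 < frechet_derivative h (at z) (vfield Z k z))"
    if k: "k \<in> {1..reg_num Z}" "y0 \<in> closure (region Z k)"
      and pos: "0 < frechet_derivative h (at y0) (vfield Z k y0)" for k
  proof -
    obtain W where "open W" "closure (region Z k) \<subseteq> W" and W: "\<And>m. Ck_on m W (vfield Z k)"
      using Z k(1) unfolding piecewise_smooth_def smooth_on_def by blast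
    have "Ck_on 0 W (\<lambda>z. frechet_derivative h (at z) (vfield Z k z))"
      by (rule Ck_on_frechet_derivative_apply[OF \<open>open W\<close> subset_UNIV hCk Ck_on_id[OF \<open>open W\<close>] W])
    then have "open {z \<in> W. 0 < frechet_derivative h (at z) (vfield Z k z)}"
      using continuous_open_preimage[OF _ \<open>open W\<close> open_greaterThan, of _ 0]
      by (simp add: vimage_def Int_def)
    moreover have "y0 \<in> W" using k(2) \<open>closure (region Z k) \<subseteq> W\<close> by blast
    ultimately show ?thesis
      using pos Ck_on_subset[OF W, of "{z \<in> W. 0 < frechet_derivative h (at z) (vfield Z k z)}"]
      by (intro exI[of _ "{z \<in> W. 0 < frechet_derivative h (at z) (vfield Z k z)}"]) auto
  qed
  note field_near = this
  have a': "a' \<in> {1..reg_num Z}" "y0 \<in> closure (region Z a')" and b': "b' \<in> {1..reg_num Z}" "y0 \<in> closure (region Z b')"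
    using ab' by blast+
  obtain Pa where Pa: "open Pa" "y0 \<in> Pa" "\<And>m. Ck_on m Pa (vfield Z a')"
      "\<And>z. z \<in> Pa \<Longrightarrow> 0 < frechet_derivative h (at z) (vfield Z a' z)"
    using field_near[OF a' pos0(1)] by blast
  obtain Pb where Pb: "open Pb" "y0 \<in> Pb" "\<And>m. Ck_on m Pb (vfield Z b')"
      "\<And>z. z \<in> Pb \<Longrightarrow> 0 < frechet_derivative h (at z) (vfield Z b' z)"
    using field_near[OF b' pos0(2)] by blast
  obtain b r1 where b: "b \<in> {1..reg_num Z}" "0 < r1" "{z \<in> ball y0 r1. 0 < h z} \<subseteq> region Z b"
    using positive_side_in_region[OF Z \<open>open B0\<close> \<open>y0 \<in> B0\<close> B0_sw hCk \<open>h y0 = 0\<close> pos0(1)] by metis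
  \<comment> \<open>The negative side is the positive side of \<open>- h\<close>, with the
    transversal direction reversed.\<close>
  obtain a r2 where a: "a \<in> {1..reg_num Z}" "0 < r2" "{z \<in> ball y0 r2. 0 < - h z} \<subseteq> region Z a"
  proof (rule positive_side_in_region[OF Z \<open>open B0\<close> \<open>y0 \<in> B0\<close>, of "\<lambda>z. - h z" "- vfield Z a' y0"])
    show "0 < frechet_derivative (\<lambda>z. - h z) (at y0) (- vfield Z a' y0)"
      using pos0(1) unfolding frechet_derivative_uminus[OF hCk UNIV_I] Dh by simp
  qed (use B0_sw \<open>h y0 = 0\<close> Ck_on_minus[OF open_UNIV hCk] in auto)
  define B where "B = B0 \<inter> Pa \<inter> Pb \<inter> ball y0 r1 \<inter> ball y0 r2"
  have "open B" using \<open>open B0\<close> Pa(1) Pb(1) by (auto simp: B_def)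
  have "y0 \<in> B" using \<open>y0 \<in> B0\<close> Pa(2) Pb(2) a(2) b(2) by (simp add: B_def)
  have sides: "h z < 0 \<Longrightarrow> z \<in> region Z a" "0 < h z \<Longrightarrow> z \<in> region Z b" if "z \<in> B" for z
    using that a(3) b(3) by (auto simp: B_def)
  have only: "k = a \<or> k = b" if "z \<in> B" "k \<in> {1..reg_num Z}" "z \<in> closure (region Z k)" for z k
  proof -
    have "B \<inter> region Z k \<noteq> {}"
      using open_Int_closure_eq_empty[OF \<open>open B\<close>, of "region Z k"] that by blast
    then obtain w where w: "w \<in> B" "w \<in> region Z k" by blast
    then have "w \<in> B0" "w \<notin> switching_set Z"
      using region_subset[OF Z that(2)] by (auto simp: B_def)
    then have "h w < 0 \<or> 0 < h w" using B0_sw by force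
    then show ?thesis
      using sides[OF w(1)] region_unique[OF Z that(2) a(1) w(2)] region_unique[OF Z that(2) b(1) w(2)]
      by blast
  qed
  \<comment> \<open>Both \<open>a'\<close> and \<open>b'\<close> adhere to \<open>y0\<close>, so
    they belong to {a, b}; being distinct, they exhaust it.\<close>
  then have "{a', b'} = {a, b}" "a \<noteq> b"
    using a' b' \<open>a' \<noteq> b'\<close> \<open>y0 \<in> B\<close> by blast+
  then have sub: "k = a \<or> k = b \<Longrightarrow> k = a' \<or> k = b'" for k by blast
  have "Ck_on m B (vfield Z k)" and pos: "z \<in> B \<Longrightarrow> 0 < frechet_derivative h (at z) (vfield Z k z)"
    if "k = a \<or> k = b" for k m z
    using sub[OF that] Pa(4) Pb(4) Ck_on_subset[OF Pa(3), of B] Ck_on_subset[OF Pb(3), of B]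
    by (auto simp: B_def)
  note fields = this
  have closures: "z \<in> closure (region Z a)" "z \<in> closure (region Z b)" if z: "z \<in> B" "h z = 0" for z
  proof -
    have "\<exists>w\<in>region Z b. dist w z < e" if "0 < e" for e
    proof -
      have "\<exists>w\<in>B \<inter> ball z e. h z < h w"
        by (rule increasing_nearby[OF hCk pos[of b]]) (use z \<open>0 < e\<close> \<open>open B\<close> in auto)
      then obtain w where "w \<in> B" "dist w z < e" "0 < h w" using z by (auto simp: dist_commute)
      then show ?thesis using sides(2) by blast
    qed
    then show "z \<in> closure (region Z b)" by (simp add: closure_approachable)
    have "\<exists>w\<in>region Z a. dist w z < e" if "0 < e" for e
    proof -
      have "0 < frechet_derivative (\<lambda>z. - h z) (at z) (- vfield Z b z)"
        using pos[of b z] z unfolding frechet_derivative_uminus[OF hCk UNIV_I] Dh by simp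
      then have "\<exists>w\<in>B \<inter> ball z e. - h z < - h w"
        by (rule increasing_nearby[OF Ck_on_minus[OF open_UNIV hCk]]) (use z \<open>0 < e\<close> \<open>open B\<close> in auto)
      then obtain w where "w \<in> B" "dist w z < e" "h w < 0" using z by (auto simp: dist_commute)
      then show ?thesis using sides(1) by blast
    qed
    then show "z \<in> closure (region Z a)" by (simp add: closure_approachable)
  qed
  have cross: "crossing_point Z z" if z: "z \<in> B" "h z = 0" for z
  proof -
    have p: "0 < s * (vfield Z a z \<bullet> gradient (sw_fun Z i) z)" "0 < s * (vfield Z b z \<bullet> gradient (sw_fun Z i) z)"
      using pos[of a z] pos[of b z] z unfolding Dh by auto
    have "0 < (s * (vfield Z a z \<bullet> gradient (sw_fun Z i) z)) * (s * (vfield Z b z \<bullet> gradient (sw_fun Z i) z))"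
      using p by (rule mult_pos_pos)
    also have "\<dots> = (s * s) * ((vfield Z a z \<bullet> gradient (sw_fun Z i) z) * (vfield Z b z \<bullet> gradient (sw_fun Z i) z))"
      by (simp only: mult_ac)
    finally have "0 < (vfield Z a z \<bullet> gradient (sw_fun Z i) z) * (vfield Z b z \<bullet> gradient (sw_fun Z i) z)"
      by (simp add: s)
    moreover have "gradient (sw_fun Z i) z \<noteq> 0" using p(1) by auto
    moreover have "{l\<in>{1..sw_num Z}. sw_fun Z l z = 0} = {i}"
      using B0[of z] z by (simp add: B_def)
    moreover have "{j\<in>{1..reg_num Z}. z \<in> closure (region Z j)} = {a, b}"
      using only[OF z(1)] closures[OF z] a(1) b(1) by blast
    ultimately show ?thesis unfolding crossing_point_def using \<open>a \<noteq> b\<close> by blast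
  qed
  have "crossing_chart Z h B a b"
    unfolding crossing_chart_def
    using \<open>open B\<close> a(1) b(1) \<open>a \<noteq> b\<close> hCk fields[of a] fields[of b] sides cross by simp
  then show ?thesis using \<open>y0 \<in> B\<close> \<open>h y0 = 0\<close> by blast
qed

section \<open>Solutions: uniqueness and time reversal\<close>

text \<open>The condition of \<open>pws_solution\<close> at a single time, separated so that
  restriction, shift, reversal and gluing can be checked time by time.\<close>

definition solution_at :: "'a::euclidean_space pws \<Rightarrow> (real \<Rightarrow> 'a) \<Rightarrow> real set \<Rightarrow> real \<Rightarrow> bool" where
  "solution_at Z \<phi> I t \<longleftrightarrow>
     (\<exists>j\<in>{1..reg_num Z}. \<phi> t \<in> region Z j \<and>
        (\<phi> has_vector_derivative vfield Z j (\<phi> t)) (at t within I)) \<or>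
     (crossing_point Z (\<phi> t) \<and>
        (\<exists>a\<in>{1..reg_num Z}. \<exists>b\<in>{1..reg_num Z}. \<exists>d>0. a \<noteq> b \<and>
           \<phi> ` (I \<inter> {t-d<..<t}) \<subseteq> region Z a \<and>
           \<phi> ` (I \<inter> {t<..<t+d}) \<subseteq> region Z b \<and>
           (\<phi> has_vector_derivative vfield Z a (\<phi> t)) (at t within (I \<inter> {..t})) \<and>
           (\<phi> has_vector_derivative vfield Z b (\<phi> t)) (at t within (I \<inter> {t..}))))"

lemma pws_solution_iff: "pws_solution Z \<phi> I \<longleftrightarrow> is_interval I \<and> (\<forall>t\<in>I. solution_at Z \<phi> I t)"
  by (simp add: pws_solution_def solution_at_def)

lemma pws_solution_cases:
  assumes "pws_solution Z \<phi> I" "t \<in> I"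
  obtains (reg) j where "j \<in> {1..reg_num Z}" "\<phi> t \<in> region Z j"
      "(\<phi> has_vector_derivative vfield Z j (\<phi> t)) (at t within I)"
    | (cross) a b d where "crossing_point Z (\<phi> t)" "a \<in> {1..reg_num Z}" "b \<in> {1..reg_num Z}" "0 < d" "a \<noteq> b"
      "\<phi> ` (I \<inter> {t-d<..<t}) \<subseteq> region Z a" "\<phi> ` (I \<inter> {t<..<t+d}) \<subseteq> region Z b"
      "(\<phi> has_vector_derivative vfield Z a (\<phi> t)) (at t within (I \<inter> {..t}))"
      "(\<phi> has_vector_derivative vfield Z b (\<phi> t)) (at t within (I \<inter> {t..}))"
  using assms unfolding pws_solution_def by metis

lemma solution_at_region:
  "j \<in> {1..reg_num Z} \<Longrightarrow> \<phi> t \<in> region Z j \<Longrightarrow>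
    (\<phi> has_vector_derivative vfield Z j (\<phi> t)) (at t within I) \<Longrightarrow> solution_at Z \<phi> I t"
  unfolding solution_at_def by blast

lemma solution_at_crossing:
  assumes "crossing_point Z (\<phi> t)" "a \<in> {1..reg_num Z}" "b \<in> {1..reg_num Z}" "0 < d" "a \<noteq> b"
    and "\<And>s. s \<in> I \<Longrightarrow> t - d < s \<Longrightarrow> s < t \<Longrightarrow> \<phi> s \<in> region Z a"
    and "\<And>s. s \<in> I \<Longrightarrow> t < s \<Longrightarrow> s < t + d \<Longrightarrow> \<phi> s \<in> region Z b"
    and "(\<phi> has_vector_derivative vfield Z a (\<phi> t)) (at t within (I \<inter> {..t}))"
    and "(\<phi> has_vector_derivative vfield Z b (\<phi> t)) (at t within (I \<inter> {t..}))"
  shows "solution_at Z \<phi> I t"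
proof -
  have "\<phi> ` (I \<inter> {t-d<..<t}) \<subseteq> region Z a" "\<phi> ` (I \<inter> {t<..<t+d}) \<subseteq> region Z b"
    using assms(6,7) by auto
  then show ?thesis
    unfolding solution_at_def using assms(1-5,8,9) by metis
qed

lemma pws_solution_interval: "pws_solution Z \<phi> I \<Longrightarrow> is_interval I"
  by (simp add: pws_solution_def)

lemma pws_solution_subset:
  assumes sol: "pws_solution Z \<phi> I" and "is_interval J" and J: "J \<subseteq> I"
  shows "pws_solution Z \<phi> J"
  unfolding pws_solution_iff
proof (intro conjI ballI)
  fix t assume "t \<in> J"
  then have "t \<in> I" using J by blast
  from sol this show "solution_at Z \<phi> J t"
  proof (cases rule: pws_solution_cases)
    case reg
    then show ?thesis
      using has_vector_derivative_within_subset[OF reg(3) J] by (intro solution_at_region)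
  next
    case (cross a b d)
    show ?thesis
    proof (rule solution_at_crossing[of Z \<phi> t a b d])
      show "(\<phi> has_vector_derivative vfield Z a (\<phi> t)) (at t within (J \<inter> {..t}))"
        by (rule has_vector_derivative_within_subset[OF cross(8)]) (use J in blast)
      show "(\<phi> has_vector_derivative vfield Z b (\<phi> t)) (at t within (J \<inter> {t..}))"
        by (rule has_vector_derivative_within_subset[OF cross(9)]) (use J in blast)
    qed (use cross(1-7) J in \<open>auto simp: image_subset_iff\<close>)
  qed
qed (rule assms(2))

lemma pws_solution_continuous:
  assumes "pws_solution Z \<phi> I"
  shows "continuous_on I \<phi>"
  unfolding continuous_on_eq_continuous_within
proof
  fix t assume "t \<in> I"
  from assms this show "continuous (at t within I) \<phi>"
  proof (cases rule: pws_solution_cases)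
    case reg
    then show ?thesis using has_vector_derivative_continuous by blast
  next
    case (cross a b d)
    have "continuous (at t within (I \<inter> {..t})) \<phi>" "continuous (at t within (I \<inter> {t..})) \<phi>"
      using cross(8,9) has_vector_derivative_continuous by blast+
    then have "continuous (at t within (I \<inter> {..t}) \<union> (I \<inter> {t..})) \<phi>"
      by (simp add: continuous_within Lim_Un)
    moreover have "(I \<inter> {..t}) \<union> (I \<inter> {t..}) = I" by auto
    ultimately show ?thesis by simp
  qed
qed

lemma has_vector_derivative_shift:
  fixes c \<sigma> :: real
  assumes "(\<phi> has_vector_derivative v) (at (\<sigma> * t + c) within J)" "\<And>s. s \<in> I \<Longrightarrow> \<sigma> * s + c \<in> J"
  shows "((\<lambda>s. \<phi> (\<sigma> * s + c)) has_vector_derivative \<sigma> *\<^sub>R v) (at t within I)"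
proof -
  have "(\<phi> \<circ> (\<lambda>s. \<sigma> * s + c) has_vector_derivative \<sigma> *\<^sub>R v) (at t within I)"
  proof (rule vector_diff_chain_within)
    show "((\<lambda>s. \<sigma> * s + c) has_vector_derivative \<sigma>) (at t within I)"
      by (auto intro!: derivative_eq_intros simp flip: has_real_derivative_iff_has_vector_derivative)
    show "(\<phi> has_vector_derivative v) (at (\<sigma> * t + c) within (\<lambda>s. \<sigma> * s + c) ` I)"
      by (rule has_vector_derivative_within_subset[OF assms(1)]) (use assms(2) in blast)
  qed
  then show ?thesis by (simp add: o_def)
qed

lemma pws_solution_shift:
  assumes sol: "pws_solution Z \<phi> I" and "is_interval J" and J: "\<And>s. s \<in> J \<Longrightarrow> s + c \<in> I"
  shows "pws_solution Z (\<lambda>s. \<phi> (s + c)) J"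
  unfolding pws_solution_iff
proof (intro conjI ballI)
  fix t assume "t \<in> J"
  from sol J[OF this] show "solution_at Z (\<lambda>s. \<phi> (s + c)) J t"
  proof (cases rule: pws_solution_cases)
    case (reg j)
    then show ?thesis
      using has_vector_derivative_shift[of \<phi> _ 1 t c I J] J by (intro solution_at_region) auto
  next
    case (cross a b d)
    show ?thesis
    proof (rule solution_at_crossing[of Z "\<lambda>s. \<phi> (s + c)" t a b d])
      show "((\<lambda>s. \<phi> (s + c)) has_vector_derivative vfield Z a (\<phi> (t + c))) (at t within (J \<inter> {..t}))"
        using has_vector_derivative_shift[of \<phi> _ 1 t c "I \<inter> {..t + c}" "J \<inter> {..t}"] cross(8) J by simp
      show "((\<lambda>s. \<phi> (s + c)) has_vector_derivative vfield Z b (\<phi> (t + c))) (at t within (J \<inter> {t..}))"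
        using has_vector_derivative_shift[of \<phi> _ 1 t c "I \<inter> {t + c..}" "J \<inter> {t..}"] cross(9) J by simp
    qed (use cross(1-7) J in \<open>auto simp: image_subset_iff\<close>)
  qed
qed (rule assms(2))

section \<open>Time reversal\<close>

definition rev_pws :: "'a::euclidean_space pws \<Rightarrow> 'a pws" where
  "rev_pws Z = Z\<lparr>vfield := \<lambda>j x. - vfield Z j x\<rparr>"

lemma rev_pws_simps [simp]:
  "sw_num (rev_pws Z) = sw_num Z" "sw_fun (rev_pws Z) = sw_fun Z" "reg_num (rev_pws Z) = reg_num Z"
  "region (rev_pws Z) = region Z" "vfield (rev_pws Z) j x = - vfield Z j x"
  "switching_set (rev_pws Z) = switching_set Z" "rev_pws (rev_pws Z) = Z"
  by (simp_all add: rev_pws_def switching_set_def)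

lemma crossing_point_rev [simp]: "crossing_point (rev_pws Z) x = crossing_point Z x"
  by (simp add: crossing_point_def)

lemma piecewise_smooth_rev: "piecewise_smooth Z \<Longrightarrow> piecewise_smooth (rev_pws Z)"
proof -
  assume Z: "piecewise_smooth Z"
  have "smooth_on W (vfield (rev_pws Z) j)" if "open W" "smooth_on W (vfield Z j)" for W j
    using that Ck_on_minus[OF that(1)] by (auto simp: smooth_on_def rev_pws_def)
  then show ?thesis
    using Z unfolding piecewise_smooth_def rev_pws_simps by blast
qed

lemma pws_solution_reverse:
  assumes sol: "pws_solution Z \<phi> {0..T}"
  shows "pws_solution (rev_pws Z) (\<lambda>s. \<phi> (T - s)) {0..T}"
  unfolding pws_solution_iff
proof (intro conjI ballI is_interval_cc)
  fix t assume "t \<in> {0..T}"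
  then have "T - t \<in> {0..T}" by auto
  from sol this show "solution_at (rev_pws Z) (\<lambda>s. \<phi> (T - s)) {0..T} t"
  proof (cases rule: pws_solution_cases)
    case (reg j)
    then show ?thesis
      using has_vector_derivative_shift[of \<phi> _ "-1" t T "{0..T}" "{0..T}"] by (intro solution_at_region) auto
  next
    case (cross a b d)
    show ?thesis
    \<comment> \<open>Reversal exchanges the incoming and the outgoing region.\<close>
    proof (rule solution_at_crossing[of "rev_pws Z" "\<lambda>s. \<phi> (T - s)" t b a d])
      show "((\<lambda>s. \<phi> (T - s)) has_vector_derivative vfield (rev_pws Z) b (\<phi> (T - t))) (at t within ({0..T} \<inter> {..t}))"
        using has_vector_derivative_shift[of \<phi> _ "-1" t T "{0..T} \<inter> {T - t..}" "{0..T} \<inter> {..t}"] cross(9) by simp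
      show "((\<lambda>s. \<phi> (T - s)) has_vector_derivative vfield (rev_pws Z) a (\<phi> (T - t))) (at t within ({0..T} \<inter> {t..}))"
        using has_vector_derivative_shift[of \<phi> _ "-1" t T "{0..T} \<inter> {..T - t}" "{0..T} \<inter> {t..}"] cross(8) by simp
    qed (use cross(1-7) in \<open>auto simp: image_subset_iff\<close>)
  qed
qed

section \<open>Forward uniqueness\<close>

context
  fixes Z :: "'a::euclidean_space pws"
  assumes Z: "piecewise_smooth Z"
begin

lemma pws_solution_stays_in_open:
  assumes "pws_solution Z \<phi> I" "t \<in> I" "open W" "\<phi> t \<in> W"
  shows "\<exists>d>0. \<forall>s\<in>I. \<bar>s - t\<bar> < d \<longrightarrow> \<phi> s \<in> W"
proof -
  have "continuous (at t within I) \<phi>"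
    using pws_solution_continuous[OF assms(1)] assms(2) by (simp add: continuous_on_eq_continuous_within)
  then have "eventually (\<lambda>s. \<phi> s \<in> W) (at t within I)"
    unfolding continuous_within using assms(3,4) by (rule topological_tendstoD)
  then obtain d where "0 < d" "\<And>s. s \<in> I \<Longrightarrow> s \<noteq> t \<Longrightarrow> dist s t < d \<Longrightarrow> \<phi> s \<in> W"
    unfolding eventually_at by blast
  then show ?thesis using assms(4) by (intro exI[of _ d]) (auto simp: dist_real_def)
qed

lemma pws_solution_derivative_in_region:
  assumes "pws_solution Z \<phi> I" "s \<in> I" "j \<in> {1..reg_num Z}" "\<phi> s \<in> region Z j"
  shows "(\<phi> has_vector_derivative vfield Z j (\<phi> s)) (at s within I)"
  using assms(1,2)
proof (cases rule: pws_solution_cases)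
  case (reg k)
  then show ?thesis using region_unique[OF Z reg(1) assms(3) reg(2) assms(4)] by simp
next
  case cross
  then show ?thesis
    using region_subset[OF Z assms(3)] assms(4) crossing_point_in_switching_set by blast
qed

lemma region_forward_derivative:
  assumes sol: "pws_solution Z \<phi> {0..T}" and t: "0 \<le> t" "t < T" and j: "j \<in> {1..reg_num Z}" "\<phi> t \<in> region Z j"
  shows "\<exists>d>0. t + d \<le> T \<and> (\<forall>s\<in>{t..t+d}. \<phi> s \<in> region Z j \<and>
      (\<phi> has_vector_derivative vfield Z j (\<phi> s)) (at s within {t..t+d}))"
proof -
  have "t \<in> {0..T}" using t by simp
  then obtain e where "0 < e" and e: "\<And>s. s \<in> {0..T} \<Longrightarrow> \<bar>s - t\<bar> < e \<Longrightarrow> \<phi> s \<in> region Z j"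
    using pws_solution_stays_in_open[OF sol _ open_region[OF Z j(1)] j(2)] by blast
  define d where "d = min (e / 2) (T - t)"
  have "0 < d" "t + d \<le> T" using \<open>0 < e\<close> t by (auto simp: d_def)
  moreover have "\<phi> s \<in> region Z j \<and> (\<phi> has_vector_derivative vfield Z j (\<phi> s)) (at s within {t..t+d})"
    if s: "s \<in> {t..t+d}" for s
  proof -
    have "s \<in> {0..T}" "\<bar>s - t\<bar> < e" using s t \<open>0 < e\<close> by (auto simp: d_def)
    then have "\<phi> s \<in> region Z j" by (rule e)
    moreover have "(\<phi> has_vector_derivative vfield Z j (\<phi> s)) (at s within {t..t+d})"
      by (rule has_vector_derivative_within_subset[OF pws_solution_derivative_in_region[OF sol \<open>s \<in> {0..T}\<close> j(1) \<open>\<phi> s \<in> region Z j\<close>]])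
        (use t \<open>t + d \<le> T\<close> in auto)
    ultimately show ?thesis by blast
  qed
  ultimately show ?thesis by blast
qed

text \<open>The definition of a solution only provides some region \<open>b1\<close> after the
  crossing. The sample time \<open>s1\<close> shows that \<open>b1\<close> is one of the two regions
  of the chart; whichever it is, its field increases \<open>h\<close>, so the solution enters the
  side \<open>0 < h\<close>, which is region \<open>b\<close>, and \<open>b1 = b\<close>
  follows.\<close>

lemma crossing_forward_derivative:
  assumes sol: "pws_solution Z \<phi> {0..T}" and t: "0 \<le> t" "t < T"
    and chart: "crossing_chart Z h B a b" and h: "\<phi> t \<in> B" "h (\<phi> t) = 0"
  shows "\<exists>d>0. t + d \<le> T \<and> (\<forall>s\<in>{t..t+d}. \<phi> s \<in> B \<and>
      (\<phi> has_vector_derivative vfield Z b (\<phi> s)) (at s within {t..t+d}))"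
proof -
  have c: "open B" "a \<in> {1..reg_num Z}" "b \<in> {1..reg_num Z}" "\<And>m. Ck_on m UNIV h"
    "\<And>z. z \<in> B \<Longrightarrow> 0 < frechet_derivative h (at z) (vfield Z a z)"
    "\<And>z. z \<in> B \<Longrightarrow> 0 < frechet_derivative h (at z) (vfield Z b z)"
    "\<And>z. z \<in> B \<Longrightarrow> h z < 0 \<Longrightarrow> z \<in> region Z a" "\<And>z. z \<in> B \<Longrightarrow> h z = 0 \<Longrightarrow> crossing_point Z z"
    "\<And>z. z \<in> B \<Longrightarrow> 0 < h z \<Longrightarrow> z \<in> region Z b"
    using chart unfolding crossing_chart_def by blast+
  have t_mem: "t \<in> {0..T}" using t by simp
  obtain d2 where "0 < d2" and d2: "\<And>s. s \<in> {0..T} \<Longrightarrow> \<bar>s - t\<bar> < d2 \<Longrightarrow> \<phi> s \<in> B"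
    using pws_solution_stays_in_open[OF sol t_mem c(1) h(1)] by blast
  from sol t_mem show ?thesis
  proof (cases rule: pws_solution_cases)
    case (reg j)
    then show ?thesis
      using region_subset[OF Z reg(1)] crossing_point_in_switching_set[OF c(8)[OF h]] by blast
  next
    case (cross a1 b1 d1)
    define s1 where "s1 = t + min (min d1 d2) (T - t) / 2"
    have s1: "s1 \<in> {0..T}" "t < s1" "s1 < t + d1" "\<bar>s1 - t\<bar> < d2"
      using cross(4) \<open>0 < d2\<close> t unfolding s1_def by (auto simp: min_def field_simps)
    then have "\<phi> s1 \<in> region Z b1" using cross(7) by auto
    then have "b1 = a \<or> b1 = b"
      using c(7,8,9)[OF d2[OF s1(1,4)]] region_unique[OF Z cross(3) c(2)] region_unique[OF Z cross(3) c(3)]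
        region_subset[OF Z cross(3)] crossing_point_in_switching_set[of Z "\<phi> s1"]
      by (metis ComplD in_mono linorder_less_linear)
    then have "0 < frechet_derivative h (at (\<phi> t)) (vfield Z b1 (\<phi> t))" using c(5,6) h(1) by blast
    from has_real_derivative_pos_inc_right[OF has_real_derivative_along_curve[OF c(4) UNIV_I cross(9)] this]
    obtain d3 where "0 < d3" and d3: "\<And>x. 0 < x \<Longrightarrow> t + x \<in> {0..T} \<inter> {t..} \<Longrightarrow> x < d3 \<Longrightarrow> h (\<phi> t) < h (\<phi> (t + x))"
      by blast
    define d where "d = min (min d1 (min d2 d3)) (T - t) / 2"
    have d: "0 < d" "d < d1" "d < d2" "d < d3" "t + d \<le> T"
      using cross(4) \<open>0 < d2\<close> \<open>0 < d3\<close> t unfolding d_def by (auto simp: min_def field_simps)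
    have in_b: "\<phi> s \<in> region Z b" if "s \<in> {t<..t+d}" for s
    proof -
      have "h (\<phi> t) < h (\<phi> (t + (s - t)))" using that d t by (intro d3) auto
      moreover have "\<phi> s \<in> B" using that d t by (intro d2) auto
      ultimately show ?thesis using c(9) h(2) by simp
    qed
    have "\<phi> (t + d) \<in> region Z b1" using cross(7) d t by auto
    then have "b1 = b"
      using region_unique[OF Z cross(3) c(3)] in_b[of "t + d"] d(1) by auto
    have "\<phi> s \<in> B \<and> (\<phi> has_vector_derivative vfield Z b (\<phi> s)) (at s within {t..t+d})" if s: "s \<in> {t..t+d}" for s
    proof
      show "\<phi> s \<in> B" using s d t by (intro d2) auto
      show "(\<phi> has_vector_derivative vfield Z b (\<phi> s)) (at s within {t..t+d})"
      proof (cases "s = t")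
        case True
        show ?thesis
          unfolding True
          by (rule has_vector_derivative_within_subset[OF cross(9)[unfolded \<open>b1 = b\<close>]]) (use t d in auto)
      next
        case False
        have "s \<in> {0..T}" using s t d by auto
        show ?thesis
          by (rule has_vector_derivative_within_subset[OF
                pws_solution_derivative_in_region[OF sol \<open>s \<in> {0..T}\<close> c(3) in_b]])
            (use s t d False in auto)
      qed
    qed
    then show ?thesis using d by blast
  qed
qed

lemma vfield_smooth_on_region: "j \<in> {1..reg_num Z} \<Longrightarrow> Ck_on m (region Z j) (vfield Z j)"
proof -
  assume "j \<in> {1..reg_num Z}"
  then obtain W where "closure (region Z j) \<subseteq> W" "smooth_on W (vfield Z j)"
    using Z unfolding piecewise_smooth_def by blast
  then show ?thesis
    using closure_subset[of "region Z j"] by (intro Ck_on_subset[OF smooth_onD, of W]) auto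
qed

text \<open>The right-hand side governing a solution just after a point depends on that point only.\<close>

lemma forward_field:
  assumes sol0: "pws_solution Z \<phi>0 {0..T}" and t: "0 \<le> t" "t < T"
  shows "\<exists>W f. open W \<and> Ck_on (Suc 0) W f \<and> \<phi>0 t \<in> W \<and>
     (\<forall>\<phi>. pws_solution Z \<phi> {0..T} \<longrightarrow> \<phi> t = \<phi>0 t \<longrightarrow> (\<exists>d>0. t + d \<le> T \<and> (\<forall>s\<in>{t..t+d}. \<phi> s \<in> W \<and>
      (\<phi> has_vector_derivative f (\<phi> s)) (at s within {t..t+d}))))"
proof -
  have "t \<in> {0..T}" using t by simp
  from sol0 this show ?thesis
  proof (cases rule: pws_solution_cases)
    case (reg j)
    show ?thesis
      using region_forward_derivative[OF _ t reg(1)] reg(2) open_region[OF Z reg(1)] vfield_smooth_on_region[OF reg(1)]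
      by (intro exI[of _ "region Z j"] exI[of _ "vfield Z j"]) auto
  next
    case cross
    obtain h B a b where chart: "crossing_chart Z h B a b" and B: "\<phi>0 t \<in> B" "h (\<phi>0 t) = 0"
      using crossing_chart_exists[OF Z cross(1)] by blast
    then have "open B" "Ck_on (Suc 0) B (vfield Z b)" unfolding crossing_chart_def by blast+
    then show ?thesis
      using crossing_forward_derivative[OF _ t chart] B
      by (intro exI[of _ B] exI[of _ "vfield Z b"]) auto
  qed
qed

text \<open>Just after t both solutions obey one and the same Lipschitz equation, so
  \<open>short_gronwall\<close> with zero initial difference and zero error applies.\<close>

lemma pws_solution_locally_unique:
  assumes sol: "pws_solution Z \<phi> {0..T}" "pws_solution Z \<psi> {0..T}" and t: "0 \<le> t" "t < T" and eq: "\<phi> t = \<psi> t"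
  shows "\<exists>d>0. t + d \<le> T \<and> (\<forall>s\<in>{t..t+d}. \<phi> s = \<psi> s)"
proof -
  obtain W f where "open W" and f: "Ck_on (Suc 0) W f" and "\<phi> t \<in> W" and
    W: "\<And>\<xi>. pws_solution Z \<xi> {0..T} \<Longrightarrow> \<xi> t = \<phi> t \<Longrightarrow> (\<exists>d>0. t + d \<le> T \<and> (\<forall>s\<in>{t..t+d}. \<xi> s \<in> W \<and>
      (\<xi> has_vector_derivative f (\<xi> s)) (at s within {t..t+d})))"
    using forward_field[OF sol(1) t] by blast
  obtain e B where "0 < e" "0 < B"
    and lip: "\<And>x y. x \<in> ball (\<phi> t) e \<Longrightarrow> y \<in> ball (\<phi> t) e \<Longrightarrow> norm (f x - f y) \<le> B * norm (x - y)"
    using C1_locally_lipschitz[OF \<open>open W\<close> f \<open>\<phi> t \<in> W\<close>] by metis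
  have t_mem: "t \<in> {0..T}" using t by simp
  obtain d1 where d1: "0 < d1" "t + d1 \<le> T"
      "\<And>s. s \<in> {t..t+d1} \<Longrightarrow> (\<phi> has_vector_derivative f (\<phi> s)) (at s within {t..t+d1})"
    using W[OF sol(1)] by blast
  obtain d2 where d2: "0 < d2" "t + d2 \<le> T"
      "\<And>s. s \<in> {t..t+d2} \<Longrightarrow> (\<psi> has_vector_derivative f (\<psi> s)) (at s within {t..t+d2})"
    using W[OF sol(2)] eq by metis
  obtain d3 where "0 < d3" and d3: "\<And>s. s \<in> {0..T} \<Longrightarrow> \<bar>s - t\<bar> < d3 \<Longrightarrow> \<phi> s \<in> ball (\<phi> t) e"
    using pws_solution_stays_in_open[OF sol(1) t_mem open_ball, of "\<phi> t" e] \<open>0 < e\<close> by auto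
  obtain d4 where "0 < d4" and d4: "\<And>s. s \<in> {0..T} \<Longrightarrow> \<bar>s - t\<bar> < d4 \<Longrightarrow> \<psi> s \<in> ball (\<phi> t) e"
    using pws_solution_stays_in_open[OF sol(2) t_mem open_ball, of "\<phi> t" e] \<open>0 < e\<close> eq by auto
  define d where "d = min (min d1 d2) (min (min d3 d4 / 2) (1 / (2 * B)))"
  have d: "0 < d" "d \<le> d1" "d \<le> d2" "d < d3" "d < d4" "d \<le> 1 / (2 * B)"
    using d1(1) d2(1) \<open>0 < d3\<close> \<open>0 < d4\<close> \<open>0 < B\<close> by (auto simp: d_def min_def)
  have Bd: "B * d \<le> 1 / 2" using d(6) \<open>0 < B\<close> by (simp add: field_simps)
  have "\<phi> s = \<psi> s" if s: "s \<in> {t..t+d}" for s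
  proof -
    have "norm (\<phi> s - \<psi> s) \<le> 2 * (norm (\<phi> t - \<psi> t) + d * 0)"
    proof (rule short_gronwall[where u = "\<lambda>s. \<phi> s - \<psi> s" and I = "{t..t+d}" and L = B])
      fix r assume r: "r \<in> {t..t+d}"
      have "(\<phi> has_vector_derivative f (\<phi> r)) (at r within {t..t+d})"
        by (rule has_vector_derivative_within_subset[OF d1(3)]) (use r d in auto)
      moreover have "(\<psi> has_vector_derivative f (\<psi> r)) (at r within {t..t+d})"
        by (rule has_vector_derivative_within_subset[OF d2(3)]) (use r d in auto)
      ultimately show "((\<lambda>s. \<phi> s - \<psi> s) has_vector_derivative f (\<phi> r) - f (\<psi> r)) (at r within {t..t+d})"
        by (rule has_vector_derivative_diff)
      have "r \<in> {0..T}" "\<bar>r - t\<bar> < d3" "\<bar>r - t\<bar> < d4" using r t d d1(2) by auto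
      then show "norm (f (\<phi> r) - f (\<psi> r)) \<le> B * norm (\<phi> r - \<psi> r) + 0"
        using lip[OF d3 d4] by simp
    qed (use s d(1) \<open>0 < B\<close> Bd in auto)
    then show ?thesis using eq by simp
  qed
  moreover have "t + d \<le> T" using d(2) d1(2) by simp
  ultimately show ?thesis using d(1) by blast
qed

text \<open>By continuity the solutions agree at the infimum of the times of disagreement; local
  uniqueness then pushes the agreement beyond it.\<close>

theorem pws_solution_unique:
  assumes sol: "pws_solution Z \<phi> {0..T}" "pws_solution Z \<psi> {0..T}" and eq: "\<phi> 0 = \<psi> 0" and "s \<in> {0..T}"
  shows "\<phi> s = \<psi> s"
proof (rule ccontr)
  assume "\<phi> s \<noteq> \<psi> s"
  define A where "A = {r \<in> {0..T}. \<phi> r \<noteq> \<psi> r}"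
  have "s \<in> A" using \<open>\<phi> s \<noteq> \<psi> s\<close> assms(4) by (simp add: A_def)
  have bdd: "bdd_below A" by (rule bdd_belowI[of _ 0]) (auto simp: A_def)
  define t where "t = Inf A"
  have "t \<le> s" unfolding t_def by (rule cInf_lower[OF \<open>s \<in> A\<close> bdd])
  have "0 \<le> t" unfolding t_def by (rule cInf_greatest) (use \<open>s \<in> A\<close> in \<open>auto simp: A_def\<close>)
  have before: "\<phi> r = \<psi> r" if "0 \<le> r" "r < t" for r
  proof (rule ccontr)
    assume "\<phi> r \<noteq> \<psi> r"
    then have "r \<in> A" using that \<open>t \<le> s\<close> assms(4) by (simp add: A_def)
    then have "t \<le> r" unfolding t_def by (rule cInf_lower[OF _ bdd])
    then show False using that(2) by simp
  qed
  have "\<phi> t = \<psi> t"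
  proof (cases "t = 0")
    case False
    have "continuous_on {0..t} (\<lambda>r. \<phi> r - \<psi> r)"
      using pws_solution_continuous[OF sol(1)] pws_solution_continuous[OF sol(2)] \<open>t \<le> s\<close> assms(4)
      by (intro continuous_intros) (auto elim!: continuous_on_subset)
    moreover have closure: "closure {0..<t} = {0..t}" using False \<open>0 \<le> t\<close> by simp
    ultimately have "\<phi> t - \<psi> t = 0"
      using continuous_constant_on_closure[of "{0..<t}" "\<lambda>r. \<phi> r - \<psi> r" 0 t, unfolded closure]
        before \<open>0 \<le> t\<close> by auto
    then show ?thesis by simp
  qed (use eq in simp)
  have "t \<noteq> s" using \<open>\<phi> t = \<psi> t\<close> \<open>\<phi> s \<noteq> \<psi> s\<close> by blast
  then have "t < T" using \<open>t \<le> s\<close> assms(4) by simp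
  obtain d where "0 < d" "t + d \<le> T" and d: "\<And>r. r \<in> {t..t+d} \<Longrightarrow> \<phi> r = \<psi> r"
    using pws_solution_locally_unique[OF sol \<open>0 \<le> t\<close> \<open>t < T\<close> \<open>\<phi> t = \<psi> t\<close>] by blast
  have "t + d \<le> r" if "r \<in> A" for r
  proof (rule ccontr)
    assume "\<not> t + d \<le> r"
    moreover have "t \<le> r" unfolding t_def by (rule cInf_lower[OF that bdd])
    ultimately have "\<phi> r = \<psi> r" by (intro d) auto
    then show False using that by (simp add: A_def)
  qed
  then have "t + d \<le> t" unfolding t_def by (intro cInf_greatest) (use \<open>s \<in> A\<close> in auto)
  then show False using \<open>0 < d\<close> by simp
qed

end

section \<open>Local flow and crossing time\<close>

text \<open>Monotonicity makes the root unique, and the signs of \<open>H\<close> slightly before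
  and after it persist when p moves a little. This gives continuity of the root before anything is
  differentiated.\<close>

lemma increasing_root_continuous:
  fixes H :: "real \<times> 'p::metric_space \<Rightarrow> real"
  assumes "open N" "p0 \<in> N" "0 < \<delta>" and cont: "continuous_on ({-\<delta><..<\<delta>} \<times> N) H" and "H (0, p0) = 0"
    and mono: "\<And>p s t. p \<in> N \<Longrightarrow> s \<in> {-\<delta><..<\<delta>} \<Longrightarrow> t \<in> {-\<delta><..<\<delta>} \<Longrightarrow> s < t \<Longrightarrow> H (s, p) < H (t, p)"
  obtains N' \<tau> where "open N'" "p0 \<in> N'" "N' \<subseteq> N" "continuous_on N' \<tau>"
    "\<And>p. p \<in> N' \<Longrightarrow> \<tau> p \<in> {-\<delta><..<\<delta>}" "\<And>p. p \<in> N' \<Longrightarrow> H (\<tau> p, p) = 0"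
proof -
  have cont_p: "continuous_on N (\<lambda>p. H (t, p))" if "t \<in> {-\<delta><..<\<delta>}" for t
    by (rule continuous_on_compose2[OF cont]) (use that in \<open>auto intro!: continuous_intros\<close>)
  define M where "M s t = {p \<in> N. H (s, p) < 0} \<inter> {p \<in> N. 0 < H (t, p)}" for s t
  have open_M: "open (M s t)" if "s \<in> {-\<delta><..<\<delta>}" "t \<in> {-\<delta><..<\<delta>}" for s t
    using continuous_open_preimage[OF cont_p[OF that(1)] \<open>open N\<close> open_lessThan, of 0]
      continuous_open_preimage[OF cont_p[OF that(2)] \<open>open N\<close> open_greaterThan, of 0]
    unfolding M_def by (intro open_Int) (simp_all add: vimage_def Int_def)
  define \<eta> where "\<eta> = \<delta> / 2"
  have \<eta>: "0 < \<eta>" "\<eta> \<in> {-\<delta><..<\<delta>}" "-\<eta> \<in> {-\<delta><..<\<delta>}" using \<open>0 < \<delta>\<close> by (auto simp: \<eta>_def)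
  define N' where "N' = M (-\<eta>) \<eta>"
  have "N' \<subseteq> N" by (auto simp: N'_def M_def)
  have "\<exists>t\<in>{-\<delta><..<\<delta>}. H (t, p) = 0" if "p \<in> N'" for p
  proof -
    have "continuous_on {-\<eta>..\<eta>} (\<lambda>t. H (t, p))"
      by (rule continuous_on_compose2[OF cont])
        (use that \<eta> in \<open>auto simp: N'_def M_def intro!: continuous_intros\<close>)
    moreover have "H (-\<eta>, p) \<le> 0" "0 \<le> H (\<eta>, p)" using that by (simp_all add: N'_def M_def)
    ultimately obtain t where "-\<eta> \<le> t" "t \<le> \<eta>" "H (t, p) = 0"
      using IVT'[of "\<lambda>t. H (t, p)" "-\<eta>" 0 \<eta>] \<eta>(1) by auto
    then show ?thesis using \<eta> by auto
  qed
  then obtain \<tau> where \<tau>: "\<And>p. p \<in> N' \<Longrightarrow> \<tau> p \<in> {-\<delta><..<\<delta>}" "\<And>p. p \<in> N' \<Longrightarrow> H (\<tau> p, p) = 0"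
    by metis
  have "continuous (at q within N') \<tau>" if q: "q \<in> N'" for q
    unfolding continuous_within
  proof (rule tendstoI)
    fix e :: real assume "0 < e"
    \<comment> \<open>Half of the available margin: both comparison times stay in the interval and
      closer than e to the root.\<close>
    define \<kappa> where "\<kappa> = min e (min (\<delta> - \<tau> q) (\<tau> q + \<delta>)) / 2"
    have \<kappa>: "0 < \<kappa>" "\<kappa> < e" "\<tau> q - \<kappa> \<in> {-\<delta><..<\<delta>}" "\<tau> q + \<kappa> \<in> {-\<delta><..<\<delta>}"
      using \<open>0 < e\<close> \<tau>(1)[OF q] by (auto simp: \<kappa>_def min_def field_simps)
    have "q \<in> M (\<tau> q - \<kappa>) (\<tau> q + \<kappa>)"
      using mono[OF _ \<kappa>(3) \<tau>(1)[OF q], of q] mono[OF _ \<tau>(1)[OF q] \<kappa>(4), of q] \<tau>(2)[OF q] \<kappa>(1) q \<open>N' \<subseteq> N\<close>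
      by (auto simp: M_def)
    then have "eventually (\<lambda>p. p \<in> M (\<tau> q - \<kappa>) (\<tau> q + \<kappa>)) (nhds q)"
      by (rule eventually_nhds_in_open[OF open_M[OF \<kappa>(3,4)]])
    then show "eventually (\<lambda>p. dist (\<tau> p) (\<tau> q) < e) (at q within N')"
      unfolding eventually_at_filter
    proof (rule eventually_mono, intro impI)
      fix p assume *: "p \<in> M (\<tau> q - \<kappa>) (\<tau> q + \<kappa>)" "p \<noteq> q" "p \<in> N'"
      then have p: "p \<in> N" "H (\<tau> q - \<kappa>, p) < 0" "0 < H (\<tau> q + \<kappa>, p)" by (auto simp: M_def)
      have "\<tau> q - \<kappa> < \<tau> p"
        using mono[OF p(1) \<tau>(1)[OF \<open>p \<in> N'\<close>] \<kappa>(3)] p(2) \<tau>(2)[OF \<open>p \<in> N'\<close>] by (cases "\<tau> p" "\<tau> q - \<kappa>" rule: linorder_cases) auto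
      moreover have "\<tau> p < \<tau> q + \<kappa>"
        using mono[OF p(1) \<kappa>(4) \<tau>(1)[OF \<open>p \<in> N'\<close>]] p(3) \<tau>(2)[OF \<open>p \<in> N'\<close>] by (cases "\<tau> p" "\<tau> q + \<kappa>" rule: linorder_cases) auto
      ultimately show "dist (\<tau> p) (\<tau> q) < e" using \<kappa>(2) by (auto simp: dist_real_def abs_less_iff)
    qed
  qed
  then have "continuous_on N' \<tau>" by (simp add: continuous_on_eq_continuous_within)
  moreover have "open N'" unfolding N'_def by (rule open_M[OF \<eta>(3,2)])
  moreover have "p0 \<in> N'"
    using mono[OF \<open>p0 \<in> N\<close> \<eta>(3), of 0] mono[OF \<open>p0 \<in> N\<close> _ \<eta>(2), of 0] \<open>H (0, p0) = 0\<close> \<eta>(1) \<open>0 < \<delta>\<close> \<open>p0 \<in> N\<close>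
    by (simp add: N'_def M_def)
  ultimately show thesis using that \<open>N' \<subseteq> N\<close> \<tau> by blast
qed

lemma increasing_in_time:
  fixes H :: "real \<times> 'p::real_normed_vector \<Rightarrow> real"
  assumes H: "Ck_on (Suc 0) ({-\<delta><..<\<delta>} \<times> N) H"
    and pos: "\<And>q. q \<in> {-\<delta><..<\<delta>} \<times> N \<Longrightarrow> 0 < frechet_derivative H (at q) (1, 0)"
    and "p \<in> N" "s \<in> {-\<delta><..<\<delta>}" "t \<in> {-\<delta><..<\<delta>}" "s < t"
  shows "H (s, p) < H (t, p)"
proof (rule DERIV_pos_imp_increasing[where f = "\<lambda>t. H (t, p)", OF \<open>s < t\<close>])
  fix x assume "s \<le> x" "x \<le> t"
  then have x: "(x, p) \<in> {-\<delta><..<\<delta>} \<times> N" using assms by auto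
  have "((\<lambda>t. (t, p)) has_vector_derivative (1, 0)) (at x)"
    by (auto intro!: has_vector_derivative_Pair derivative_eq_intros)
  from has_real_derivative_along_curve[OF H x this]
  show "\<exists>y. ((\<lambda>t. H (t, p)) has_real_derivative y) (at x) \<and> 0 < y" using pos[OF x] by blast
qed

text \<open>The levels of \<open>H\<close> are kept as a parameter \<open>u\<close>: then \<open>(u, p) \<mapsto> (\<tau> (u, p), p)\<close> is a continuous
  right inverse of \<open>(t, p) \<mapsto> (H (t, p), p)\<close> and the derivative of the inverse is available.\<close>

theorem scalar_implicit_function:
  fixes H :: "real \<times> 'p::euclidean_space \<Rightarrow> real"
  assumes "open N" "p0 \<in> N" "0 < \<delta>" and H: "Ck_on (Suc m) ({-\<delta><..<\<delta>} \<times> N) H" and "H (0, p0) = 0"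
    and pos: "\<And>q. q \<in> {-\<delta><..<\<delta>} \<times> N \<Longrightarrow> 0 < frechet_derivative H (at q) (1, 0)"
  obtains N' \<tau> where "open N'" "p0 \<in> N'" "N' \<subseteq> N" "Ck_on (Suc m) N' \<tau>"
    "\<And>p. p \<in> N' \<Longrightarrow> \<tau> p \<in> {-\<delta><..<\<delta>}" "\<And>p. p \<in> N' \<Longrightarrow> H (\<tau> p, p) = 0"
proof -
  let ?J = "{-\<delta><..<\<delta>}"
  let ?D = "\<lambda>q. frechet_derivative H (at q)"
  have H1: "Ck_on (Suc 0) (?J \<times> N) H" by (rule Ck_on_mono[OF H]) simp
  define H2 where "H2 q = H (fst q, snd (snd q)) - fst (snd q)" for q :: "real \<times> real \<times> 'p"
  have "continuous_on (?J \<times> (UNIV \<times> N)) (\<lambda>q. H (fst q, snd (snd q)))"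
    by (rule continuous_on_compose2[OF Ck_on_Suc_continuous[OF H]]) (auto intro!: continuous_intros)
  then have cont2: "continuous_on (?J \<times> (UNIV \<times> N)) H2"
    unfolding H2_def by (intro continuous_intros)
  obtain N2 T where N2: "open N2" "(0, p0) \<in> N2" "N2 \<subseteq> UNIV \<times> N" "continuous_on N2 T"
    "\<And>p. p \<in> N2 \<Longrightarrow> T p \<in> ?J" "\<And>p. p \<in> N2 \<Longrightarrow> H2 (T p, p) = 0"
  proof (rule increasing_root_continuous[OF _ _ \<open>0 < \<delta>\<close> cont2])
    show "H2 (s, p) < H2 (t, p)" if "p \<in> UNIV \<times> N" "s \<in> ?J" "t \<in> ?J" "s < t" for p s t
      using increasing_in_time[OF H1 pos _ that(2-4), of "snd p"] that(1) by (auto simp: H2_def)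
  qed (use \<open>open N\<close> \<open>p0 \<in> N\<close> \<open>H (0, p0) = 0\<close> in \<open>auto simp: H2_def open_Times\<close>)
  define N' where "N' = (\<lambda>p. (0, p)) -` N2"
  define \<tau> where "\<tau> p = T (0, p)" for p
  have "open N'"
    unfolding N'_def by (intro open_vimage N2(1) continuous_intros)
  have \<tau>: "\<tau> p \<in> ?J" "H (\<tau> p, p) = 0" "p \<in> N" if "p \<in> N'" for p
    using N2(3,5,6) that by (auto simp: \<tau>_def N'_def H2_def)
  have D\<tau>: "(\<tau> has_derivative (\<lambda>v. - (?D (\<tau> p, p) (0, v) * inverse (?D (\<tau> p, p) (1, 0))))) (at p)"
    if p: "p \<in> N'" for p
  proof -
    let ?q = "(\<tau> p, p)"
    have q: "?q \<in> ?J \<times> N" using \<tau>[OF p] by simp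
    have DH: "(H has_derivative ?D ?q) (at ?q)" by (rule Ck_on_SucD(1)[OF H q])
    have lin: "?D ?q (s, v) = s * ?D ?q (1, 0) + ?D ?q (0, v)" for s v
    proof -
      have "?D ?q (s, v) = ?D ?q (s *\<^sub>R (1, 0) + (0, v))" by simp
      also have "\<dots> = s *\<^sub>R ?D ?q (1, 0) + ?D ?q (0, v)"
        using has_derivative_linear[OF DH] by (simp only: linear_add linear_scale)
      finally show ?thesis by simp
    qed
    have "0 < ?D ?q (1, 0)" by (rule pos[OF q])
    define F where "F q = (H q, snd q)" for q
    define g where "g y = (T y, snd y)" for y
    \<comment> \<open>Inverse of the linear map w \<mapsto> (?D ?q w, snd w): the first equation is
      solved for the time component, whose coefficient \<open>?D ?q (1, 0)\<close> is
      positive.\<close>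
    define g' where "g' y = ((fst y - ?D ?q (0, snd y)) * inverse (?D ?q (1, 0)), snd y)" for y
    have "bounded_linear (\<lambda>y. ?D ?q (0, snd y))"
      by (rule bounded_linear_compose[OF has_derivative_bounded_linear[OF DH]])
        (intro bounded_linear_Pair bounded_linear_zero bounded_linear_snd)
    then have "bounded_linear g'"
      unfolding g'_def
      by (intro bounded_linear_Pair bounded_linear_snd bounded_linear_const_mult
          bounded_linear_compose[OF bounded_linear_mult_left] bounded_linear_sub bounded_linear_fst)
    have "(g has_derivative g') (at (0, p))"
    proof (rule has_derivative_inverse_basic[where f = F and T = N2 and f' = "\<lambda>w. (?D ?q w, snd w)"])
      show "(F has_derivative (\<lambda>w. (?D ?q w, snd w))) (at (g (0, p)))"
        unfolding F_def g_def \<tau>_def[symmetric] snd_conv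
        by (intro has_derivative_Pair DH bounded_linear.has_derivative[OF bounded_linear_snd] has_derivative_ident)
      show "g' \<circ> (\<lambda>w. (?D ?q w, snd w)) = id"
      proof
        fix w :: "real \<times> 'p"
        show "(g' \<circ> (\<lambda>w. (?D ?q w, snd w))) w = id w"
          using lin[of "fst w" "snd w"] \<open>0 < ?D ?q (1, 0)\<close> by (simp add: g'_def prod_eq_iff)
      qed
      show "continuous (at (0, p)) g"
      proof -
        have "continuous_on N2 g" unfolding g_def using N2(4) by (intro continuous_intros)
        then show ?thesis using p N2(1) by (simp add: continuous_on_eq_continuous_at N'_def)
      qed
      show "F (g y) = y" if "y \<in> N2" for y
        using N2(6)[OF that] by (simp add: F_def g_def H2_def prod_eq_iff)
    qed (use N2(1) p \<open>bounded_linear g'\<close> in \<open>auto simp: N'_def\<close>)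
    moreover have "((\<lambda>p. (0::real, p)) has_derivative (\<lambda>v. (0, v))) (at p)"
      by (auto intro!: derivative_eq_intros)
    ultimately have "((\<lambda>p. g (0, p)) has_derivative (\<lambda>v. g' (0, v))) (at p)"
      by (rule has_derivative_compose[rotated])
    from bounded_linear.has_derivative[OF bounded_linear_fst this]
    show ?thesis by (simp add: g_def g'_def \<tau>_def[abs_def])
  qed
  \<comment> \<open>Bootstrapping: the derivative of \<open>\<tau>\<close> is a formula in
    \<open>\<tau>\<close> and the derivative of \<open>H\<close>, so each order of
    \<open>\<tau>\<close> yields the next.\<close>
  have "Ck_on k N' \<tau>" if "k \<le> Suc m" for k
    using that
  proof (induction k)
    case 0
    have "continuous_on N' \<tau>"
      by (intro continuous_at_imp_continuous_on ballI) (rule has_derivative_continuous[OF D\<tau>])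
    then show ?case by simp
  next
    case (Suc k)
    have w: "Ck_on k N' (\<lambda>p. (\<tau> p, p))"
      using Suc by (intro Ck_on_Pair \<open>open N'\<close> Ck_on_id) simp
    have Hk: "Ck_on (Suc k) (?J \<times> N) H" by (rule Ck_on_mono[OF H]) (use Suc.prems in simp)
    have sub: "(\<lambda>p. (\<tau> p, p)) ` N' \<subseteq> ?J \<times> N" using \<tau> by auto
    have D: "Ck_on k N' (\<lambda>p. ?D (\<tau> p, p) v)" for v
      by (rule Ck_on_frechet_derivative_apply[OF \<open>open N'\<close> sub Hk w]) simp
    show ?case
    proof (rule Ck_on_SucI[OF \<open>open N'\<close> D\<tau>])
      have "Ck_on k N' (\<lambda>p. inverse (?D (\<tau> p, p) (1, 0)))"
      proof (rule Ck_on_inverse[OF \<open>open N'\<close> D])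
        show "?D (\<tau> p, p) (1, 0) \<noteq> 0" if "p \<in> N'" for p
          using pos[of "(\<tau> p, p)"] \<tau>[OF that] by auto
      qed
      from Ck_on_minus[OF \<open>open N'\<close> Ck_on_scaleR[OF \<open>open N'\<close> D this]]
      show "Ck_on k N' (\<lambda>p. - (?D (\<tau> p, p) (0, v) * inverse (?D (\<tau> p, p) (1, 0))))" for v
        by simp
    qed
  qed
  then have "Ck_on (Suc m) N' \<tau>" by simp
  moreover have "p0 \<in> N'" "N' \<subseteq> N" using N2(2) \<tau>(3) by (auto simp: N'_def)
  ultimately show thesis using that[OF \<open>open N'\<close>] \<tau> by blast
qed

text \<open>Smoothness is demanded only around points that start and end off the switching set, on a
  neighbourhood that may depend on the point and the time. The order \<open>m\<close> is an argument
  because \<open>N\<close> and \<open>d\<close> come from a construction that depends on it.\<close>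

definition local_flow :: "'a::euclidean_space pws \<Rightarrow> nat \<Rightarrow> 'a set \<Rightarrow> real \<Rightarrow> (real \<Rightarrow> 'a \<Rightarrow> 'a) \<Rightarrow> bool" where
  "local_flow Z m N d \<Phi> \<longleftrightarrow> open N \<and> 0 < d \<and>
     (\<forall>z\<in>N. pws_solution Z (\<lambda>s. \<Phi> s z) {0..<d} \<and> \<Phi> 0 z = z) \<and>
     (\<forall>t\<in>{0..<d}. continuous_on N (\<Phi> t)) \<and>
     (\<forall>t\<in>{0..<d}. \<forall>z\<in>N. z \<notin> switching_set Z \<longrightarrow> \<Phi> t z \<notin> switching_set Z \<longrightarrow>
        (\<exists>S. open S \<and> z \<in> S \<and> Ck_on m S (\<Phi> t)))"

lemma Ck_on_time_section:
  fixes \<phi> :: "real \<times> 'a::euclidean_space \<Rightarrow> 'b::real_normed_vector"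
  assumes "Ck_on m (J \<times> N) \<phi>" "open N" "t \<in> J"
  shows "Ck_on m N (\<lambda>z. \<phi> (t, z))"
proof (rule Ck_on_compose[OF assms(2) _ assms(1)])
  show "Pair t ` N \<subseteq> J \<times> N" using assms(3) by auto
  show "Ck_on m N (Pair t)" by (rule Ck_on_Pair[OF assms(2) Ck_on_const Ck_on_id[OF assms(2)]])
qed

lemma is_interval_co_real: "is_interval {a..<b::real}"
  unfolding is_interval_1 by auto

section \<open>Local flows at regular points and at crossing points\<close>

context
  fixes Z :: "'a::euclidean_space pws"
  assumes Z: "piecewise_smooth Z"
begin

lemma local_flow_region:
  assumes j: "j \<in> {1..reg_num Z}" and "y0 \<in> region Z j"
  shows "\<exists>N d \<Phi>. y0 \<in> N \<and> local_flow Z m N d \<Phi>"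
proof -
  obtain d N \<phi> where *: "0 < d" "open N" "y0 \<in> N" and \<phi>: "Ck_on (Suc m) ({-d<..<d} \<times> N) \<phi>"
    "\<And>x. x \<in> N \<Longrightarrow> \<phi> (0, x) = x"
    "\<And>t x. t \<in> {-d<..<d} \<Longrightarrow> x \<in> N \<Longrightarrow> \<phi> (t, x) \<in> region Z j"
    "\<And>t x. t \<in> {-d<..<d} \<Longrightarrow> x \<in> N \<Longrightarrow>
        ((\<lambda>s. \<phi> (s, x)) has_vector_derivative vfield Z j (\<phi> (t, x))) (at t)"
    by (rule local_flow_exists[OF open_region[OF Z j] vfield_smooth_on_region[OF Z j, of "Suc m"] assms(2)])
      (rule that; assumption)
  have sec: "Ck_on (Suc m) N (\<lambda>z. \<phi> (t, z))" if "t \<in> {0..<d}" for t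
    by (rule Ck_on_time_section[OF \<phi>(1) *(2)]) (use that in auto)
  have "local_flow Z m N d (\<lambda>t z. \<phi> (t, z))"
    unfolding local_flow_def
  proof (intro conjI ballI impI)
    fix z assume "z \<in> N"
    show "pws_solution Z (\<lambda>s. \<phi> (s, z)) {0..<d}"
      unfolding pws_solution_iff
      using \<phi>(3,4) \<open>z \<in> N\<close> j
      by (auto intro!: is_interval_co_real solution_at_region intro: has_vector_derivative_at_within)
    show "\<phi> (0, z) = z" by (rule \<phi>(2)[OF \<open>z \<in> N\<close>])
  next
    fix t assume "t \<in> {0..<d}"
    then show "continuous_on N (\<lambda>z. \<phi> (t, z))" by (rule Ck_on_Suc_continuous[OF sec])
    show "\<exists>S. open S \<and> z \<in> S \<and> Ck_on m S (\<lambda>z. \<phi> (t, z))" if "z \<in> N" for z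
      using Ck_on_Suc_imp[OF sec[OF \<open>t \<in> {0..<d}\<close>]] *(2) that by blast
  qed (use * in auto)
  then show ?thesis using *(3) by blast
qed

text \<open>Brings transversality into the form asked for by
  \<open>scalar_implicit_function\<close>: the derivative of \<open>h\<close> along the field is the
  partial derivative of the height in direction (1, 0).\<close>

lemma crossing_height_increasing:
  fixes \<phi> :: "real \<times> 'a \<Rightarrow> 'a" and h :: "'a \<Rightarrow> real"
  assumes h: "\<And>m. Ck_on m UNIV h" and "open N" and \<phi>: "Ck_on (Suc m) ({-\<delta><..<\<delta>} \<times> N) \<phi>"
    and der: "\<And>t x. t \<in> {-\<delta><..<\<delta>} \<Longrightarrow> x \<in> N \<Longrightarrow>
        ((\<lambda>s. \<phi> (s, x)) has_vector_derivative f (\<phi> (t, x))) (at t)"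
    and pos: "\<And>q. q \<in> {-\<delta><..<\<delta>} \<times> N \<Longrightarrow> 0 < frechet_derivative h (at (\<phi> q)) (f (\<phi> q))"
  shows "Ck_on (Suc m) ({-\<delta><..<\<delta>} \<times> N) (\<lambda>q. h (\<phi> q))"
    and "q \<in> {-\<delta><..<\<delta>} \<times> N \<Longrightarrow> 0 < frechet_derivative (\<lambda>q. h (\<phi> q)) (at q) (1, 0)"
proof -
  have box: "open ({-\<delta><..<\<delta>} \<times> N)" by (intro open_Times \<open>open N\<close>) auto
  show H: "Ck_on (Suc m) ({-\<delta><..<\<delta>} \<times> N) (\<lambda>q. h (\<phi> q))"
    by (rule Ck_on_compose[OF box subset_UNIV h \<phi>])
  assume q: "q \<in> {-\<delta><..<\<delta>} \<times> N"
  obtain t x where tx: "q = (t, x)" "t \<in> {-\<delta><..<\<delta>}" "x \<in> N" using q by auto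
  have "((\<lambda>t. (t, x)) has_vector_derivative (1, 0)) (at t)"
    by (auto intro!: has_vector_derivative_Pair derivative_eq_intros)
  moreover have "(t, x) \<in> {-\<delta><..<\<delta>} \<times> N" using tx by simp
  moreover have "Ck_on (Suc 0) ({-\<delta><..<\<delta>} \<times> N) (\<lambda>q. h (\<phi> q))" by (rule Ck_on_mono[OF H]) simp
  ultimately have "((\<lambda>t. h (\<phi> (t, x))) has_real_derivative frechet_derivative (\<lambda>q. h (\<phi> q)) (at q) (1, 0)) (at t)"
    unfolding tx(1) by (intro has_real_derivative_along_curve)
  moreover have "((\<lambda>t. h (\<phi> (t, x))) has_real_derivative frechet_derivative h (at (\<phi> (t, x))) (f (\<phi> (t, x)))) (at t)"
    by (rule has_real_derivative_along_curve[OF h UNIV_I der[OF tx(2,3)]])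
  ultimately have "frechet_derivative (\<lambda>q. h (\<phi> q)) (at q) (1, 0) = frechet_derivative h (at (\<phi> q)) (f (\<phi> q))"
    unfolding tx(1) by (rule DERIV_unique)
  then show "0 < frechet_derivative (\<lambda>q. h (\<phi> q)) (at q) (1, 0)" using pos[OF q] by simp
qed

text \<open>Near a crossing point a trajectory follows the flow \<open>\<alpha>\<close> of the incoming field up to the time
  \<open>\<tau> z\<close> of crossing and the flow \<open>\<beta>\<close> of the outgoing field afterwards. Truncating \<open>\<tau> z\<close> to
  \<open>{0..t}\<close> gives one formula for starting points on either side.\<close>

lemma local_flow_crossing:
  assumes "crossing_point Z y0"
  shows "\<exists>N d \<Phi>. y0 \<in> N \<and> local_flow Z m N d \<Phi>"
proof -
  obtain h B a b where chart: "crossing_chart Z h B a b" and "y0 \<in> B" "h y0 = 0"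
    using crossing_chart_exists[OF Z assms] by blast
  then have c: "open B" "a \<in> {1..reg_num Z}" "b \<in> {1..reg_num Z}" "a \<noteq> b" "\<And>m. Ck_on m UNIV h"
    "\<And>m. Ck_on m B (vfield Z a)" "\<And>m. Ck_on m B (vfield Z b)"
    and pos: "\<And>z. z \<in> B \<Longrightarrow> 0 < frechet_derivative h (at z) (vfield Z a z)"
    "\<And>z. z \<in> B \<Longrightarrow> 0 < frechet_derivative h (at z) (vfield Z b z)"
    and sides: "\<And>z. z \<in> B \<Longrightarrow> h z < 0 \<Longrightarrow> z \<in> region Z a" "\<And>z. z \<in> B \<Longrightarrow> h z = 0 \<Longrightarrow> crossing_point Z z"
    "\<And>z. z \<in> B \<Longrightarrow> 0 < h z \<Longrightarrow> z \<in> region Z b"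
    unfolding crossing_chart_def by blast+
  obtain \<delta>a Na \<alpha> where a: "0 < \<delta>a" "open Na" "y0 \<in> Na" "Ck_on (Suc m) ({-\<delta>a<..<\<delta>a} \<times> Na) \<alpha>"
    "\<And>x. x \<in> Na \<Longrightarrow> \<alpha> (0, x) = x"
    "\<And>t x. t \<in> {-\<delta>a<..<\<delta>a} \<Longrightarrow> x \<in> Na \<Longrightarrow> \<alpha> (t, x) \<in> B"
    "\<And>t x. t \<in> {-\<delta>a<..<\<delta>a} \<Longrightarrow> x \<in> Na \<Longrightarrow>
        ((\<lambda>s. \<alpha> (s, x)) has_vector_derivative vfield Z a (\<alpha> (t, x))) (at t)"
    by (rule local_flow_exists[OF c(1) c(6)[of "Suc m"] \<open>y0 \<in> B\<close>]) (rule that; assumption)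
  obtain \<delta>b Nb \<beta> where b: "0 < \<delta>b" "open Nb" "y0 \<in> Nb" "Ck_on (Suc m) ({-\<delta>b<..<\<delta>b} \<times> Nb) \<beta>"
    "\<And>x. x \<in> Nb \<Longrightarrow> \<beta> (0, x) = x"
    "\<And>t x. t \<in> {-\<delta>b<..<\<delta>b} \<Longrightarrow> x \<in> Nb \<Longrightarrow> \<beta> (t, x) \<in> B"
    "\<And>t x. t \<in> {-\<delta>b<..<\<delta>b} \<Longrightarrow> x \<in> Nb \<Longrightarrow>
        ((\<lambda>s. \<beta> (s, x)) has_vector_derivative vfield Z b (\<beta> (t, x))) (at t)"
    by (rule local_flow_exists[OF c(1) c(7)[of "Suc m"] \<open>y0 \<in> B\<close>]) (rule that; assumption)
  have posa: "0 < frechet_derivative h (at (\<alpha> q)) (vfield Z a (\<alpha> q))" if "q \<in> {-\<delta>a<..<\<delta>a} \<times> Na" for q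
    using pos(1) a(6)[of "fst q" "snd q"] that by auto
  have posb: "0 < frechet_derivative h (at (\<beta> q)) (vfield Z b (\<beta> q))" if "q \<in> {-\<delta>b<..<\<delta>b} \<times> Nb" for q
    using pos(2) b(6)[of "fst q" "snd q"] that by auto
  note Ha = crossing_height_increasing[OF c(5) a(2,4,7) posa]
  note Hb = crossing_height_increasing[OF c(5) b(2,4,7) posb]
  have mono_a: "h (\<alpha> (s, z)) < h (\<alpha> (t, z))"
    if "z \<in> Na" "s \<in> {-\<delta>a<..<\<delta>a}" "t \<in> {-\<delta>a<..<\<delta>a}" "s < t" for z s t
    using increasing_in_time[OF Ck_on_mono[OF Ha(1)] Ha(2) that] by simp
  have mono_b: "h (\<beta> (s, z)) < h (\<beta> (t, z))"
    if "z \<in> Nb" "s \<in> {-\<delta>b<..<\<delta>b}" "t \<in> {-\<delta>b<..<\<delta>b}" "s < t" for z s t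
    using increasing_in_time[OF Ck_on_mono[OF Hb(1)] Hb(2) that] by simp
  obtain N' \<tau> where N': "open N'" "y0 \<in> N'" "N' \<subseteq> Na" and \<tau>Ck: "Ck_on (Suc m) N' \<tau>"
    and \<tau>: "\<And>z. z \<in> N' \<Longrightarrow> \<tau> z \<in> {-\<delta>a<..<\<delta>a}" "\<And>z. z \<in> N' \<Longrightarrow> h (\<alpha> (\<tau> z, z)) = 0"
    by (rule scalar_implicit_function[OF a(2,3,1) Ha(1) _ Ha(2)]) (use a(3,5) \<open>h y0 = 0\<close> in auto)

  let ?A = "{-\<delta>a<..<\<delta>a} \<times> Na"
  have cont_\<alpha>: "continuous_on ?A \<alpha>" by (rule Ck_on_Suc_continuous[OF a(4)])
  have cont_\<beta>: "continuous_on ({-\<delta>b<..<\<delta>b} \<times> Nb) \<beta>" by (rule Ck_on_Suc_continuous[OF b(4)])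
  have "open ?A" using a(2) by (intro open_Times) auto
  \<comment> \<open>The outgoing flow must be able to start wherever the incoming one arrives, so
    times and starting points are cut down until \<open>\<alpha>\<close> takes its values in
    \<open>Nb\<close>.\<close>
  then have "open (?A \<inter> \<alpha> -` Nb)"
    by (rule continuous_open_preimage[OF cont_\<alpha> _ b(2)])
  moreover have "(0, y0) \<in> ?A \<inter> \<alpha> -` Nb" using a(1,3,5) b(3) by simp
  ultimately obtain A0 A1 where A: "open A0" "open A1" "(0, y0) \<in> A0 \<times> A1" "A0 \<times> A1 \<subseteq> ?A \<inter> \<alpha> -` Nb"
    by (rule open_prod_elim)
  obtain d0 where d0: "0 < d0" "ball 0 d0 \<subseteq> A0" using openE[OF A(1), of 0] A(3) by blast
  define d where "d = min d0 (min \<delta>a \<delta>b)"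
  define N where "N = A1 \<inter> N' \<inter> Nb"
  have "0 < d" using d0(1) a(1) b(1) by (simp add: d_def)
  have "open N" using A(2) N'(1) b(2) by (auto simp: N_def)
  have "y0 \<in> N" using A(3) N'(2) b(3) by (simp add: N_def)
  have dab: "s \<in> {-\<delta>a<..<\<delta>a}" "s \<in> {-\<delta>b<..<\<delta>b}" if "s \<in> {0..<d}" for s
    using that by (auto simp: d_def)
  have \<alpha>Nb: "\<alpha> (s, z) \<in> Nb" if "s \<in> {0..<d}" "z \<in> N" for s z
  proof -
    have "s \<in> ball 0 d0" using that(1) by (auto simp: d_def dist_norm)
    then have "(s, z) \<in> A0 \<times> A1" using d0(2) that(2) by (auto simp: N_def)
    then show ?thesis using A(4) by auto
  qed
  have NN: "z \<in> Na" "z \<in> N'" "z \<in> Nb" "z \<in> B" if "z \<in> N" for z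
    using that N'(3) a(1,5) a(6)[of 0 z] by (auto simp: N_def)
  \<comment> \<open>\<open>u t z\<close> is the time spent in the incoming field. The root
    \<open>\<tau> z\<close> is negative if \<open>z\<close> is already on the positive side and
    exceeds \<open>t\<close> if the surface has not been reached; truncation replaces it by 0 and
    \<open>t\<close> in these cases.\<close>
  define u where "u t z = max 0 (min t (\<tau> z))" for t z
  define \<Phi> where "\<Phi> t z = \<beta> (t - u t z, \<alpha> (u t z, z))" for t z
  have u: "u t z \<in> {0..<d}" "t - u t z \<in> {0..<d}" if "t \<in> {0..<d}" for t z
    using that by (auto simp: u_def)
  have before: "\<Phi> s z = \<alpha> (s, z)" if "s \<in> {0..<d}" "z \<in> N" "s \<le> \<tau> z" for s z
    using that b(5)[OF \<alpha>Nb[OF that(1,2)]] by (simp add: \<Phi>_def u_def)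
  have after: "\<Phi> s z = \<beta> (s - max 0 (\<tau> z), \<alpha> (max 0 (\<tau> z), z))" if "\<tau> z \<le> s" for s z
    using that by (simp add: \<Phi>_def u_def)
  have h0: "h z = h (\<alpha> (0, z))" if "z \<in> N" for z using a(5)[OF NN(1)[OF that]] by simp
  have in_a: "\<Phi> s z \<in> region Z a" if "s \<in> {0..<d}" "z \<in> N" "s < \<tau> z" for s z
    using mono_a[OF NN(1)[OF that(2)] dab(1)[OF that(1)] \<tau>(1)[OF NN(2)[OF that(2)]] that(3)]
      \<tau>(2)[OF NN(2)[OF that(2)]] before[OF that(1,2)] that(3) sides(1) a(6)[OF dab(1)[OF that(1)] NN(1)[OF that(2)]]
    by simp
  have in_b: "\<Phi> s z \<in> region Z b" if s: "s \<in> {0..<d}" "z \<in> N" "\<tau> z < s" for s z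
  proof -
    define \<tau>' where "\<tau>' = max 0 (\<tau> z)"
    have \<tau>': "\<tau>' \<in> {0..<d}" "s - \<tau>' \<in> {0..<d}" "0 \<in> {0..<d}" using s \<open>0 < d\<close> by (auto simp: \<tau>'_def)
    let ?w = "\<alpha> (\<tau>', z)"
    have "?w \<in> Nb" by (rule \<alpha>Nb[OF \<tau>'(1) s(2)])
    have "0 < h z" if "\<tau> z < 0"
      using mono_a[OF NN(1)[OF s(2)] \<tau>(1)[OF NN(2)[OF s(2)]] dab(1)[OF \<tau>'(3)] that]
        \<tau>(2)[OF NN(2)[OF s(2)]] h0[OF s(2)] by simp
    \<comment> \<open>If \<open>\<tau> z < 0\<close>, then \<open>?w\<close> is \<open>z\<close>
      itself, already of positive height; otherwise it lies on the surface and only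
      \<open>\<beta>\<close> raises it.\<close>
    then have w: "0 \<le> h ?w" "\<tau> z < 0 \<Longrightarrow> 0 < h ?w"
      using \<tau>(2)[OF NN(2)[OF s(2)]] h0[OF s(2)] by (auto simp: \<tau>'_def max_def not_le)
    have "0 < h (\<beta> (s - \<tau>', ?w))"
    proof (cases "s = \<tau>'")
      case True
      then have "\<tau> z < 0" using s(3) by (auto simp: \<tau>'_def max_def split: if_splits)
      then show ?thesis using w(2) b(5)[OF \<open>?w \<in> Nb\<close>] True by simp
    next
      case False
      then have "h (\<beta> (0, ?w)) < h (\<beta> (s - \<tau>', ?w))"
        using \<tau>' by (intro mono_b \<open>?w \<in> Nb\<close> dab(2)) auto
      then show ?thesis using w(1) b(5)[OF \<open>?w \<in> Nb\<close>] by simp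
    qed
    then show ?thesis
      using after[of z s] s(3) sides(3)[OF b(6)[OF dab(2)[OF \<tau>'(2)] \<open>?w \<in> Nb\<close>]] by (simp add: \<tau>'_def)
  qed
  have der_a: "((\<lambda>s. \<Phi> s z) has_vector_derivative vfield Z a (\<Phi> s z)) (at s within {0..<d} \<inter> {..\<tau> z})"
    if "s \<in> {0..<d}" "z \<in> N" "s \<le> \<tau> z" for s z
    using has_vector_derivative_at_within[OF a(7)[OF dab(1)[OF that(1)] NN(1)[OF that(2)]], of "{0..<d} \<inter> {..\<tau> z}"]
    unfolding before[OF that, symmetric]
    by (rule has_vector_derivative_transform[rotated 2]) (use that before in auto)
  have der_b: "((\<lambda>s. \<Phi> s z) has_vector_derivative vfield Z b (\<Phi> s z)) (at s within {0..<d} \<inter> {\<tau> z..})"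
    if s: "s \<in> {0..<d}" "z \<in> N" "\<tau> z \<le> s" for s z
  proof -
    define \<tau>' where "\<tau>' = max 0 (\<tau> z)"
    have \<tau>': "\<tau>' \<in> {0..<d}" "s - \<tau>' \<in> {0..<d}" using s by (auto simp: \<tau>'_def)
    have "((\<lambda>r. \<beta> (r, \<alpha> (\<tau>', z))) has_vector_derivative vfield Z b (\<Phi> s z)) (at (s - \<tau>'))"
      using b(7)[OF dab(2)[OF \<tau>'(2)] \<alpha>Nb[OF \<tau>'(1) s(2)]] after[OF s(3)] by (simp add: \<tau>'_def)
    then have "((\<lambda>r. \<beta> (1 * r + - \<tau>', \<alpha> (\<tau>', z))) has_vector_derivative 1 *\<^sub>R vfield Z b (\<Phi> s z)) (at s within {0..<d} \<inter> {\<tau> z..})"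
      by (intro has_vector_derivative_shift[where J = UNIV and \<phi> = "\<lambda>r. \<beta> (r, \<alpha> (\<tau>', z))"]) auto
    then have "((\<lambda>r. \<beta> (r - \<tau>', \<alpha> (\<tau>', z))) has_vector_derivative vfield Z b (\<Phi> s z)) (at s within {0..<d} \<inter> {\<tau> z..})"
      by simp
    then show ?thesis
      by (rule has_vector_derivative_transform[rotated 2]) (use s after \<tau>'_def in auto)
  qed
  have sol: "pws_solution Z (\<lambda>s. \<Phi> s z) {0..<d}" if z: "z \<in> N" for z
    unfolding pws_solution_iff
  proof (intro conjI ballI is_interval_co_real)
    fix s assume s: "s \<in> {0..<d}"
    consider "s < \<tau> z" | "\<tau> z < s" | "s = \<tau> z" by linarith
    then show "solution_at Z (\<lambda>s. \<Phi> s z) {0..<d} s"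
    proof cases
      case 1
      have "at s within {0..<d} = at s within {0..<d} \<inter> {..\<tau> z}"
        by (rule at_within_nhd[of _ "{..<\<tau> z}"]) (use 1 in auto)
      then show ?thesis using der_a[OF s z] in_a[OF s z 1] 1 c(2) by (intro solution_at_region) auto
    next
      case 2
      have "at s within {0..<d} = at s within {0..<d} \<inter> {\<tau> z..}"
        by (rule at_within_nhd[of _ "{\<tau> z<..}"]) (use 2 in auto)
      then show ?thesis using der_b[OF s z] in_b[OF s z 2] 2 c(3) by (intro solution_at_region) auto
    next
      case 3
      show ?thesis
      \<comment> \<open>Any window would do, since \<open>in_a\<close> and \<open>in_b\<close> hold
        on all of {0..<d}.\<close>
      proof (rule solution_at_crossing[of Z "\<lambda>s. \<Phi> s z" s a b 1])
        show "crossing_point Z (\<Phi> s z)"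
          using before[OF s z] 3 \<tau>(2)[OF NN(2)[OF z]] sides(2) a(6)[OF dab(1)[OF s] NN(1)[OF z]] by simp
      qed (use c(2-4) in_a[OF _ z] in_b[OF _ z] der_a[OF s z] der_b[OF s z] 3 in auto)
    qed
  qed
  have cont_\<tau>: "continuous_on N \<tau>"
    by (rule continuous_on_subset[OF Ck_on_Suc_continuous[OF \<tau>Ck]]) (use NN(2) in blast)
  have cont: "continuous_on N (\<Phi> t)" if t: "t \<in> {0..<d}" for t
  proof -
    have cu: "continuous_on N (u t)"
      unfolding u_def using cont_\<tau> by (intro continuous_intros)
    have "continuous_on N (\<lambda>z. \<alpha> (u t z, z))"
      by (rule continuous_on_compose2[OF cont_\<alpha>])
        (use u(1)[OF t] dab(1) NN(1) in \<open>auto intro!: continuous_intros cu\<close>)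
    then have "continuous_on N (\<lambda>z. (t - u t z, \<alpha> (u t z, z)))"
      using cu by (intro continuous_intros)
    then show ?thesis
      unfolding \<Phi>_def
      by (rule continuous_on_compose2[OF cont_\<beta>]) (use u[OF t] dab(2) \<alpha>Nb in \<open>auto\<close>)
  qed
  have smooth: "\<exists>S. open S \<and> z \<in> S \<and> Ck_on m S (\<Phi> t)"
    if t: "t \<in> {0..<d}" and z: "z \<in> N" and off: "z \<notin> switching_set Z" "\<Phi> t z \<notin> switching_set Z" for t z
  proof -
    have open_pre: "open {x \<in> N. \<tau> x \<in> A}" if "open A" for A
      using continuous_open_preimage[OF cont_\<tau> \<open>open N\<close> that] by (simp add: vimage_def Int_def)
    have subN: "{x \<in> N. \<tau> x \<in> A} \<subseteq> Na" "{x \<in> N. \<tau> x \<in> A} \<subseteq> Nb" "{x \<in> N. \<tau> x \<in> A} \<subseteq> N'" for A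
      using NN by auto
    \<comment> \<open>The truncation has its kinks at \<open>\<tau> z = 0\<close> and
      \<open>\<tau> z = t\<close>, which would put the starting point or the end point on the
      switching set. Otherwise one of three smooth formulas holds nearby: \<open>\<alpha>\<close>
      alone, \<open>\<beta>\<close> alone, or the two joined at the smooth time
      \<open>\<tau>\<close>.\<close>
    have "\<tau> z \<noteq> 0"
    proof
      assume "\<tau> z = 0"
      then have "h z = 0" using \<tau>(2)[OF NN(2)[OF z]] h0[OF z] by simp
      then show False using crossing_point_in_switching_set[OF sides(2)[OF NN(4)[OF z]]] off(1) by blast
    qed
    moreover have "\<tau> z \<noteq> t"
    proof
      assume "\<tau> z = t"
      then have "crossing_point Z (\<Phi> t z)"
        using before[OF t z] \<tau>(2)[OF NN(2)[OF z]] sides(2) a(6)[OF dab(1)[OF t] NN(1)[OF z]] by simp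
      then show False using crossing_point_in_switching_set off(2) by blast
    qed
    ultimately consider "t < \<tau> z" | "\<tau> z < 0" | "0 < \<tau> z" "\<tau> z < t" using t by fastforce
    then show ?thesis
    proof cases
      case 1
      let ?S = "{x \<in> N. \<tau> x \<in> {t<..}}"
      have S: "open ?S" by (intro open_pre) auto
      have "Ck_on (Suc m) ?S (\<lambda>x. \<alpha> (t, x))"
        by (rule Ck_on_subset[OF Ck_on_time_section[OF a(4,2) dab(1)[OF t]] subN(1)])
      then have "Ck_on (Suc m) ?S (\<Phi> t)"
        by (rule Ck_on_cong[OF S, rotated]) (use before[OF t] in auto)
      then have "Ck_on m ?S (\<Phi> t)" by (rule Ck_on_Suc_imp)
      then show ?thesis using S 1 z by (intro exI[of _ ?S]) auto
    next
      case 2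
      let ?S = "{x \<in> N. \<tau> x \<in> {..<0}}"
      have S: "open ?S" by (intro open_pre) auto
      have "Ck_on (Suc m) ?S (\<lambda>x. \<beta> (t, x))"
        by (rule Ck_on_subset[OF Ck_on_time_section[OF b(4,2) dab(2)[OF t]] subN(2)])
      then have "Ck_on (Suc m) ?S (\<Phi> t)"
        by (rule Ck_on_cong[OF S, rotated]) (use after t a(5)[OF NN(1)] in auto)
      then have "Ck_on m ?S (\<Phi> t)" by (rule Ck_on_Suc_imp)
      then show ?thesis using S 2 z by (intro exI[of _ ?S]) auto
    next
      case 3
      let ?S = "{x \<in> N. \<tau> x \<in> {0<..<t}}"
      have S: "open ?S" by (intro open_pre) auto
      have \<tau>S: "Ck_on (Suc m) ?S \<tau>" by (rule Ck_on_subset[OF \<tau>Ck subN(3)])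
      have "Ck_on (Suc m) ?S (\<lambda>x. (\<tau> x, x))"
        by (intro Ck_on_Pair S \<tau>S Ck_on_id)
      then have "Ck_on (Suc m) ?S (\<lambda>x. \<alpha> (\<tau> x, x))"
        by (rule Ck_on_compose[OF S _ a(4), rotated]) (use NN(1) t dab(1) in auto)
      then have "Ck_on (Suc m) ?S (\<lambda>x. (t - \<tau> x, \<alpha> (\<tau> x, x)))"
        by (intro Ck_on_Pair S Ck_on_diff Ck_on_const \<tau>S)
      then have "Ck_on (Suc m) ?S (\<lambda>x. \<beta> (t - \<tau> x, \<alpha> (\<tau> x, x)))"
        by (rule Ck_on_compose[OF S _ b(4), rotated]) (use \<alpha>Nb t dab(2) in auto)
      then have "Ck_on (Suc m) ?S (\<Phi> t)"
        by (rule Ck_on_cong[OF S, rotated]) (auto simp: after)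
      then have "Ck_on m ?S (\<Phi> t)" by (rule Ck_on_Suc_imp)
      then show ?thesis using S 3 z by (intro exI[of _ ?S]) auto
    qed
  qed
  have init: "\<Phi> 0 z = z" if "z \<in> N" for z
    using b(5)[OF NN(3)[OF that]] a(5)[OF NN(1)[OF that]] by (simp add: \<Phi>_def u_def min_def)
  have "local_flow Z m N d \<Phi>"
    unfolding local_flow_def
    by (intro conjI ballI impI \<open>open N\<close> \<open>0 < d\<close> sol cont smooth init)
  then show ?thesis using \<open>y0 \<in> N\<close> by blast
qed

end

section \<open>The flow along a solution\<close>

lemma pws_solution_cong:
  assumes sol: "pws_solution Z \<phi> I" and eq: "\<And>t. t \<in> I \<Longrightarrow> \<psi> t = \<phi> t"
  shows "pws_solution Z \<psi> I"
  unfolding pws_solution_iff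
proof (intro conjI ballI pws_solution_interval[OF sol])
  fix t assume t: "t \<in> I"
  have der: "(\<psi> has_vector_derivative v) (at t within J)"
    if "(\<phi> has_vector_derivative v) (at t within J)" "J \<subseteq> I" "t \<in> J" for v J
    by (rule has_vector_derivative_transform[OF that(3) _ that(1)]) (use eq that(2) in auto)
  from sol t show "solution_at Z \<psi> I t"
  proof (cases rule: pws_solution_cases)
    case (reg j)
    then show ?thesis using der[OF reg(3)] t eq[OF t] by (intro solution_at_region) auto
  next
    case (cross a b d)
    show ?thesis
    proof (rule solution_at_crossing[of Z \<psi> t a b d])
      show "(\<psi> has_vector_derivative vfield Z a (\<psi> t)) (at t within (I \<inter> {..t}))"
        "(\<psi> has_vector_derivative vfield Z b (\<psi> t)) (at t within (I \<inter> {t..}))"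
        using der[OF cross(8)] der[OF cross(9)] t eq[OF t] by auto
    qed (use cross(1-7) eq[OF t] eq in \<open>auto simp: image_subset_iff\<close>)
  qed
qed

lemma has_vector_derivative_Un:
  "(f has_vector_derivative v) (at t within I) \<Longrightarrow> (f has_vector_derivative v) (at t within J) \<Longrightarrow>
    (f has_vector_derivative v) (at t within I \<union> J)"
  unfolding has_vector_derivative_def has_derivative_within by (simp add: Lim_Un)

lemma solution_at_local:
  assumes sol: "pws_solution Z \<phi> I" "t \<in> I" and "0 < e" and eq: "I \<inter> {t-e<..<t+e} = J \<inter> {t-e<..<t+e}"
  shows "solution_at Z \<phi> J t"
proof -
  have eq': "s \<in> J \<longleftrightarrow> s \<in> I" if "s \<in> {t-e<..<t+e}" for s using eq that by blast
  have nhd: "at t within (J \<inter> A) = at t within (I \<inter> A)" for A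
    by (rule at_within_nhd[of _ "{t-e<..<t+e}"]) (use eq' \<open>0 < e\<close> in auto)
  from sol show ?thesis
  proof (cases rule: pws_solution_cases)
    case (reg j)
    then show ?thesis using nhd[of UNIV] by (intro solution_at_region) auto
  next
    case (cross a b d)
    have near: "s \<in> I" "\<bar>s - t\<bar> < d" if "s \<in> J" "\<bar>s - t\<bar> < min d e" for s
      using eq'[of s] that by (auto simp: abs_less_iff)
    show ?thesis
    proof (rule solution_at_crossing[of Z \<phi> t a b "min d e"])
      show "\<phi> s \<in> region Z a" if "s \<in> J" "t - min d e < s" "s < t" for s
      proof -
        have "\<bar>s - t\<bar> < min d e" using that(2,3) by linarith
        then show ?thesis using near[OF that(1)] that(3) cross(6) by (auto simp: image_subset_iff)
      qed
      show "\<phi> s \<in> region Z b" if "s \<in> J" "t < s" "s < t + min d e" for s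
      proof -
        have "\<bar>s - t\<bar> < min d e" using that(2,3) by linarith
        then show ?thesis using near[OF that(1)] that(2) cross(7) by (auto simp: image_subset_iff)
      qed
    qed (use cross(1-5,8,9) \<open>0 < e\<close> nhd in auto)
  qed
qed

text \<open>At the joint the point determines its region, so the derivatives from both sides are
  values of the same field and agree; no regions of the two halves have to be matched.\<close>

lemma pws_solution_join:
  assumes "piecewise_smooth Z" and sol: "pws_solution Z \<phi> {r..s}" "pws_solution Z \<phi> {s..t}"
    and "r \<le> s" "s \<le> t" and off: "\<phi> s \<notin> switching_set Z"
  shows "pws_solution Z \<phi> {r..t}"
  unfolding pws_solution_iff
proof (intro conjI ballI is_interval_cc)
  fix x assume x: "x \<in> {r..t}"
  consider "x < s" | "s < x" | "x = s" by linarith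
  then show "solution_at Z \<phi> {r..t} x"
  proof cases
    case 1
    then show ?thesis
      using x \<open>s \<le> t\<close> by (intro solution_at_local[OF sol(1), of x "s - x"]) auto
  next
    case 2
    then show ?thesis
      using x \<open>r \<le> s\<close> by (intro solution_at_local[OF sol(2), of x "x - s"]) auto
  next
    case 3
    obtain j where j: "j \<in> {1..reg_num Z}" "\<phi> s \<in> region Z j"
      using region_cover[OF assms(1) off] by blast
    have "{r..t} = {r..s} \<union> {s..t}" using \<open>r \<le> s\<close> \<open>s \<le> t\<close> by auto
    moreover have "(\<phi> has_vector_derivative vfield Z j (\<phi> s)) (at s within {r..s} \<union> {s..t})"
      by (intro has_vector_derivative_Un pws_solution_derivative_in_region[OF assms(1) sol(1) _ j]
          pws_solution_derivative_in_region[OF assms(1) sol(2) _ j]) (use \<open>r \<le> s\<close> \<open>s \<le> t\<close> in auto)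
    ultimately show ?thesis using j 3 by (intro solution_at_region) auto
  qed
qed

section \<open>Continuation of the flow along a compact arc\<close>

context
  fixes Z :: "'a::euclidean_space pws"
  assumes Z: "piecewise_smooth Z"
begin

lemma pws_solution_append:
  assumes sol: "pws_solution Z \<phi> {0..s}" "pws_solution Z \<psi> {0..t}" and "0 \<le> s" "0 \<le> t"
    and eq: "\<phi> s = \<psi> 0" and off: "\<phi> s \<notin> switching_set Z"
  shows "\<exists>\<xi>. pws_solution Z \<xi> {0..s + t} \<and> \<xi> 0 = \<phi> 0 \<and> \<xi> (s + t) = \<psi> t"
proof -
  define \<xi> where "\<xi> r = (if r \<le> s then \<phi> r else \<psi> (r - s))" for r
  have "pws_solution Z \<xi> {0..s}"
    by (rule pws_solution_cong[OF sol(1)]) (auto simp: \<xi>_def)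
  moreover have "pws_solution Z (\<lambda>r. \<psi> (r + - s)) {s..s + t}"
    by (rule pws_solution_shift[OF sol(2) is_interval_cc]) auto
  then have "pws_solution Z \<xi> {s..s + t}"
    by (rule pws_solution_cong) (auto simp: \<xi>_def eq)
  ultimately have "pws_solution Z \<xi> {0..s + t}"
    by (rule pws_solution_join[OF Z]) (use assms(3,4) off in \<open>auto simp: \<xi>_def\<close>)
  moreover have "\<xi> 0 = \<phi> 0" "\<xi> (s + t) = \<psi> t"
    using \<open>0 \<le> s\<close> \<open>0 \<le> t\<close> eq by (auto simp: \<xi>_def)
  ultimately show ?thesis by blast
qed

lemma local_flow_along_solution:
  assumes "pws_solution Z \<phi> I" "t \<in> I"
  shows "\<exists>N d \<Phi>. \<phi> t \<in> N \<and> local_flow Z m N d \<Phi>"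
  using assms
proof (cases rule: pws_solution_cases)
  case reg
  then show ?thesis using local_flow_region[OF Z] by blast
next
  case cross
  then show ?thesis using local_flow_crossing[OF Z] by blast
qed

text \<open>Regularity near \<phi> s of the flow from time s to time t, with smoothness conditional
  on both ends. The witness \<open>F\<close> stands for the flow map, so that steps can be composed
  before \<open>pws_flow\<close> is known to be well defined.\<close>

definition regular_step :: "nat \<Rightarrow> (real \<Rightarrow> 'a) \<Rightarrow> real \<Rightarrow> real \<Rightarrow> bool" where
  "regular_step m \<phi> s t \<longleftrightarrow> (\<exists>N F. open N \<and> \<phi> s \<in> N \<and> continuous_on N F \<and>
     (\<forall>z\<in>N. \<exists>\<psi>. pws_solution Z \<psi> {0..t-s} \<and> \<psi> 0 = z \<and> \<psi> (t-s) = F z) \<and>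
     (\<phi> s \<notin> switching_set Z \<longrightarrow> \<phi> t \<notin> switching_set Z \<longrightarrow> Ck_on m N F))"

lemma solution_between:
  assumes "pws_solution Z \<phi> {0..T}" "0 \<le> s" "t \<le> T"
  shows "pws_solution Z (\<lambda>r. \<phi> (r + s)) {0..t-s}"
  by (rule pws_solution_shift[OF assms(1) is_interval_cc]) (use assms in auto)

text \<open>Uniqueness identifies \<phi> with the local flow. This transfers the condition on
  \<open>\<phi> t\<close> to the end point of \<open>\<Phi>\<close>, where the smoothness of the
  local flow is conditional on it.\<close>

lemma regular_step_local:
  assumes sol: "pws_solution Z \<phi> {0..T}" and x: "x \<in> {0..T}"
  shows "\<exists>d>0. \<forall>s\<in>{0..T}. \<forall>t\<in>{0..T}. s \<le> t \<longrightarrow> \<bar>s - x\<bar> < d \<longrightarrow> \<bar>t - x\<bar> < d \<longrightarrow> regular_step m \<phi> s t"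
proof -
  obtain N d \<Phi> where "\<phi> x \<in> N" and lf: "local_flow Z m N d \<Phi>"
    using local_flow_along_solution[OF sol x] by blast
  then have "open N" "0 < d" and flow: "\<And>z. z \<in> N \<Longrightarrow> pws_solution Z (\<lambda>s. \<Phi> s z) {0..<d}"
    "\<And>z. z \<in> N \<Longrightarrow> \<Phi> 0 z = z" "\<And>t. t \<in> {0..<d} \<Longrightarrow> continuous_on N (\<Phi> t)"
    and smooth: "\<And>t z. t \<in> {0..<d} \<Longrightarrow> z \<in> N \<Longrightarrow> z \<notin> switching_set Z \<Longrightarrow> \<Phi> t z \<notin> switching_set Z \<Longrightarrow>
      \<exists>S. open S \<and> z \<in> S \<and> Ck_on m S (\<Phi> t)"
    unfolding local_flow_def by blast+
  obtain d1 where "0 < d1" and d1: "\<And>s. s \<in> {0..T} \<Longrightarrow> \<bar>s - x\<bar> < d1 \<Longrightarrow> \<phi> s \<in> N"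
    using pws_solution_stays_in_open[OF Z sol x \<open>open N\<close> \<open>\<phi> x \<in> N\<close>] by blast
  have "regular_step m \<phi> s t"
    if st: "s \<in> {0..T}" "t \<in> {0..T}" "s \<le> t" "\<bar>s - x\<bar> < min d1 (d/2)" "\<bar>t - x\<bar> < min d1 (d/2)" for s t
  proof -
    have "\<phi> s \<in> N" using d1 st by simp
    have "\<bar>s - x\<bar> < d/2" "\<bar>t - x\<bar> < d/2" using st(4,5) by simp_all
    then have "t - s < d" by linarith
    then have ts: "t - s \<in> {0..<d}" using st(3) by simp
    have sub: "pws_solution Z (\<lambda>s. \<Phi> s z) {0..t-s}" if "z \<in> N" for z
      by (rule pws_solution_subset[OF flow(1)[OF that] is_interval_cc]) (use ts in auto)
    have "\<phi> (t - s + s) = \<Phi> (t - s) (\<phi> s)"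
      by (rule pws_solution_unique[OF Z solution_between[OF sol] sub[OF \<open>\<phi> s \<in> N\<close>]])
        (use st ts flow(2)[OF \<open>\<phi> s \<in> N\<close>] in auto)
    then have end_eq: "\<phi> t = \<Phi> (t - s) (\<phi> s)" by simp
    obtain S where S: "open S" "\<phi> s \<in> S"
      "\<phi> s \<notin> switching_set Z \<Longrightarrow> \<phi> t \<notin> switching_set Z \<Longrightarrow> Ck_on m S (\<Phi> (t - s))"
    proof (cases "\<phi> s \<notin> switching_set Z \<and> \<phi> t \<notin> switching_set Z")
      case True
      then show ?thesis using smooth[OF ts \<open>\<phi> s \<in> N\<close>] end_eq that by auto
    next
      case False
      then show ?thesis using that[of UNIV] by auto
    qed
    show ?thesis
      unfolding regular_step_def
    proof (intro exI[of _ "N \<inter> S"] exI[of _ "\<Phi> (t - s)"] conjI ballI impI)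
      show "continuous_on (N \<inter> S) (\<Phi> (t - s))"
        by (rule continuous_on_subset[OF flow(3)[OF ts]]) simp
      show "\<exists>\<psi>. pws_solution Z \<psi> {0..t-s} \<and> \<psi> 0 = z \<and> \<psi> (t-s) = \<Phi> (t - s) z" if "z \<in> N \<inter> S" for z
        using sub[of z] flow(2)[of z] that by (intro exI[of _ "\<lambda>s. \<Phi> s z"]) auto
      show "Ck_on m (N \<inter> S) (\<Phi> (t - s))" if "\<phi> s \<notin> switching_set Z" "\<phi> t \<notin> switching_set Z"
        by (rule Ck_on_subset[OF S(3)[OF that]]) simp
    qed (use \<open>open N\<close> S \<open>\<phi> s \<in> N\<close> in auto)
  qed
  then show ?thesis using \<open>0 < d\<close> \<open>0 < d1\<close> by (intro exI[of _ "min d1 (d/2)"]) auto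
qed

text \<open>Every nearby solution, not only \<phi>, has to be concatenated off the switching set.
  That set is closed, so restricting \<open>N1\<close> to starting points whose intermediate point
  avoids it leaves an open neighbourhood.\<close>

lemma regular_step_trans:
  assumes sol: "pws_solution Z \<phi> {0..T}" and "0 \<le> s" "s \<le> x" "x \<le> t" "t \<le> T" and off: "\<phi> x \<notin> switching_set Z"
    and 1: "regular_step m \<phi> s x" and 2: "regular_step m \<phi> x t"
  shows "regular_step m \<phi> s t"
proof -
  obtain N1 F1 where N1: "open N1" "\<phi> s \<in> N1" "continuous_on N1 F1"
    "\<And>z. z \<in> N1 \<Longrightarrow> \<exists>\<psi>. pws_solution Z \<psi> {0..x-s} \<and> \<psi> 0 = z \<and> \<psi> (x-s) = F1 z"
    "\<phi> s \<notin> switching_set Z \<Longrightarrow> \<phi> x \<notin> switching_set Z \<Longrightarrow> Ck_on m N1 F1"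
    using 1 unfolding regular_step_def by blast
  obtain N2 F2 where N2: "open N2" "\<phi> x \<in> N2" "continuous_on N2 F2"
    "\<And>z. z \<in> N2 \<Longrightarrow> \<exists>\<psi>. pws_solution Z \<psi> {0..t-x} \<and> \<psi> 0 = z \<and> \<psi> (t-x) = F2 z"
    "\<phi> x \<notin> switching_set Z \<Longrightarrow> \<phi> t \<notin> switching_set Z \<Longrightarrow> Ck_on m N2 F2"
    using 2 unfolding regular_step_def by blast
  have "F1 (\<phi> s) = \<phi> x"
  proof -
    obtain \<psi> where \<psi>: "pws_solution Z \<psi> {0..x-s}" "\<psi> 0 = \<phi> s" "\<psi> (x-s) = F1 (\<phi> s)" using N1(4)[OF N1(2)] by blast
    have "\<phi> (x - s + s) = \<psi> (x - s)"
      by (rule pws_solution_unique[OF Z solution_between[OF sol] \<psi>(1)]) (use \<psi>(2) assms in auto)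
    then show ?thesis using \<psi>(3) by simp
  qed
  define N where "N = N1 \<inter> F1 -` (N2 - switching_set Z)"
  have "open N"
    unfolding N_def
    by (rule continuous_open_preimage[OF N1(3,1)]) (intro open_Diff N2(1) closed_switching_set[OF Z])
  have F1N: "F1 z \<in> N2" "F1 z \<notin> switching_set Z" "z \<in> N1" if "z \<in> N" for z using that by (auto simp: N_def)
  show ?thesis
    unfolding regular_step_def
  proof (intro exI[of _ N] exI[of _ "\<lambda>z. F2 (F1 z)"] conjI ballI impI)
    show "open N" by fact
    show "\<phi> s \<in> N" using N1(2) N2(2) off \<open>F1 (\<phi> s) = \<phi> x\<close> by (simp add: N_def)
    have contF1: "continuous_on N F1" by (rule continuous_on_subset[OF N1(3)]) (use F1N in auto)
    show "continuous_on N (\<lambda>z. F2 (F1 z))"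
      by (rule continuous_on_compose2[OF N2(3) contF1]) (use F1N in auto)
    show "\<exists>\<psi>. pws_solution Z \<psi> {0..t-s} \<and> \<psi> 0 = z \<and> \<psi> (t-s) = F2 (F1 z)" if z: "z \<in> N" for z
    proof -
      obtain \<psi>1 where \<psi>1: "pws_solution Z \<psi>1 {0..x-s}" "\<psi>1 0 = z" "\<psi>1 (x-s) = F1 z"
        using N1(4)[OF F1N(3)[OF z]] by blast
      obtain \<psi>2 where \<psi>2: "pws_solution Z \<psi>2 {0..t-x}" "\<psi>2 0 = F1 z" "\<psi>2 (t-x) = F2 (F1 z)"
        using N2(4)[OF F1N(1)[OF z]] by blast
      have "x - s + (t - x) = t - s" by simp
      then show ?thesis
        using pws_solution_append[OF \<psi>1(1) \<psi>2(1)] \<psi>1(2,3) \<psi>2(2,3) F1N(2)[OF z] assms(3,4) by auto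
    qed
    assume "\<phi> s \<notin> switching_set Z" "\<phi> t \<notin> switching_set Z"
    then have "Ck_on m N F1" "Ck_on m N2 F2"
      using N1(5) N2(5) off by (auto intro: Ck_on_subset simp: N_def)
    then show "Ck_on m N (\<lambda>z. F2 (F1 z))"
      by (intro Ck_on_compose[OF \<open>open N\<close> _ \<open>Ck_on m N2 F2\<close>]) (use F1N in auto)
  qed
qed

text \<open>Just before a crossing the definition of a solution places it in a region, which
  supplies regular times as close as desired.\<close>

lemma off_switching_set_before:
  assumes sol: "pws_solution Z \<phi> {0..T}" and x: "0 < x" "x \<le> T" and "0 < e"
  shows "\<exists>y\<in>{0..T}. x - e < y \<and> y \<le> x \<and> \<phi> y \<notin> switching_set Z"
proof -
  have "x \<in> {0..T}" using x by simp
  from sol this show ?thesis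
  proof (cases rule: pws_solution_cases)
    case (reg j)
    then show ?thesis using region_subset[OF Z reg(1)] x \<open>0 < e\<close> by (intro bexI[of _ x]) auto
  next
    case (cross a b d)
    define y where "y = x - min (min d e) x / 2"
    have y: "y \<in> {0..T}" "x - d < y" "x - e < y" "y < x"
      using cross(4) x \<open>0 < e\<close> unfolding y_def by (auto simp: min_def field_simps)
    then have "\<phi> y \<in> region Z a" using cross(6) by auto
    then show ?thesis using region_subset[OF Z cross(2)] y by (intro bexI[of _ y]) auto
  qed
qed

text \<open>Steps can only be composed at points off the switching set. Allowing the end points of a step
  to move a little makes the property of being a regular step compose everywhere.\<close>

theorem regular_step_solution:
  assumes sol: "pws_solution Z \<phi> {0..T}" and "0 \<le> T"
  shows "regular_step m \<phi> 0 T"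
proof -
  define P where "P a b \<longleftrightarrow> 0 \<le> a \<longrightarrow> b \<le> T \<longrightarrow> (\<exists>e>0. \<forall>s\<in>{0..T}. \<forall>t\<in>{0..T}. s \<le> t \<longrightarrow>
    \<bar>s - a\<bar> < e \<longrightarrow> \<bar>t - b\<bar> < e \<longrightarrow> regular_step m \<phi> s t)" for a b
  have "P 0 T"
    using \<open>0 \<le> T\<close>
  proof (induction rule: Bolzano)
    case (trans a b c)
    consider "a = b" | "b = c" | "a < b" "b < c" using trans(3,4) by linarith
    then show ?case
    proof cases
      case 3
      show ?thesis
        unfolding P_def
      proof (intro impI)
        assume "0 \<le> a" "c \<le> T"
        then obtain e1 where "0 < e1" and e1: "\<And>s t. s \<in> {0..T} \<Longrightarrow> t \<in> {0..T} \<Longrightarrow> s \<le> t \<Longrightarrow>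
            \<bar>s - a\<bar> < e1 \<Longrightarrow> \<bar>t - b\<bar> < e1 \<Longrightarrow> regular_step m \<phi> s t"
          using trans(1) 3 unfolding P_def by auto
        obtain e2 where "0 < e2" and e2: "\<And>s t. s \<in> {0..T} \<Longrightarrow> t \<in> {0..T} \<Longrightarrow> s \<le> t \<Longrightarrow>
            \<bar>s - b\<bar> < e2 \<Longrightarrow> \<bar>t - c\<bar> < e2 \<Longrightarrow> regular_step m \<phi> s t"
          using trans(2) 3 \<open>0 \<le> a\<close> \<open>c \<le> T\<close> unfolding P_def by auto
        \<comment> \<open>Since 2 * e is at most both gaps, s \<le> y \<le> t holds for all s near
          \<open>a\<close> and t near \<open>c\<close>, where y is a regular time in (b - e, b] that
          replaces \<open>b\<close>.\<close>
        define e where "e = min (min e1 e2) (min (b - a) (c - b) / 2)"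
        have e: "0 < e" "e \<le> e1" "e \<le> e2" "2 * e \<le> b - a" "2 * e \<le> c - b"
          using \<open>0 < e1\<close> \<open>0 < e2\<close> 3 by (auto simp: e_def min_def)
        obtain y where y: "y \<in> {0..T}" "b - e < y" "y \<le> b" "\<phi> y \<notin> switching_set Z"
          using off_switching_set_before[OF sol, of b e] e(1) 3 \<open>0 \<le> a\<close> \<open>c \<le> T\<close> by auto
        have "regular_step m \<phi> s t"
          if st: "s \<in> {0..T}" "t \<in> {0..T}" "s \<le> t" "\<bar>s - a\<bar> < e" "\<bar>t - c\<bar> < e" for s t
        proof (rule regular_step_trans[OF sol _ _ _ _ y(4)])
          have "\<bar>y - b\<bar> < e" using y by simp
          then have "\<bar>s - a\<bar> < e1" "\<bar>y - b\<bar> < e1" "\<bar>y - b\<bar> < e2" "\<bar>t - c\<bar> < e2"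
            using st(4,5) e(2,3) by simp_all
          moreover show "s \<le> y" using st(4) y(2) e(4) by linarith
          moreover show "y \<le> t" using st(5) y(3) e(5) by linarith
          ultimately show "regular_step m \<phi> s y" "regular_step m \<phi> y t"
            by (auto intro: e1[OF st(1) y(1)] e2[OF y(1) st(2)])
        qed (use st in auto)
        then show "\<exists>e>0. \<forall>s\<in>{0..T}. \<forall>t\<in>{0..T}. s \<le> t \<longrightarrow>
            \<bar>s - a\<bar> < e \<longrightarrow> \<bar>t - c\<bar> < e \<longrightarrow> regular_step m \<phi> s t"
          by (intro exI[of _ e] conjI ballI impI e(1))
      qed
    qed (use trans(1,2) in auto)
  next
    case (local x)
    then have "x \<in> {0..T}" by simp
    then obtain d where "0 < d" and d: "\<And>s t. s \<in> {0..T} \<Longrightarrow> t \<in> {0..T} \<Longrightarrow> s \<le> t \<Longrightarrow>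
        \<bar>s - x\<bar> < d \<Longrightarrow> \<bar>t - x\<bar> < d \<Longrightarrow> regular_step m \<phi> s t"
      using regular_step_local[OF sol] by blast
    \<comment> \<open>The end points of an interval of length below d / 2 around \<open>x\<close>,
      moved by less than d / 2, stay within d of \<open>x\<close>.\<close>
    have "P a b" if "a \<le> x" "x \<le> b" "b - a < d / 2" for a b
      unfolding P_def
    proof (intro impI exI[of _ "d / 2"] conjI ballI)
      fix s t assume st: "s \<in> {0..T}" "t \<in> {0..T}" "s \<le> t" and s: "\<bar>s - a\<bar> < d / 2" and t: "\<bar>t - b\<bar> < d / 2"
      have "\<bar>s - x\<bar> < d" using s that by linarith
      moreover have "\<bar>t - x\<bar> < d" using t that by linarith
      ultimately show "regular_step m \<phi> s t" using d[OF st] by blast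
    qed (use \<open>0 < d\<close> in simp)
    then show ?case using \<open>0 < d\<close> by (intro exI[of _ "d / 2"]) auto
  qed
  then show ?thesis using \<open>0 \<le> T\<close> unfolding P_def by auto
qed

text \<open>Uniqueness makes the description in \<open>pws_flow\<close> proper, so that any solution
  computes the flow.\<close>

lemma pws_flow_eq:
  assumes "pws_solution Z \<psi> {0..t}" "0 \<le> t"
  shows "pws_flow Z t (\<psi> 0) = \<psi> t"
proof -
  have seg: "closed_segment 0 t = {0..t}" using assms(2) by (simp add: closed_segment_eq_real_ivl)
  show ?thesis
    unfolding pws_flow_def seg
  proof (rule the_equality)
    show "\<exists>\<phi>. pws_solution Z \<phi> {0..t} \<and> \<phi> 0 = \<psi> 0 \<and> \<phi> t = \<psi> t" using assms(1) by blast
    fix y assume "\<exists>\<phi>. pws_solution Z \<phi> {0..t} \<and> \<phi> 0 = \<psi> 0 \<and> \<phi> t = y"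
    then obtain \<phi> where "pws_solution Z \<phi> {0..t}" "\<phi> 0 = \<psi> 0" "\<phi> t = y" by blast
    then show "y = \<psi> t" using pws_solution_unique[OF Z _ assms(1), of \<phi> t] assms(2) by auto
  qed
qed

theorem pws_flow_regular:
  assumes "solution_exists Z {0..t} z" "0 \<le> t"
  obtains N where "open N" "z \<in> N" "\<And>w. w \<in> N \<Longrightarrow> solution_exists Z {0..t} w"
    "continuous_on N (pws_flow Z t)"
    "z \<notin> switching_set Z \<Longrightarrow> pws_flow Z t z \<notin> switching_set Z \<Longrightarrow> Ck_on m N (pws_flow Z t)"
proof -
  obtain \<phi> where \<phi>: "pws_solution Z \<phi> {0..t}" "\<phi> 0 = z" using assms(1) by (auto simp: solution_exists_def)
  then have \<phi>t: "\<phi> t = pws_flow Z t z" using pws_flow_eq[OF \<phi>(1) assms(2)] by simp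
  obtain N F where N: "open N" "z \<in> N" "continuous_on N F"
    "\<And>w. w \<in> N \<Longrightarrow> \<exists>\<psi>. pws_solution Z \<psi> {0..t} \<and> \<psi> 0 = w \<and> \<psi> t = F w"
    and Ck: "z \<notin> switching_set Z \<Longrightarrow> pws_flow Z t z \<notin> switching_set Z \<Longrightarrow> Ck_on m N F"
    using regular_step_solution[OF \<phi>(1) assms(2), of m] unfolding regular_step_def \<phi>(2) \<phi>t by auto
  have F: "F w = pws_flow Z t w" if "w \<in> N" for w
    using N(4)[OF that] pws_flow_eq[OF _ assms(2)] by metis
  show thesis
  proof (rule that[OF N(1,2)])
    show "solution_exists Z {0..t} w" if "w \<in> N" for w
      using N(4)[OF that] unfolding solution_exists_def by blast
    show "continuous_on N (pws_flow Z t)"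
      using N(3) F by (simp add: cong: continuous_on_cong)
    show "Ck_on m N (pws_flow Z t)" if "z \<notin> switching_set Z" "pws_flow Z t z \<notin> switching_set Z"
      by (rule Ck_on_cong[OF N(1) F Ck[OF that]])
  qed
qed

end

lemma pws_flow_reverse:
  assumes Z: "piecewise_smooth Z" and "solution_exists Z {0..t} z" "0 \<le> t"
  shows "solution_exists (rev_pws Z) {0..t} (pws_flow Z t z)"
    and "pws_flow (rev_pws Z) t (pws_flow Z t z) = z"
proof -
  obtain \<phi> where \<phi>: "pws_solution Z \<phi> {0..t}" "\<phi> 0 = z" using assms(2) by (auto simp: solution_exists_def)
  then have \<phi>t: "\<phi> t = pws_flow Z t z" using pws_flow_eq[OF Z \<phi>(1) assms(3)] by simp
  note rev = pws_solution_reverse[OF \<phi>(1)]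
  show "solution_exists (rev_pws Z) {0..t} (pws_flow Z t z)"
    unfolding solution_exists_def using rev \<phi>t by (intro exI[of _ "\<lambda>s. \<phi> (t - s)"]) simp
  show "pws_flow (rev_pws Z) t (pws_flow Z t z) = z"
    using pws_flow_eq[OF piecewise_smooth_rev[OF Z] rev assms(3)] \<phi>t \<phi>(2) by simp
qed

section \<open>The time-T map of the perturbed system\<close>

text \<open>The last coordinate has the same speed in all regions, so its one-sided derivatives
  agree even at crossings.\<close>

lemma snd_pws_solution:
  fixes W :: "('a::euclidean_space \<times> real) pws"
  assumes sol: "pws_solution W \<phi> {0..T}" and c: "\<And>j z. snd (vfield W j z) = c" and "s \<in> {0..T}"
  shows "snd (\<phi> s) = snd (\<phi> 0) + c * s"
proof -
  have der: "((\<lambda>s. snd (\<phi> s)) has_vector_derivative c) (at s within {0..T})" if "s \<in> {0..T}" for s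
    using sol that
  proof (cases rule: pws_solution_cases)
    case (reg j)
    then show ?thesis
      using bounded_linear.has_vector_derivative[OF bounded_linear_snd reg(3)] by (simp add: c)
  next
    case (cross a b d)
    have "((\<lambda>s. snd (\<phi> s)) has_vector_derivative c) (at s within {0..T} \<inter> {..s} \<union> {0..T} \<inter> {s..})"
      using bounded_linear.has_vector_derivative[OF bounded_linear_snd cross(8)]
        bounded_linear.has_vector_derivative[OF bounded_linear_snd cross(9)]
      by (intro has_vector_derivative_Un) (simp_all add: c)
    moreover have "{0..T} \<inter> {..s} \<union> {0..T} \<inter> {s..} = {0..T}" by auto
    ultimately show ?thesis by simp
  qed
  have "((\<lambda>s. snd (\<phi> s) - c * s) has_derivative (\<lambda>h. 0)) (at s within {0..T})" if "s \<in> {0..T}" for s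
  proof -
    have "((\<lambda>s. c * s) has_vector_derivative c) (at s within {0..T})"
      by (auto intro!: derivative_eq_intros simp flip: has_real_derivative_iff_has_vector_derivative)
    from has_vector_derivative_diff[OF der[OF that] this] show ?thesis
      by (simp add: has_vector_derivative_def)
  qed
  then have "snd (\<phi> s) - c * s = snd (\<phi> 0) - c * 0"
    using assms(3) by (intro has_derivative_zero_unique[of "{0..T}" "\<lambda>s. snd (\<phi> s) - c * s"]) auto
  then show ?thesis by simp
qed

section \<open>Maps between time slices\<close>

context
  fixes W :: "('a::euclidean_space \<times> real) pws" and \<Sigma> :: "'a set" and c t \<tau> :: real
  assumes W: "piecewise_smooth W" and speed: "\<And>j z. snd (vfield W j z) = c"
    and \<Sigma>: "switching_set W = \<Sigma> \<times> UNIV" and \<tau>: "0 \<le> \<tau>"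
begin

lemma pws_flow_slice:
  assumes "solution_exists W {0..\<tau>} (x, t)"
  shows "pws_flow W \<tau> (x, t) = (fst (pws_flow W \<tau> (x, t)), t + c * \<tau>)"
proof -
  obtain \<phi> where \<phi>: "pws_solution W \<phi> {0..\<tau>}" "\<phi> 0 = (x, t)" using assms by (auto simp: solution_exists_def)
  have "\<phi> \<tau> = pws_flow W \<tau> (x, t)" using pws_flow_eq[OF W \<phi>(1) \<tau>] \<phi>(2) by simp
  moreover have "snd (\<phi> \<tau>) = t + c * \<tau>" using snd_pws_solution[OF \<phi>(1) speed] \<tau> \<phi>(2) by simp
  ultimately show ?thesis by (metis prod.collapse)
qed

text \<open>Slices are mapped to slices and the switching set is a product, so the conditions on the
  flow in the product space reduce to conditions on first components.\<close>

lemma slice_map_regular: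
  assumes ex: "solution_exists W {0..\<tau>} (x, t)"
  obtains N where "open N" "x \<in> N" "\<And>y. y \<in> N \<Longrightarrow> solution_exists W {0..\<tau>} (y, t)"
    "continuous_on N (\<lambda>x. fst (pws_flow W \<tau> (x, t)))"
    "x \<notin> \<Sigma> \<Longrightarrow> fst (pws_flow W \<tau> (x, t)) \<notin> \<Sigma> \<Longrightarrow> Ck_on m N (\<lambda>x. fst (pws_flow W \<tau> (x, t)))"
proof -
  obtain N where N: "open N" "(x, t) \<in> N" "\<And>w. w \<in> N \<Longrightarrow> solution_exists W {0..\<tau>} w"
    "continuous_on N (pws_flow W \<tau>)"
    "(x, t) \<notin> switching_set W \<Longrightarrow> pws_flow W \<tau> (x, t) \<notin> switching_set W \<Longrightarrow> Ck_on m N (pws_flow W \<tau>)"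
    by (rule pws_flow_regular[OF W ex \<tau>, of m]) (rule that; assumption)
  define N' where "N' = (\<lambda>x. (x, t)) -` N"
  have "open N'" unfolding N'_def by (intro open_vimage N(1) continuous_intros)
  show thesis
  proof (rule that[OF \<open>open N'\<close>])
    show "x \<in> N'" using N(2) by (simp add: N'_def)
    show "solution_exists W {0..\<tau>} (y, t)" if "y \<in> N'" for y using N(3) that by (simp add: N'_def)
    have "continuous_on N' (\<lambda>x. pws_flow W \<tau> (x, t))"
      by (rule continuous_on_compose2[OF N(4)]) (auto simp: N'_def intro!: continuous_intros)
    then show "continuous_on N' (\<lambda>x. fst (pws_flow W \<tau> (x, t)))" by (intro continuous_intros)
    assume off: "x \<notin> \<Sigma>" "fst (pws_flow W \<tau> (x, t)) \<notin> \<Sigma>"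
    have "pws_flow W \<tau> (x, t) \<notin> switching_set W"
      using off(2) by (subst pws_flow_slice[OF ex]) (simp add: \<Sigma>)
    then have "Ck_on m N (pws_flow W \<tau>)" using N(5) off(1) by (simp add: \<Sigma>)
    moreover have "Ck_on m N' (\<lambda>x. (x, t))"
      by (rule Ck_on_Pair[OF \<open>open N'\<close> Ck_on_id[OF \<open>open N'\<close>] Ck_on_const])
    moreover have "(\<lambda>x. (x, t)) ` N' \<subseteq> N" by (auto simp: N'_def)
    ultimately have "Ck_on m N' (\<lambda>x. pws_flow W \<tau> (x, t))"
      using Ck_on_compose[OF \<open>open N'\<close>, of "\<lambda>x. (x, t)" N m "pws_flow W \<tau>"] by blast
    then show "Ck_on m N' (\<lambda>x. fst (pws_flow W \<tau> (x, t)))" by (rule Ck_on_fst[OF \<open>open N'\<close>])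
  qed
qed

lemma slice_map_continuous:
  assumes "\<And>x. x \<in> U \<Longrightarrow> solution_exists W {0..\<tau>} (x, t)"
  shows "continuous_on U (\<lambda>x. fst (pws_flow W \<tau> (x, t)))"
proof (intro continuous_at_imp_continuous_on ballI)
  fix x assume "x \<in> U"
  obtain N where "open N" "x \<in> N" "continuous_on N (\<lambda>x. fst (pws_flow W \<tau> (x, t)))"
    by (rule slice_map_regular[OF assms[OF \<open>x \<in> U\<close>]]) (rule that; assumption)
  then show "isCont (\<lambda>x. fst (pws_flow W \<tau> (x, t))) x" by (simp add: continuous_on_eq_continuous_at)
qed

text \<open>The neighbourhood supplied for the order m depends on m, but the map does not;
  \<open>Ck_on_local\<close> therefore yields every order on the same set.\<close>

lemma slice_map_Ck:
  assumes "\<And>x. x \<in> D \<Longrightarrow> solution_exists W {0..\<tau>} (x, t)"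
    and "\<And>x. x \<in> D \<Longrightarrow> x \<notin> \<Sigma>" "\<And>x. x \<in> D \<Longrightarrow> fst (pws_flow W \<tau> (x, t)) \<notin> \<Sigma>"
  shows "smooth_on D (\<lambda>x. fst (pws_flow W \<tau> (x, t)))"
  unfolding smooth_on_def
proof (intro allI Ck_on_local)
  fix m x assume "x \<in> D"
  obtain N where "open N" "x \<in> N"
    "x \<notin> \<Sigma> \<Longrightarrow> fst (pws_flow W \<tau> (x, t)) \<notin> \<Sigma> \<Longrightarrow> Ck_on m N (\<lambda>x. fst (pws_flow W \<tau> (x, t)))"
    by (rule slice_map_regular[OF assms(1)[OF \<open>x \<in> D\<close>], of m]) (rule that; assumption)
  then show "\<exists>N. open N \<and> x \<in> N \<and> Ck_on m N (\<lambda>x. fst (pws_flow W \<tau> (x, t)))"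
    using assms(2,3)[OF \<open>x \<in> D\<close>] by blast
qed

end

text \<open>The inverse is the reversed flow, started at the time coordinate t + c * \<tau> that was
  reached. For openness of the image, the reversed flow exists on a neighbourhood of each image
  point, and the points there that it sends into \<open>U\<close> are images themselves, as a second
  reversal shows.\<close>

theorem slice_map_homeomorphism:
  fixes W :: "('a::euclidean_space \<times> real) pws"
  assumes W: "piecewise_smooth W" and speed: "\<And>j z. snd (vfield W j z) = c"
    and \<Sigma>: "switching_set W = \<Sigma> \<times> UNIV" and \<tau>: "0 \<le> \<tau>"
    and "open U" and ex: "\<And>x. x \<in> U \<Longrightarrow> solution_exists W {0..\<tau>} (x, t)"
  defines "p \<equiv> \<lambda>x. fst (pws_flow W \<tau> (x, t))"
    and "g \<equiv> \<lambda>y. fst (pws_flow (rev_pws W) \<tau> (y, t + c * \<tau>))"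
  shows "open (p ` U)" "homeomorphism U (p ` U) p g"
    and "(\<And>x. x \<in> U \<Longrightarrow> x \<notin> \<Sigma>) \<Longrightarrow> (\<And>x. x \<in> U \<Longrightarrow> p x \<notin> \<Sigma>) \<Longrightarrow> smooth_on U p \<and> smooth_on (p ` U) g"
proof -
  note rW = piecewise_smooth_rev[OF W]
  have rspeed: "snd (vfield (rev_pws W) j z) = - c" for j z by (simp add: speed)
  have r\<Sigma>: "switching_set (rev_pws W) = \<Sigma> \<times> UNIV" by (simp add: \<Sigma>)
  have flow: "pws_flow W \<tau> (x, t) = (p x, t + c * \<tau>)" if "x \<in> U" for x
    unfolding p_def by (rule pws_flow_slice[OF W speed \<Sigma> \<tau> ex[OF that]])
  have rex: "solution_exists (rev_pws W) {0..\<tau>} (y, t + c * \<tau>)" if "y \<in> p ` U" for y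
    using that pws_flow_reverse(1)[OF W ex \<tau>] flow by fastforce
  have gp: "g (p x) = x" if "x \<in> U" for x
    using pws_flow_reverse(2)[OF W ex[OF that] \<tau>] flow[OF that] by (simp add: g_def)
  have contg: "continuous_on (p ` U) g"
    unfolding g_def by (rule slice_map_continuous[OF rW rspeed r\<Sigma> \<tau> rex])
  have contp: "continuous_on U p"
    unfolding p_def by (rule slice_map_continuous[OF W speed \<Sigma> \<tau> ex])
  show "open (p ` U)"
  proof (subst open_subopen, intro ballI)
    fix y assume y: "y \<in> p ` U"
    obtain N where N: "open N" "y \<in> N" "\<And>w. w \<in> N \<Longrightarrow> solution_exists (rev_pws W) {0..\<tau>} (w, t + c * \<tau>)"
      "continuous_on N g"
    proof (rule slice_map_regular[OF rW rspeed r\<Sigma> \<tau> rex[OF y], of 0])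
      fix N assume "open N" "y \<in> N" "\<And>w. w \<in> N \<Longrightarrow> solution_exists (rev_pws W) {0..\<tau>} (w, t + c * \<tau>)"
        "continuous_on N (\<lambda>y. fst (pws_flow (rev_pws W) \<tau> (y, t + c * \<tau>)))"
      then show thesis by (rule that[unfolded g_def])
    qed
    have "open (N \<inter> g -` U)" by (rule continuous_open_preimage[OF N(4,1) \<open>open U\<close>])
    moreover have "y \<in> N \<inter> g -` U" using N(2) y gp by auto
    moreover have "w \<in> p ` U" if w: "w \<in> N \<inter> g -` U" for w
    proof -
      have "solution_exists (rev_pws W) {0..\<tau>} (w, t + c * \<tau>)" using w N(3) by blast
      from pws_flow_reverse(2)[OF rW this \<tau>] pws_flow_slice[OF rW rspeed r\<Sigma> \<tau> this]
      have "pws_flow W \<tau> (g w, t) = (w, t + c * \<tau>)" by (simp add: g_def)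
      then have "p (g w) = w" by (simp add: p_def)
      then show ?thesis using w by (metis IntD2 imageI vimage_eq)
    qed
    ultimately show "\<exists>T. open T \<and> y \<in> T \<and> T \<subseteq> p ` U" by blast
  qed
  show "homeomorphism U (p ` U) p g"
    unfolding homeomorphism_def using contp contg gp by force
  assume off: "\<And>x. x \<in> U \<Longrightarrow> x \<notin> \<Sigma>" "\<And>x. x \<in> U \<Longrightarrow> p x \<notin> \<Sigma>"
  have "smooth_on U p"
    unfolding p_def by (rule slice_map_Ck[OF W speed \<Sigma> \<tau> ex]) (use off in \<open>auto simp: p_def\<close>)
  moreover have "smooth_on (p ` U) g"
    unfolding g_def by (rule slice_map_Ck[OF rW rspeed r\<Sigma> \<tau> rex]) (use off gp in \<open>auto simp: g_def\<close>)
  ultimately show "smooth_on U p \<and> smooth_on (p ` U) g" ..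
qed

section \<open>The perturbed system as a piecewise smooth field\<close>

lemma components_Times_UNIV:
  fixes S :: "'a::topological_space set"
  shows "components (S \<times> (UNIV :: 'b::real_normed_vector set)) = (\<lambda>C. C \<times> UNIV) ` components S"
proof -
  have Times: "C \<times> UNIV \<in> components (S \<times> (UNIV :: 'b set))" if C: "C \<in> components S" for C
  proof -
    have "C \<noteq> {}" "C \<subseteq> S" "connected C"
      using C in_components_nonempty in_components_subset in_components_connected by blast+
    have max: "D = C \<times> UNIV" if D: "D \<noteq> {}" "C \<times> UNIV \<subseteq> D" "D \<subseteq> S \<times> UNIV" "connected D" for D :: "('a \<times> 'b) set"
    proof -
      \<comment> \<open>The projection of a connected superset is a connected subset of
        \<open>S\<close> that meets \<open>C\<close>, hence lies in \<open>C\<close>.\<close>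
      have "connected (fst ` D)"
        by (rule connected_continuous_image[OF _ D(4)]) (intro continuous_intros)
      moreover have "fst ` D \<subseteq> S" using D(3) by auto
      moreover have "C \<subseteq> fst ` D" using D(2) by force
      then have "C \<inter> fst ` D \<noteq> {}" using \<open>C \<noteq> {}\<close> by blast
      ultimately have "fst ` D \<subseteq> C" using components_maximal[OF C] by blast
      then show ?thesis using D(2) by force
    qed
    have "connected (C \<times> (UNIV :: 'b set))"
      by (rule connected_Times[OF \<open>connected C\<close> connected_UNIV])
    moreover have "C \<times> (UNIV :: 'b set) \<noteq> {}" "C \<times> (UNIV :: 'b set) \<subseteq> S \<times> UNIV"
      using \<open>C \<noteq> {}\<close> \<open>C \<subseteq> S\<close> by auto
    ultimately show ?thesis
      unfolding in_components_maximal by (intro conjI allI impI max) (assumption | elim conjE)+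
  qed
  have "D \<in> (\<lambda>C. C \<times> UNIV) ` components S" if D: "D \<in> components (S \<times> (UNIV :: 'b set))" for D
  proof -
    obtain x y where xy: "(x, y) \<in> D" using in_components_nonempty[OF D] by auto
    then have "x \<in> S" using in_components_subset[OF D] by auto
    then obtain C where C: "C \<in> components S" "x \<in> C" using Union_components[of S] by blast
    have "D = C \<times> UNIV"
      using components_nonoverlap[OF D Times[OF C(1)]] xy C(2) by blast
    then show ?thesis using C(1) by blast
  qed
  then show ?thesis using Times by blast
qed

lemma perturbed_simps [simp]:
  "sw_num (perturbed Z X1 \<epsilon>) = sw_num Z" "sw_fun (perturbed Z X1 \<epsilon>) i (x, t) = sw_fun Z i x"
  "reg_num (perturbed Z X1 \<epsilon>) = reg_num Z" "region (perturbed Z X1 \<epsilon>) j = region Z j \<times> UNIV"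
  "vfield (perturbed Z X1 \<epsilon>) j (x, t) = (vfield Z j x + \<epsilon> *\<^sub>R X1 j x t, 1)"
  by (simp_all add: perturbed_def)

lemma switching_set_perturbed: "switching_set (perturbed Z X1 \<epsilon>) = switching_set Z \<times> UNIV"
  by (auto simp: mem_switching_set)

text \<open>The point to check is that the products of the regions with the time axis are exactly
  the components of the complement of the new switching set; \<open>components_Times_UNIV\<close>
  settles it.\<close>

lemma piecewise_smooth_perturbed:
  assumes Z: "piecewise_smooth Z" and X1: "periodic_perturbation Z T X1"
  shows "piecewise_smooth (perturbed Z X1 \<epsilon>)"
  unfolding piecewise_smooth_def
proof (intro conjI ballI)
  show "1 \<le> sw_num (perturbed Z X1 \<epsilon>)" "2 \<le> reg_num (perturbed Z X1 \<epsilon>)"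
    using Z by (simp_all add: piecewise_smooth_def)
  show "smooth_on UNIV (sw_fun (perturbed Z X1 \<epsilon>) i)" if "i \<in> {1..sw_num (perturbed Z X1 \<epsilon>)}" for i
  proof -
    have "smooth_on UNIV (sw_fun Z i)" using Z that by (simp add: piecewise_smooth_def)
    then have "Ck_on m UNIV (\<lambda>z::'a \<times> real. sw_fun Z i (fst z))" for m
      by (rule Ck_on_compose[OF open_UNIV subset_UNIV smooth_onD
            Ck_on_bounded_linear[OF open_UNIV bounded_linear_fst]])
    moreover have "sw_fun (perturbed Z X1 \<epsilon>) i = (\<lambda>z. sw_fun Z i (fst z))"
      by (auto simp: fun_eq_iff)
    ultimately show ?thesis by (simp add: smooth_on_def)
  qed
  have bij: "bij_betw (region Z) {1..reg_num Z} (components (- switching_set Z))"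
    using Z by (simp add: piecewise_smooth_def)
  have "inj_on (\<lambda>C. C \<times> (UNIV :: real set)) (components (- switching_set Z))"
    by (rule inj_onI) (auto dest!: arg_cong[where f = "image fst"])
  then have "bij_betw (\<lambda>C. C \<times> (UNIV :: real set)) (components (- switching_set Z))
      (components ((- switching_set Z) \<times> UNIV))"
    unfolding components_Times_UNIV by (rule inj_on_imp_bij_betw)
  from bij_betw_trans[OF bij this]
  have "bij_betw (\<lambda>j. region Z j \<times> (UNIV :: real set)) {1..reg_num Z} (components ((- switching_set Z) \<times> UNIV))"
    by (simp add: o_def)
  moreover have "- switching_set (perturbed Z X1 \<epsilon>) = (- switching_set Z) \<times> UNIV"
    unfolding switching_set_perturbed by auto
  moreover have "region (perturbed Z X1 \<epsilon>) = (\<lambda>j. region Z j \<times> UNIV)" by (auto simp: fun_eq_iff)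
  ultimately show "bij_betw (region (perturbed Z X1 \<epsilon>)) {1..reg_num (perturbed Z X1 \<epsilon>)}
      (components (- switching_set (perturbed Z X1 \<epsilon>)))"
    by simp
  fix j assume "j \<in> {1..reg_num (perturbed Z X1 \<epsilon>)}"
  then have j: "j \<in> {1..reg_num Z}" by simp
  obtain W where W: "open W" "closure (region Z j) \<subseteq> W" "smooth_on W (vfield Z j)"
    using Z j unfolding piecewise_smooth_def by blast
  obtain W1 where W1: "open W1" "closure (region Z j) \<subseteq> W1" "smooth_on (W1 \<times> UNIV) (\<lambda>(x, t). X1 j x t)"
    using X1 j unfolding periodic_perturbation_def by blast
  let ?W = "(W \<inter> W1) \<times> (UNIV :: real set)"
  have "open ?W" using W(1) W1(1) by (intro open_Times open_Int) auto
  have "Ck_on m ?W (vfield (perturbed Z X1 \<epsilon>) j)" for m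
  proof -
    have "Ck_on m ?W fst" by (rule Ck_on_bounded_linear[OF \<open>open ?W\<close> bounded_linear_fst])
    then have "Ck_on m ?W (\<lambda>z. vfield Z j (fst z))"
      by (rule Ck_on_compose[OF \<open>open ?W\<close> _ smooth_onD[OF W(3)], rotated]) auto
    moreover have "Ck_on m ?W (\<lambda>(x, t). X1 j x t)"
      by (rule Ck_on_subset[OF smooth_onD[OF W1(3)]]) auto
    ultimately have "Ck_on m ?W (\<lambda>z. (vfield Z j (fst z) + \<epsilon> *\<^sub>R (case z of (x, t) \<Rightarrow> X1 j x t), 1::real))"
      by (intro Ck_on_Pair Ck_on_add Ck_on_scaleR Ck_on_const \<open>open ?W\<close>)
    moreover have "vfield (perturbed Z X1 \<epsilon>) j = (\<lambda>z. (vfield Z j (fst z) + \<epsilon> *\<^sub>R (case z of (x, t) \<Rightarrow> X1 j x t), 1))"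
      by (auto simp: fun_eq_iff)
    ultimately show ?thesis by simp
  qed
  moreover have "closure (region (perturbed Z X1 \<epsilon>) j) \<subseteq> ?W"
    using W(2) W1(2) by (auto simp: closure_Times)
  ultimately show "\<exists>W. open W \<and> closure (region (perturbed Z X1 \<epsilon>) j) \<subseteq> W \<and> smooth_on W (vfield (perturbed Z X1 \<epsilon>) j)"
    using \<open>open ?W\<close> by (auto simp: smooth_on_def)
qed

lemma solution_exists_subset:
  "solution_exists Z I z \<Longrightarrow> is_interval J \<Longrightarrow> J \<subseteq> I \<Longrightarrow> solution_exists Z J z"
  unfolding solution_exists_def using pws_solution_subset by blast

text \<open>The slice theorem is used three times: for time t from \<open>U0\<close>, for time T on
  \<open>U\<close>, and for time T on the part \<open>D\<close> of \<open>U\<close> where both ends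
  avoid the switching set.\<close>

lemma time_T_map_admissible:
  assumes Z: "piecewise_smooth Z" and X1: "periodic_perturbation Z T X1"
    and adm: "admissible_domain Z X1 T \<Gamma> \<epsilon> U0" and t: "t \<in> {0..<T}"
  defines "U \<equiv> time_slice Z X1 \<epsilon> U0 t" and "P \<equiv> time_T_map Z X1 T \<epsilon> t"
  shows "\<exists>g. homeomorphism U (P ` U) P g"
    and "let D = U - (switching_set Z \<union> P -` switching_set Z) in \<exists>g. diffeomorphism D (P ` D) P g"
proof -
  let ?W = "perturbed Z X1 \<epsilon>"
  note W = piecewise_smooth_perturbed[OF Z X1, of \<epsilon>]
  have speed: "snd (vfield ?W j z) = 1" for j z by (cases z) simp
  note slice = slice_map_homeomorphism[OF W speed switching_set_perturbed]
  have "0 \<le> t" "0 \<le> T" using t by auto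
  have ex: "solution_exists ?W {0..s} (x, r)" if "solution_exists ?W {-T..T} (x, r)" "s \<le> T" for s x r
    by (rule solution_exists_subset[OF that(1) is_interval_cc]) (use that(2) \<open>0 \<le> T\<close> in auto)
  have "open U0" using adm by (simp add: admissible_domain_def)
  \<comment> \<open>\<open>admissible_domain\<close> asks for an open set at time 0; the slice map
    for time t carries openness to the slice over t.\<close>
  then have "open U"
    unfolding U_def time_slice_def
    by (rule slice(1)[OF \<open>0 \<le> t\<close>]) (use adm t in \<open>auto simp: admissible_domain_def intro!: ex\<close>)
  have exU: "solution_exists ?W {0..T} (x, t)" if "x \<in> U" for x
    using adm t that ex unfolding admissible_domain_def U_def by blast
  have P: "P = (\<lambda>x. fst (pws_flow ?W T (x, t)))" by (simp add: P_def time_T_map_def fun_eq_iff)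
  note homeo = slice(2)[OF \<open>0 \<le> T\<close> \<open>open U\<close> exU, folded P]
  show "\<exists>g. homeomorphism U (P ` U) P g" using homeo by blast
  define D where "D = U - (switching_set Z \<union> P -` switching_set Z)"
  have "open (U \<inter> P -` (- switching_set Z))"
    using homeo closed_switching_set[OF Z] \<open>open U\<close>
    by (intro continuous_open_preimage) (auto simp: homeomorphism_def)
  moreover have "D = (U \<inter> P -` (- switching_set Z)) - switching_set Z" by (auto simp: D_def)
  ultimately have "open D" using closed_switching_set[OF Z] by (simp add: open_Diff)
  have exD: "solution_exists ?W {0..T} (x, t)" if "x \<in> D" for x using exU that by (simp add: D_def)
  note sliceD = slice[OF \<open>0 \<le> T\<close> \<open>open D\<close> exD, folded P]
  have "\<exists>g. diffeomorphism D (P ` D) P g"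
  proof (intro exI)
    have "smooth_on D P \<and> smooth_on (P ` D) (\<lambda>y. fst (pws_flow (rev_pws ?W) T (y, t + 1 * T)))"
      by (rule sliceD(3)) (auto simp: D_def P)
    then show "diffeomorphism D (P ` D) P (\<lambda>y. fst (pws_flow (rev_pws ?W) T (y, t + 1 * T)))"
      unfolding diffeomorphism_def using \<open>open D\<close> sliceD(1,2) by simp
  qed
  then show "let D = U - (switching_set Z \<union> P -` switching_set Z) in \<exists>g. diffeomorphism D (P ` D) P g"
    unfolding D_def Let_def .
qed

theorem proposition5:
  fixes Z :: "(real^'n) pws"
    and X1 :: "nat \<Rightarrow> real^'n \<Rightarrow> real \<Rightarrow> real^'n"
    and T :: real
    and p0 q0 :: "real^'n"
    and \<Gamma> :: "(real^'n) set"
    and U0 :: "real \<Rightarrow> (real^'n) set"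
    and U V :: "real \<Rightarrow> real \<Rightarrow> (real^'n) set"
    and P :: "real \<Rightarrow> real \<Rightarrow> real^'n \<Rightarrow> real^'n"
  assumes "CARD('n) \<ge> 2"
    and "piecewise_smooth Z"
    and "p0 \<notin> switching_set Z" and "hyperbolic_saddle Z p0"
    and "q0 \<in> (stable_manifold Z p0 \<inter> unstable_manifold Z p0) - {p0}"
    and "\<forall>x\<in>orbit Z q0 \<inter> switching_set Z. crossing_point Z x"
    and "\<Gamma> = {p0} \<union> orbit Z q0"
    and "T > 0" and "periodic_perturbation Z T X1"
    and "\<forall>\<^sub>F \<epsilon> in at_right 0. admissible_domain Z X1 T \<Gamma> \<epsilon> (U0 \<epsilon>)"
    and "\<And>\<epsilon> t. U \<epsilon> t = time_slice Z X1 \<epsilon> (U0 \<epsilon>) t"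
    and "\<And>\<epsilon> t. P \<epsilon> t = time_T_map Z X1 T \<epsilon> t"
    and "\<And>\<epsilon> t. V \<epsilon> t = P \<epsilon> t ` U \<epsilon> t"
  shows "\<forall>\<^sub>F \<epsilon> in at_right 0.
      (\<forall>t\<in>{0..<T}. \<exists>g. homeomorphism (U \<epsilon> t) (V \<epsilon> t) (P \<epsilon> t) g) \<and>
      (\<forall>t\<in>{0..<T}. let D = U \<epsilon> t - (switching_set Z \<union> P \<epsilon> t -` switching_set Z) in
         \<exists>g. diffeomorphism D (P \<epsilon> t ` D) (P \<epsilon> t) g)"
  using assms(10)
proof (rule eventually_mono)
  \<comment> \<open>Both claims hold for each \<epsilon> with an admissible domain; smallness of
    \<epsilon> enters through the existence of such a domain.\<close>
  fix \<epsilon> assume adm: "admissible_domain Z X1 T \<Gamma> \<epsilon> (U0 \<epsilon>)"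
  show "(\<forall>t\<in>{0..<T}. \<exists>g. homeomorphism (U \<epsilon> t) (V \<epsilon> t) (P \<epsilon> t) g) \<and>
      (\<forall>t\<in>{0..<T}. let D = U \<epsilon> t - (switching_set Z \<union> P \<epsilon> t -` switching_set Z) in
         \<exists>g. diffeomorphism D (P \<epsilon> t ` D) (P \<epsilon> t) g)"
    unfolding assms(11-13)
    using time_T_map_admissible[OF \<open>piecewise_smooth Z\<close> \<open>periodic_perturbation Z T X1\<close> adm] by blast
qed

end
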